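(* Assume $\mathsf{ZF}+\mathsf{AC}_\omega$ (the countable axiom of choice). Then surjective cardinals form a surjective cardinal algebra; that is, the class of surjective cardinals, equipped with the finitary addition $+$ and the countable sum $\sum_{n\in\omega}$, satisfies the postulates I, II, III, IV, V, VI$'$ and VII listed in the context.
   Context: For sets $X,Y$, a partial surjection from $X$ onto $Y$ is a function $f$ with $\mathrm{dom}(f)\subseteq X$ and $\mathrm{ran}(f)=Y$. For cardinals $\mathfrak{a},\mathfrak{b}$ write $\mathfrak{a}=^\ast\mathfrak{b}$ if there are sets $X,Y$ of cardinalities $\mathfrak{a},\mathfrak{b}$ such that there are partial surjections from $X$ onto $Y$ and from $Y$ onto $X$. A surjective cardinal is an $=^\ast$-equivalence class of cardinals (made into a set by Scott's trick: the members of minimal rank). Addition and countable sums of surjective cardinals are induced by cardinal addition (disjoint unions) and countable cardinal sums $\sum_{n\in\omega}\mathfrak{a}_n$ (cardinality of $\bigcup_n X_n\times\{n\}$ with $|X_n|=\mathfrak{a}_n$). A surjective cardinal algebra is a system $\langle A,+,\sum\rangle$ satisfying: I: if $a,b\in A$ then $a+b\in A$. II: if $a_n\in A$ for all $n\in\omega$ then $\sum_{n\in\omega}a_n\in A$. III: if $a_n\in A$ for all $n$ then $\sum_{n\in\omega}a_n=a_0+\sum_{n\in\omega}a_{n+1}$. IV: if $a_n,b_n\in A$ for all $n$ then $\sum_{n}(a_n+b_n)=\sum_n a_n+\sum_n b_n$. V: there is $0\in A$ with $a+0=0+a=a$ for all $a\in A$. VI$'$ (finite refinement): if $a_1,a_2,b_1,b_2\in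 A$ and $a_1+a_2=b_1+b_2$, then there are $c_1,c_2,c_3,c_4\in A$ with $a_1=c_1+c_2$, $a_2=c_3+c_4$, $b_1=c_1+c_3$, $b_2=c_2+c_4$. VII (remainder): if $a_n,b_n\in A$ and $a_n=a_{n+1}+b_n$ for all $n\in\omega$, then there is $c\in A$ with $a_m=c+\sum_{n\in\omega}b_{m+n}$ for all $m\in\omega$. *)

theory Defs
  imports Main
begin

text \<open>
  HOL has a global choice operator, so a theorem of ZF plus countable choice cannot be stated
  about HOL sets without silently assuming full choice. It is therefore stated about an
  arbitrary first-order structure whose universe is a type and whose membership relation is
  \<open>mem\<close>. Separation and Replacement range over first-order formulas only, given by the datatype
  \<open>fm\<close>; if they ranged over all HOL predicates, every model would satisfy full choice.
  All sets, functions and sequences below are elements of the structure.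
\<close>

datatype fm = FMem nat nat | FEq nat nat | FNeg fm | FConj fm fm | FAll nat fm

context
  fixes mem :: "'a \<Rightarrow> 'a \<Rightarrow> bool" (infix "\<^bold>\<in>" 50)
begin

primrec sat :: "fm \<Rightarrow> (nat \<Rightarrow> 'a) \<Rightarrow> bool" where
  "sat (FMem i j) s \<longleftrightarrow> s i \<^bold>\<in> s j"
| "sat (FEq i j) s \<longleftrightarrow> s i = s j"
| "sat (FNeg p) s \<longleftrightarrow> \<not> sat p s"
| "sat (FConj p q) s \<longleftrightarrow> sat p s \<and> sat q s"
| "sat (FAll i p) s \<longleftrightarrow> (\<forall>x. sat p (s(i := x)))"

text \<open>In the two schemes the assignment \<open>s\<close> supplies the parameters.\<close>

definition ZF :: bool where
  "ZF \<longleftrightarrow>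
    \<comment> \<open>Extensionality\<close>
    (\<forall>x y. (\<forall>z. z \<^bold>\<in> x \<longleftrightarrow> z \<^bold>\<in> y) \<longrightarrow> x = y) \<and>
    \<comment> \<open>Foundation\<close>
    (\<forall>x. (\<exists>y. y \<^bold>\<in> x) \<longrightarrow> (\<exists>y. y \<^bold>\<in> x \<and> \<not> (\<exists>z. z \<^bold>\<in> x \<and> z \<^bold>\<in> y))) \<and>
    \<comment> \<open>Pairing\<close>
    (\<forall>x y. \<exists>u. \<forall>z. z \<^bold>\<in> u \<longleftrightarrow> z = x \<or> z = y) \<and>
    \<comment> \<open>Union\<close>
    (\<forall>x. \<exists>u. \<forall>z. z \<^bold>\<in> u \<longleftrightarrow> (\<exists>y. y \<^bold>\<in> x \<and> z \<^bold>\<in> y)) \<and>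
    \<comment> \<open>Power set\<close>
    (\<forall>x. \<exists>u. \<forall>z. z \<^bold>\<in> u \<longleftrightarrow> (\<forall>y. y \<^bold>\<in> z \<longrightarrow> y \<^bold>\<in> x)) \<and>
    \<comment> \<open>Infinity\<close>
    (\<exists>u. (\<exists>e. e \<^bold>\<in> u \<and> (\<forall>z. \<not> z \<^bold>\<in> e)) \<and>
         (\<forall>n. n \<^bold>\<in> u \<longrightarrow> (\<exists>m. m \<^bold>\<in> u \<and> (\<forall>z. z \<^bold>\<in> m \<longleftrightarrow> z \<^bold>\<in> n \<or> z = n)))) \<and>
    \<comment> \<open>Separation\<close>
    (\<forall>p s x. \<exists>u. \<forall>z. z \<^bold>\<in> u \<longleftrightarrow> z \<^bold>\<in> x \<and> sat p (s(0 := z))) \<and>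
    \<comment> \<open>Replacement\<close>
    (\<forall>p s x. (\<forall>y. y \<^bold>\<in> x \<longrightarrow> (\<exists>!z. sat p (s(0 := y, 1 := z)))) \<longrightarrow>
       (\<exists>u. \<forall>z. z \<^bold>\<in> u \<longleftrightarrow> (\<exists>y. y \<^bold>\<in> x \<and> sat p (s(0 := y, 1 := z)))))"

text \<open>Unspecified if no element of the structure has extension \<open>P\<close>.\<close>

definition the_set :: "('a \<Rightarrow> bool) \<Rightarrow> 'a" where
  "the_set P = (THE u. \<forall>z. z \<^bold>\<in> u \<longleftrightarrow> P z)"

definition subset_of :: "'a \<Rightarrow> 'a \<Rightarrow> bool" (infix "\<^bold>\<subseteq>" 50) where
  "x \<^bold>\<subseteq> y \<longleftrightarrow> (\<forall>z. z \<^bold>\<in> x \<longrightarrow> z \<^bold>\<in> y)"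

definition zero :: 'a where
  "zero = the_set (\<lambda>z. False)"

definition succ :: "'a \<Rightarrow> 'a" where
  "succ x = the_set (\<lambda>z. z \<^bold>\<in> x \<or> z = x)"

definition omega :: 'a where
  "omega = the_set (\<lambda>n. \<forall>u. zero \<^bold>\<in> u \<and> (\<forall>k. k \<^bold>\<in> u \<longrightarrow> succ k \<^bold>\<in> u) \<longrightarrow> n \<^bold>\<in> u)"

definition upair :: "'a \<Rightarrow> 'a \<Rightarrow> 'a" where
  "upair x y = the_set (\<lambda>z. z = x \<or> z = y)"

definition opair :: "'a \<Rightarrow> 'a \<Rightarrow> 'a" where
  "opair x y = upair (upair x x) (upair x y)"

definition is_function :: "'a \<Rightarrow> bool" where
  "is_function f \<longleftrightarrow>
    (\<forall>p. p \<^bold>\<in> f \<longrightarrow> (\<exists>x y. p = opair x y)) \<and>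
    (\<forall>x y z. opair x y \<^bold>\<in> f \<and> opair x z \<^bold>\<in> f \<longrightarrow> y = z)"

definition domain_of :: "'a \<Rightarrow> 'a" where
  "domain_of f = the_set (\<lambda>x. \<exists>y. opair x y \<^bold>\<in> f)"

definition range_of :: "'a \<Rightarrow> 'a" where
  "range_of f = the_set (\<lambda>y. \<exists>x. opair x y \<^bold>\<in> f)"

definition app :: "'a \<Rightarrow> 'a \<Rightarrow> 'a" (infixl "\<^bold>`" 90) where
  "f \<^bold>` x = (THE y. opair x y \<^bold>\<in> f)"

definition sequence :: "'a \<Rightarrow> bool" where
  "sequence a \<longleftrightarrow> is_function a \<and> domain_of a = omega"

text \<open>The sequence \<open>\<langle>t n : n \<in> \<omega>\<rangle>\<close> as an element of the structure.\<close>

definition seq_of :: "('a \<Rightarrow> 'a) \<Rightarrow> 'a" where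
  "seq_of t = the_set (\<lambda>p. \<exists>n. n \<^bold>\<in> omega \<and> p = opair n (t n))"

definition nat_add :: "'a \<Rightarrow> 'a \<Rightarrow> 'a" where
  "nat_add m n = (THE k. \<exists>f. sequence f \<and> f \<^bold>` zero = m \<and>
     (\<forall>i. i \<^bold>\<in> omega \<longrightarrow> f \<^bold>` succ i = succ (f \<^bold>` i)) \<and> k = f \<^bold>` n)"

definition AC_omega :: bool where
  "AC_omega \<longleftrightarrow>
    (\<forall>X. sequence X \<and> (\<forall>n. n \<^bold>\<in> omega \<longrightarrow> (\<exists>x. x \<^bold>\<in> X \<^bold>` n)) \<longrightarrow>
      (\<exists>f. sequence f \<and> (\<forall>n. n \<^bold>\<in> omega \<longrightarrow> f \<^bold>` n \<^bold>\<in> X \<^bold>` n)))"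

text \<open>\<open>rank x = \<Union>{succ (rank y) | y \<in> x}\<close>, by recursion on a transitive set containing \<open>x\<close>.\<close>

definition rank_function :: "'a \<Rightarrow> 'a \<Rightarrow> bool" where
  "rank_function r t \<longleftrightarrow> is_function r \<and> domain_of r = t \<and>
    (\<forall>x. x \<^bold>\<in> t \<longrightarrow> (\<forall>z. z \<^bold>\<in> r \<^bold>` x \<longleftrightarrow> (\<exists>y. y \<^bold>\<in> x \<and> z \<^bold>\<in> succ (r \<^bold>` y))))"

definition rank :: "'a \<Rightarrow> 'a" where
  "rank x = (THE k. \<exists>t r. (\<forall>y. y \<^bold>\<in> t \<longrightarrow> y \<^bold>\<subseteq> t) \<and> x \<^bold>\<in> t \<and> rank_function r t \<and> k = r \<^bold>` x)"

text \<open>Scott's trick: the elements of minimal rank of the class \<open>P\<close>.\<close>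

definition scott :: "('a \<Rightarrow> bool) \<Rightarrow> 'a" where
  "scott P = the_set (\<lambda>x. P x \<and> (\<forall>y. P y \<longrightarrow> rank x \<^bold>\<subseteq> rank y))"

definition equipotent :: "'a \<Rightarrow> 'a \<Rightarrow> bool" where
  "equipotent X Y \<longleftrightarrow> (\<exists>f. is_function f \<and> domain_of f = X \<and> range_of f = Y \<and>
     (\<forall>x x'. x \<^bold>\<in> X \<and> x' \<^bold>\<in> X \<and> f \<^bold>` x = f \<^bold>` x' \<longrightarrow> x = x'))"

definition card_of :: "'a \<Rightarrow> 'a" where
  "card_of X = scott (\<lambda>Y. equipotent X Y)"

definition cardinal :: "'a \<Rightarrow> bool" where
  "cardinal a \<longleftrightarrow> (\<exists>X. a = card_of X)"

definition card_add :: "'a \<Rightarrow> 'a \<Rightarrow> 'a" where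
  "card_add a b = (THE c. \<exists>X Y. card_of X = a \<and> card_of Y = b \<and>
     c = card_of (the_set (\<lambda>p. (\<exists>x. x \<^bold>\<in> X \<and> p = opair x zero) \<or>
                               (\<exists>y. y \<^bold>\<in> Y \<and> p = opair y (succ zero)))))"

definition card_sum :: "'a \<Rightarrow> 'a" where
  "card_sum a = (THE c. \<exists>X. sequence X \<and> (\<forall>n. n \<^bold>\<in> omega \<longrightarrow> card_of (X \<^bold>` n) = a \<^bold>` n) \<and>
     c = card_of (the_set (\<lambda>p. \<exists>n x. n \<^bold>\<in> omega \<and> x \<^bold>\<in> X \<^bold>` n \<and> p = opair x n)))"

definition partial_surjection :: "'a \<Rightarrow> 'a \<Rightarrow> 'a \<Rightarrow> bool" where
  "partial_surjection f X Y \<longleftrightarrow> is_function f \<and> domain_of f \<^bold>\<subseteq> X \<and> range_of f = Y"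

definition eq_star :: "'a \<Rightarrow> 'a \<Rightarrow> bool" where
  "eq_star a b \<longleftrightarrow> (\<exists>X Y. card_of X = a \<and> card_of Y = b \<and>
     (\<exists>f. partial_surjection f X Y) \<and> (\<exists>g. partial_surjection g Y X))"

definition surj_class :: "'a \<Rightarrow> 'a" where
  "surj_class a = scott (\<lambda>b. cardinal b \<and> eq_star a b)"

definition surjective_cardinal :: "'a \<Rightarrow> bool" where
  "surjective_cardinal A \<longleftrightarrow> (\<exists>a. cardinal a \<and> A = surj_class a)"

text \<open>
  The operations induced on surjective cardinals. Each description denotes only if the result
  does not depend on the representatives.
\<close>

definition surj_add :: "'a \<Rightarrow> 'a \<Rightarrow> 'a" where
  "surj_add A B = (THE C. \<exists>a b. cardinal a \<and> cardinal b \<and> surj_class a = A \<and> surj_class b = B \<and>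
     C = surj_class (card_add a b))"

definition surj_sum :: "'a \<Rightarrow> 'a" where
  "surj_sum A = (THE C. \<exists>a. sequence a \<and>
     (\<forall>n. n \<^bold>\<in> omega \<longrightarrow> cardinal (a \<^bold>` n) \<and> surj_class (a \<^bold>` n) = A \<^bold>` n) \<and>
     C = surj_class (card_sum a))"

definition sequence_in :: "('a \<Rightarrow> bool) \<Rightarrow> 'a \<Rightarrow> bool" where
  "sequence_in A a \<longleftrightarrow> sequence a \<and> (\<forall>n. n \<^bold>\<in> omega \<longrightarrow> A (a \<^bold>` n))"

text \<open>
  The carrier \<open>A\<close> may be a proper class of the structure, hence a predicate; \<open>S\<close> maps a sequence
  (an element of the structure) to its sum.
\<close>

definition surjective_cardinal_algebra ::
  "('a \<Rightarrow> bool) \<Rightarrow> ('a \<Rightarrow> 'a \<Rightarrow> 'a) \<Rightarrow> ('a \<Rightarrow> 'a) \<Rightarrow> bool" where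
  "surjective_cardinal_algebra A add S \<longleftrightarrow>
    (\<forall>a b. A a \<and> A b \<longrightarrow> A (add a b)) \<and>
    (\<forall>a. sequence_in A a \<longrightarrow> A (S a)) \<and>
    (\<forall>a. sequence_in A a \<longrightarrow> S a = add (a \<^bold>` zero) (S (seq_of (\<lambda>n. a \<^bold>` succ n)))) \<and>
    (\<forall>a b. sequence_in A a \<and> sequence_in A b \<longrightarrow>
       S (seq_of (\<lambda>n. add (a \<^bold>` n) (b \<^bold>` n))) = add (S a) (S b)) \<and>
    (\<exists>z. A z \<and> (\<forall>a. A a \<longrightarrow> add a z = a \<and> add z a = a)) \<and>
    \<comment> \<open>finite refinement\<close>
    (\<forall>a1 a2 b1 b2. A a1 \<and> A a2 \<and> A b1 \<and> A b2 \<and> add a1 a2 = add b1 b2 \<longrightarrow>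
       (\<exists>c1 c2 c3 c4. A c1 \<and> A c2 \<and> A c3 \<and> A c4 \<and>
          a1 = add c1 c2 \<and> a2 = add c3 c4 \<and> b1 = add c1 c3 \<and> b2 = add c2 c4)) \<and>
    \<comment> \<open>remainder\<close>
    (\<forall>a b. sequence_in A a \<and> sequence_in A b \<and>
       (\<forall>n. n \<^bold>\<in> omega \<longrightarrow> a \<^bold>` n = add (a \<^bold>` succ n) (b \<^bold>` n)) \<longrightarrow>
       (\<exists>c. A c \<and> (\<forall>m. m \<^bold>\<in> omega \<longrightarrow>
          a \<^bold>` m = add c (S (seq_of (\<lambda>n. b \<^bold>` nat_add m n))))))"

end

end

theory Submission
  imports Defs
begin

text \<open>
  Write \<open>X \<preceq> Y\<close> if some partial function maps \<open>Y\<close> onto \<open>X\<close>, and say that \<open>A\<close> absorbs \<open>Y\<close> if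
  \<open>A + Y \<preceq> A\<close>. Three facts about absorption carry the proof. Countably many absorbed sets are
  absorbed simultaneously. A set absorbed by \<open>A\<^sub>1 + A\<^sub>2\<close> splits into a part absorbed by \<open>A\<^sub>1\<close> and a
  part absorbed by \<open>A\<^sub>2\<close>. If \<open>f\<close> maps \<open>A\<close> onto \<open>B\<close> and \<open>g\<close> maps \<open>B\<close> onto \<open>A\<close>, then every
  \<open>T \<subseteq> B\<close> and its preimage under \<open>f\<close> agree up to subsets absorbed by \<open>A\<close>: the points of the
  preimage without a predecessor of the same kind under the iterates of \<open>g f\<close> sit below infinite
  trees outside the preimage, which absorb them. Finite refinement follows by distributing the
  absorbed pieces. For the remainder postulate, the set \<open>C\<^sub>m\<close> of points of \<open>A\<^sub>m\<close> that never reach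
  any \<open>B\<^sub>n\<close> is, after removal of absorbed parts, an increasing chain in \<open>m\<close>; its limit,
  enlarged by a set that every \<open>A\<^sub>m\<close> absorbs, is the remainder.

  The natural numbers of the structure may be nonstandard, so induction and recursion apply to
  first-order definable properties only, and each of them needs a definability proof.
\<close>

text \<open>Without choice, surjections in both directions need not yield a bijection, so a
  decomposition of one side cannot simply be carried to the other. First returns under
  \<open>g f\<close> recover every point of a preimage that has an earlier point of its own kind.
  Any other point still has predecessors without end, because both maps are onto, and these provide
  the room that absorbs it. Equivalence of corresponding parts is thus available only up to sets
  absorbed by the whole, and refinement requires each such error to be charged to one particular
  summand; this is why absorbed sets have to be split. In the remainder postulate the errors depend
  on the index, and absorption passes from \<open>A\<^sub>m\<^sub>+\<^sub>1\<close> down to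
  \<open>A\<^sub>m\<close> but in general not upwards, so an error found at \<open>m\<close> has to
  be cut down to what later terms absorb too. Countable choice selects representatives, witnessing
  surjections and errors, after the classes of candidates have been reduced to sets by minimal rank.
  The rules collected under \<open>Dr\<close> make a definability proof follow the shape of the
  expression.\<close>

named_theorems Dr

section \<open>Definability with parameters\<close>

primrec vars :: "fm \<Rightarrow> nat set" where
  "vars (FMem i j) = {i, j}"
| "vars (FEq i j) = {i, j}"
| "vars (FNeg p) = vars p"
| "vars (FConj p q) = vars p \<union> vars q"
| "vars (FAll i p) = insert i (vars p)"

primrec ren :: "(nat \<Rightarrow> nat) \<Rightarrow> fm \<Rightarrow> fm" where
  "ren r (FMem i j) = FMem (r i) (r j)"
| "ren r (FEq i j) = FEq (r i) (r j)"
| "ren r (FNeg p) = FNeg (ren r p)"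
| "ren r (FConj p q) = FConj (ren r p) (ren r q)"
| "ren r (FAll i p) = FAll (r i) (ren r p)"

lemma finite_vars: "finite (vars p)"
  by (induction p) auto

lemma sat_cong: "(\<And>i. i \<in> vars p \<Longrightarrow> s i = s' i) \<Longrightarrow> sat mem p s = sat mem p s'"
proof (induction p arbitrary: s s')
  case (FNeg p)
  have "sat mem p s = sat mem p s'" by (rule FNeg.IH) (use FNeg.prems in simp)
  then show ?case by simp
next
  case (FConj p q)
  have "sat mem p s = sat mem p s'" by (rule FConj.IH(1)) (use FConj.prems in simp)
  moreover have "sat mem q s = sat mem q s'" by (rule FConj.IH(2)) (use FConj.prems in simp)
  ultimately show ?case by simp
next
  case (FAll i p)
  have "sat mem p (s(i := x)) = sat mem p (s'(i := x))" for x
    by (rule FAll.IH) (use FAll.prems in auto)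
  then show ?case by simp
qed simp_all

text \<open>Injectivity is asked for on bound variables as well, so that a renamed quantifier cannot
  capture another variable.\<close>

lemma sat_ren: "inj_on r (vars p) \<Longrightarrow> sat mem (ren r p) s = sat mem p (s \<circ> r)"
proof (induction p arbitrary: s)
  case (FConj p q)
  then show ?case by (simp add: inj_on_Un)
next
  case (FAll i p)
  have "sat mem (ren r p) (s(r i := x)) = sat mem p ((s \<circ> r)(i := x))" for x
  proof -
    have "sat mem (ren r p) (s(r i := x)) = sat mem p (s(r i := x) \<circ> r)"
      by (rule FAll.IH) (use FAll.prems in \<open>auto simp: inj_on_def\<close>)
    also have "\<dots> = sat mem p ((s \<circ> r)(i := x))"
      by (rule sat_cong) (use FAll.prems in \<open>auto simp: inj_on_def\<close>)
    finally show ?thesis .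
  qed
  then show ?case by (simp add: o_def)
qed auto

text \<open>Even positions hold the variables, odd positions the parameters.\<close>

definition mix :: "(nat \<Rightarrow> 'a) \<Rightarrow> (nat \<Rightarrow> 'a) \<Rightarrow> nat \<Rightarrow> 'a" where
  "mix s c n = (if even n then s (n div 2) else c (n div 2))"

locale zf =
  fixes mem :: "'a \<Rightarrow> 'a \<Rightarrow> bool" (infix "\<epsilon>" 50)
  assumes ZF: "ZF mem"
begin

text \<open>The sets that are fixed in an argument enter its formulas through the parameters
  \<open>c\<close>; in this form Separation and Replacement become rules about HOL
  predicates.\<close>

definition D :: "((nat \<Rightarrow> 'a) \<Rightarrow> bool) \<Rightarrow> bool" where
  "D P \<longleftrightarrow> (\<exists>p c. \<forall>s. P s = sat mem p (mix s c))"

text \<open>Variables are de Bruijn indices: a quantifier puts the bound variable at position 0.\<close>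

definition Dt :: "((nat \<Rightarrow> 'a) \<Rightarrow> 'a) \<Rightarrow> bool" where
  "Dt t \<longleftrightarrow> D (\<lambda>s. s 0 = t (\<lambda>i. s (Suc i)))"

lemma D_ren:
  assumes "D P" "inj r"
  shows "D (\<lambda>s. P (\<lambda>i. s (r i)))"
proof -
  obtain p c where p: "\<And>s. P s = sat mem p (mix s c)"
    using assms(1) unfolding D_def by blast
  \<comment> \<open>Variable \<open>i\<close> sits at position \<open>2 * i\<close>, so a renaming
    of variables acts on even positions and leaves the parameters in place.\<close>
  define r' where "r' n = (if even n then 2 * r (n div 2) else n)" for n
  have "inj r'"
    unfolding r'_def inj_def using assms(2)[unfolded inj_def]
    by (smt (verit, best) dvd_triv_left even_two_times_div_two mult_cancel1 numeral_neq_zero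
        nonzero_mult_div_cancel_left)
  then have "inj_on r' (vars p)" using inj_on_subset by blast
  then have "sat mem (ren r' p) (mix s c) = sat mem p (mix s c \<circ> r')" for s
    by (rule sat_ren)
  moreover have "mix s c \<circ> r' = mix (\<lambda>i. s (r i)) c" for s
    by (auto simp: mix_def r'_def fun_eq_iff)
  ultimately show ?thesis unfolding D_def using p by (metis (no_types))
qed

lemma D_atom_mem: "D (\<lambda>s. s i \<epsilon> s j)"
  unfolding D_def by (rule exI[of _ "FMem (2*i) (2*j)"]) (auto simp: mix_def)

lemma D_atom_eq: "D (\<lambda>s. s i = s j)"
  unfolding D_def by (rule exI[of _ "FEq (2*i) (2*j)"]) (auto simp: mix_def)

lemma D_atom_eqc: "D (\<lambda>s. s i = c)"
  unfolding D_def
  by (rule exI[of _ "FEq (2*i) 1"], rule exI[of _ "\<lambda>_. c"]) (auto simp: mix_def)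

lemma D_not: "D P \<Longrightarrow> D (\<lambda>s. \<not> P s)"
  unfolding D_def by (metis sat.simps(3))

text \<open>The two formulas come with different parameter sequences. These are interleaved into
  one, and the odd positions of each formula are renamed accordingly.\<close>

lemma D_conj:
  assumes "D P" "D Q"
  shows "D (\<lambda>s. P s \<and> Q s)"
proof -
  obtain p c where p: "\<And>s. P s = sat mem p (mix s c)"
    using assms(1) unfolding D_def by blast
  obtain q d where q: "\<And>s. Q s = sat mem q (mix s d)"
    using assms(2) unfolding D_def by blast
  define a where "a n = (if even n then n else 2 * (2 * (n div 2)) + 1)" for n :: nat
  define b where "b n = (if even n then n else 2 * (2 * (n div 2) + 1) + 1)" for n :: nat
  define e where "e n = (if even n then c (n div 2) else d (n div 2))" for n
  have ab: "inj a" "inj b"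
    unfolding a_def b_def inj_def by (auto, presburger+)
  have "mix s e \<circ> a = mix s c" for s
    by (rule ext) (auto simp: mix_def a_def e_def elim!: oddE)
  moreover have "mix s e \<circ> b = mix s d" for s
    by (rule ext) (auto simp: mix_def b_def e_def)
  ultimately have "sat mem (FConj (ren a p) (ren b q)) (mix s e) \<longleftrightarrow> P s \<and> Q s" for s
    using sat_ren[of a p mem "mix s e"] sat_ren[of b q mem "mix s e"] ab p q
    by (metis inj_on_subset sat.simps(4) top_greatest)
  then show ?thesis unfolding D_def by blast
qed

text \<open>The variable to be quantified moves from position 0 to the fresh position
  \<open>2 * k\<close> beyond all variables of \<open>p\<close>. Every other variable drops by one
  index, hence by two positions, and the parameters stay.\<close>

lemma D_all:
  assumes "D (\<lambda>s. Q (\<lambda>i. s (Suc i)) (s 0))"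
  shows "D (\<lambda>s. \<forall>x. Q s x)"
proof -
  obtain p c where p: "\<And>s. Q (\<lambda>i. s (Suc i)) (s 0) = sat mem p (mix s c)"
    using assms unfolding D_def by blast
  obtain k where k: "\<And>v. v \<in> vars p \<Longrightarrow> v < 2 * k"
  proof -
    obtain m where "\<forall>v\<in>vars p. v < m" using finite_vars[of p] finite_nat_set_iff_bounded by blast
    then show ?thesis by (intro that[of m]) fastforce
  qed
  define r where "r n = (if n = 0 then 2 * k else if even n then n - 2 else n)" for n :: nat
  have inj: "inj_on r (vars p)"
  proof (rule inj_onI)
    fix u v assume "u \<in> vars p" "v \<in> vars p" "r u = r v"
    with k[of u] k[of v] show "u = v" unfolding r_def
      by (auto split: if_splits) presburger+
  qed
  have "sat mem (FAll (2 * k) (ren r p)) (mix s c) \<longleftrightarrow> (\<forall>x. Q s x)" for s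
  proof -
    have "sat mem (ren r p) ((mix s c)(2 * k := x)) = Q s x" for x
    proof -
      have "sat mem (ren r p) ((mix s c)(2 * k := x)) = sat mem p ((mix s c)(2 * k := x) \<circ> r)"
        by (rule sat_ren[OF inj])
      also have "\<dots> = sat mem p (mix (case_nat x s) c)"
      proof (rule sat_cong)
        fix i assume i: "i \<in> vars p"
        consider "i = 0" | j where "i = 2 * j + 2" | j where "i = 2 * j + 1"
          by (metis One_nat_def Suc_1 add.right_neutral add_Suc_right evenE mult_Suc_right
              not0_implies_Suc oddE add.commute mult_0_right)
        then show "((mix s c)(2 * k := x) \<circ> r) i = mix (case_nat x s) c i"
        proof cases
          case 2
          then have "2 * j \<noteq> 2 * k" using k[OF i] by simp
          then show ?thesis using 2 by (simp add: r_def mix_def)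
        next
          case 3
          have "2 * j + 1 \<noteq> 2 * k" by presburger
          then show ?thesis using 3 by (simp add: r_def mix_def)
        qed (simp add: r_def mix_def)
      qed
      also have "\<dots> = Q s x" using p[of "case_nat x s"] by simp
      finally show ?thesis .
    qed
    then show ?thesis by simp
  qed
  then show ?thesis unfolding D_def by metis
qed

lemma D_ex:
  assumes "D (\<lambda>s. Q (\<lambda>i. s (Suc i)) (s 0))"
  shows "D (\<lambda>s. \<exists>x. Q s x)"
proof -
  have "D (\<lambda>s. \<not> (\<forall>x. \<not> Q s x))"
    by (rule D_not, rule D_all, rule D_not) (rule assms)
  then show ?thesis by simp
qed

lemma D_const: "D (\<lambda>s. B)"
proof (cases B)
  case True
  then have "(\<lambda>s::nat \<Rightarrow> 'a. B) = (\<lambda>s. s 0 = s 0)" by simp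
  then show ?thesis using D_atom_eq[of 0 0] by metis
next
  case False
  then have "(\<lambda>s::nat \<Rightarrow> 'a. B) = (\<lambda>s. \<not> s 0 = s 0)" by simp
  then show ?thesis using D_not[OF D_atom_eq[of 0 0]] by metis
qed

lemma D_disj:
  assumes "D P" "D Q"
  shows "D (\<lambda>s. P s \<or> Q s)"
proof -
  have "D (\<lambda>s. \<not> (\<not> P s \<and> \<not> Q s))"
    by (intro D_not D_conj assms)
  then show ?thesis by simp
qed

lemma D_imp:
  assumes "D P" "D Q"
  shows "D (\<lambda>s. P s \<longrightarrow> Q s)"
  unfolding imp_conv_disj by (intro D_not D_disj assms)

lemma D_iff:
  assumes "D P" "D Q"
  shows "D (\<lambda>s. P s = Q s)"
  unfolding iff_conv_conj_imp by (intro D_imp D_conj assms)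

text \<open>The formal language has no terms, so the value \<open>t s\<close> is introduced by an
  existential quantifier over its definable graph.\<close>

lemma D_subst:
  assumes "Dt t" "D (\<lambda>s. Q (\<lambda>i. s (Suc i)) (s 0))"
  shows "D (\<lambda>s. Q s (t s))"
proof -
  have "D (\<lambda>s. \<exists>x. x = t s \<and> Q s x)"
    by (rule D_ex, rule D_conj) (use assms in \<open>auto simp: Dt_def\<close>)
  then show ?thesis by simp
qed

lemma Dt_var: "Dt (\<lambda>s. s i)"
  unfolding Dt_def by (rule D_atom_eq)

lemma Dt_const: "Dt (\<lambda>s. c)"
  unfolding Dt_def by (rule D_atom_eqc)

lemma Dt_shift: "Dt t \<Longrightarrow> Dt (\<lambda>s. t (\<lambda>i. s (Suc i)))"
  unfolding Dt_def
  by (drule D_ren[where r = "case_nat 0 (\<lambda>i. Suc (Suc i))"])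
    (auto simp: inj_def split: nat.splits)

lemma D_app2:
  assumes "D (\<lambda>s. R (s 0) (s 1))" "Dt t" "Dt u"
  shows "D (\<lambda>s. R (t s) (u s))"
proof (rule D_subst[OF assms(3), where Q = "\<lambda>s y. R (t s) y"])
  show "D (\<lambda>s. R (t (\<lambda>i. s (Suc i))) (s 0))"
    by (rule D_subst[OF Dt_shift[OF assms(2)], where Q = "\<lambda>s x. R x (s 0)"])
      (use assms(1) in simp)
qed

lemma D_app1:
  assumes "D (\<lambda>s. P (s 0))" "Dt t"
  shows "D (\<lambda>s. P (t s))"
  by (rule D_subst[OF assms(2)]) (use assms(1) in simp)

lemma D_app3:
  assumes "D (\<lambda>s. R (s 0) (s 1) (s 2))" "Dt t" "Dt u" "Dt v"
  shows "D (\<lambda>s. R (t s) (u s) (v s))"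
proof (rule D_subst[OF assms(4), where Q = "\<lambda>s y. R (t s) (u s) y"])
  show "D (\<lambda>s. R (t (\<lambda>i. s (Suc i))) (u (\<lambda>i. s (Suc i))) (s 0))"
  proof (rule D_subst[OF Dt_shift[OF assms(3)], where Q = "\<lambda>s y. R (t (\<lambda>i. s (Suc i))) y (s 0)"])
    show "D (\<lambda>s. R (t (\<lambda>i. s (Suc (Suc i)))) (s 0) (s (Suc 0)))"
      by (rule D_subst[OF Dt_shift[OF Dt_shift[OF assms(2)]], where Q = "\<lambda>s x. R x (s 0) (s (Suc 0))"])
        (use assms(1) in \<open>simp add: numeral_2_eq_2\<close>)
  qed
qed

lemma Dt_app1:
  assumes "Dt (\<lambda>s. F (s 0))" "Dt t"
  shows "Dt (\<lambda>s. F (t s))"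
  unfolding Dt_def
  by (rule D_subst[OF Dt_shift[OF assms(2)], where Q = "\<lambda>s x. s 0 = F x"])
    (use D_ren[of "\<lambda>s. s 0 = F (s 1)" "case_nat 1 (case_nat 0 (\<lambda>i. Suc (Suc i)))"] assms(1)
      in \<open>auto simp: Dt_def inj_def split: nat.splits\<close>)

lemma Dt_app2:
  assumes "Dt (\<lambda>s. F (s 0) (s 1))" "Dt t" "Dt u"
  shows "Dt (\<lambda>s. F (t s) (u s))"
proof -
  have "D (\<lambda>s. s 0 = F (s 1) (s 2))" using assms(1) by (simp add: Dt_def numeral_2_eq_2)
  from D_app3[OF this Dt_var[of 0] Dt_shift[OF assms(2)] Dt_shift[OF assms(3)]]
  show ?thesis unfolding Dt_def .
qed

lemma D_mem: "Dt t \<Longrightarrow> Dt u \<Longrightarrow> D (\<lambda>s. t s \<epsilon> u s)"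
  by (rule D_app2[where R = mem, OF D_atom_mem])

lemma D_eq: "Dt t \<Longrightarrow> Dt u \<Longrightarrow> D (\<lambda>s. t s = u s)"
  by (rule D_app2[where R = "(=)", OF D_atom_eq])

lemma D_ball: "D (\<lambda>s. \<forall>x. x \<in> A s \<longrightarrow> Q s x) \<Longrightarrow> D (\<lambda>s. \<forall>x\<in>A s. Q s x)"
  by (simp add: Ball_def)

lemma D_bex: "D (\<lambda>s. \<exists>x. x \<in> A s \<and> Q s x) \<Longrightarrow> D (\<lambda>s. \<exists>x\<in>A s. Q s x)"
  by (simp add: Bex_def)

lemmas D_logic = D_const D_not D_conj D_disj D_imp D_iff D_all D_ex D_ball D_bex
  Dt_var Dt_const D_mem D_eq

declare D_logic [Dr]

section \<open>Sets of the structure as HOL sets\<close>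

abbreviation pr :: "'a \<Rightarrow> 'a \<Rightarrow> 'a" ("\<langle>_,/ _\<rangle>") where
  "\<langle>x, y\<rangle> \<equiv> opair mem x y"

definition ext :: "'a \<Rightarrow> 'a set" where
  "ext u = {z. z \<epsilon> u}"

text \<open>The arguments run on HOL sets of elements, where set algebra is available; smallness
  marks those that the structure itself contains.\<close>

definition small :: "'a set \<Rightarrow> bool" where
  "small A \<longleftrightarrow> (\<exists>u. A = ext u)"

definition coll :: "'a set \<Rightarrow> 'a" where
  "coll A = the_set mem (\<lambda>z. z \<in> A)"

lemma ext_iff [simp]: "z \<in> ext u \<longleftrightarrow> z \<epsilon> u"
  by (simp add: ext_def)

lemmas ZF_axioms = ZF[unfolded ZF_def]
lemmas ax_ext = ZF_axioms[THEN conjunct1]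
lemmas ax_found = ZF_axioms[THEN conjunct2, THEN conjunct1]
lemmas ax_pair = ZF_axioms[THEN conjunct2, THEN conjunct2, THEN conjunct1]
lemmas ax_union = ZF_axioms[THEN conjunct2, THEN conjunct2, THEN conjunct2, THEN conjunct1]
lemmas ax_power = ZF_axioms[THEN conjunct2, THEN conjunct2, THEN conjunct2, THEN conjunct2, THEN conjunct1]
lemmas ax_inf = ZF_axioms[THEN conjunct2, THEN conjunct2, THEN conjunct2, THEN conjunct2, THEN conjunct2, THEN conjunct1]
lemmas ax_sep = ZF_axioms[THEN conjunct2, THEN conjunct2, THEN conjunct2, THEN conjunct2, THEN conjunct2, THEN conjunct2, THEN conjunct1]
lemmas ax_repl = ZF_axioms[THEN conjunct2, THEN conjunct2, THEN conjunct2, THEN conjunct2, THEN conjunct2, THEN conjunct2, THEN conjunct2]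

lemma extensional: "(\<And>z. z \<epsilon> u \<longleftrightarrow> z \<epsilon> v) \<Longrightarrow> u = v"
  using ax_ext by blast

lemma ext_inj: "ext u = ext v \<longleftrightarrow> u = v"
  by (metis ext_iff extensional)

lemma small_ext [simp]: "small (ext u)"
  unfolding small_def by blast

lemma smallE: "small A \<Longrightarrow> (\<And>u. A = ext u \<Longrightarrow> thesis) \<Longrightarrow> thesis"
  unfolding small_def by blast

lemma coll_ext [simp]: "coll (ext u) = u"
  unfolding coll_def the_set_def by (rule the_equality) (auto intro: extensional)

lemma ext_coll: "small A \<Longrightarrow> ext (coll A) = A"
  by (auto elim: smallE)

lemma mem_coll: "small A \<Longrightarrow> z \<epsilon> coll A \<longleftrightarrow> z \<in> A"
  by (metis ext_coll ext_iff)

lemma the_set_coll: "the_set mem P = coll {z. P z}"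
  by (simp add: coll_def)

lemma D_ext [Dr]: "Dt t \<Longrightarrow> Dt u \<Longrightarrow> D (\<lambda>s. t s \<in> ext (u s))"
  by (simp add: D_mem)

lemma D_small: "small A \<Longrightarrow> Dt t \<Longrightarrow> D (\<lambda>s. t s \<in> A)"
  by (elim smallE) (simp add: D_mem Dt_const)

lemma D_Collect [Dr]: "D (\<lambda>s. P s (t s)) \<Longrightarrow> D (\<lambda>s. t s \<in> {x. P s x})"
  by simp

lemma D_Un [Dr]: "D (\<lambda>s. t s \<in> A s) \<Longrightarrow> D (\<lambda>s. t s \<in> B s) \<Longrightarrow> D (\<lambda>s. t s \<in> A s \<union> B s)"
  using D_disj[of "\<lambda>s. t s \<in> A s" "\<lambda>s. t s \<in> B s"] by simp

lemma D_Int [Dr]: "D (\<lambda>s. t s \<in> A s) \<Longrightarrow> D (\<lambda>s. t s \<in> B s) \<Longrightarrow> D (\<lambda>s. t s \<in> A s \<inter> B s)"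
  using D_conj[of "\<lambda>s. t s \<in> A s" "\<lambda>s. t s \<in> B s"] by simp

lemma D_Diff [Dr]: "D (\<lambda>s. t s \<in> A s) \<Longrightarrow> D (\<lambda>s. t s \<in> B s) \<Longrightarrow> D (\<lambda>s. t s \<in> A s - B s)"
  using D_conj[OF _ D_not, of "\<lambda>s. t s \<in> A s" "\<lambda>s. t s \<in> B s"] by simp

lemma D_subset [Dr]: "D (\<lambda>s. \<forall>x. x \<in> A s \<longrightarrow> x \<in> B s) \<Longrightarrow> D (\<lambda>s. A s \<subseteq> B s)"
  by (simp add: subset_eq Ball_def)

lemma D_UN [Dr]: "D (\<lambda>s. \<exists>i. i \<in> I s \<and> t s \<in> F s i) \<Longrightarrow> D (\<lambda>s. t s \<in> (\<Union>i\<in>I s. F s i))"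
  by (simp add: Bex_def)

lemma small_sep:
  assumes "small A" "D (\<lambda>s. P (s 0))"
  shows "small {x \<in> A. P x}"
proof -
  obtain u where u: "A = ext u" using assms(1) by (elim smallE)
  obtain p c where p: "\<And>s. P (s 0) = sat mem p (mix s c)"
    using assms(2) unfolding D_def by blast
  have "\<forall>p s x. \<exists>u. \<forall>z. z \<epsilon> u \<longleftrightarrow> z \<epsilon> x \<and> sat mem p (s(0 := z))"
    by (rule ax_sep)
  then obtain v where v: "\<And>z. z \<epsilon> v \<longleftrightarrow> z \<epsilon> u \<and> sat mem p ((mix (\<lambda>_. undefined) c)(0 := z))" by blast
  have "(mix (\<lambda>_. undefined) c)(0 := z) = mix ((\<lambda>_. undefined)(0 := z)) c" for z
    by (auto simp: mix_def fun_eq_iff elim!: evenE)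
  then have "z \<epsilon> v \<longleftrightarrow> z \<epsilon> u \<and> P z" for z
    using v[of z] p[of "(\<lambda>_. undefined)(0 := z)"] by simp
  then have "{x \<in> A. P x} = ext v" using u by (simp add: set_eq_iff)
  then show ?thesis by simp
qed

lemma small_subset: "small A \<Longrightarrow> B \<subseteq> A \<Longrightarrow> D (\<lambda>s. s 0 \<in> B) \<Longrightarrow> small B"
  using small_sep[of A "\<lambda>x. x \<in> B"] by (simp add: Int_absorb1 flip: Int_def)

lemma small_pair: "small {x, y}"
proof -
  obtain u where "\<forall>z. z \<epsilon> u \<longleftrightarrow> z = x \<or> z = y" using ax_pair by metis
  then have "{x, y} = ext u" by (simp add: set_eq_iff)
  then show ?thesis by simp
qed

lemma small_single: "small {x}"
  using small_pair[of x x] by simp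

lemma small_Union:
  assumes "small A"
  shows "small (\<Union>x\<in>A. ext x)"
proof -
  obtain v where "A = ext v" using assms by (elim smallE)
  moreover obtain u where "\<forall>z. z \<epsilon> u \<longleftrightarrow> (\<exists>y. y \<epsilon> v \<and> z \<epsilon> y)" using ax_union by metis
  ultimately have "(\<Union>x\<in>A. ext x) = ext u" by (auto simp: ext_def)
  then show ?thesis by simp
qed

lemma small_Pow:
  assumes "small A"
  shows "small {u. ext u \<subseteq> A}"
proof -
  obtain v where v: "A = ext v" using assms by (elim smallE)
  obtain u where "\<forall>z. z \<epsilon> u \<longleftrightarrow> (\<forall>y. y \<epsilon> z \<longrightarrow> y \<epsilon> v)" using ax_power by metis
  then have "{u. ext u \<subseteq> A} = ext u" using v by (auto simp: ext_def)
  then show ?thesis by simp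
qed

lemma small_empty: "small {}"
  using small_sep[OF small_single D_const[of False]] by simp

lemma foundation: "x \<epsilon> u \<Longrightarrow> \<exists>y. y \<epsilon> u \<and> (\<forall>z. z \<epsilon> u \<longrightarrow> \<not> z \<epsilon> y)"
  using ax_found by blast

lemma small_image_rel:
  assumes "small A" "D (\<lambda>s. R (s 0) (s 1))" "\<And>x. x \<in> A \<Longrightarrow> \<exists>!y. R x y"
  shows "small {y. \<exists>x\<in>A. R x y}"
proof -
  obtain u where u: "A = ext u" using assms(1) by (elim smallE)
  obtain p c where p: "\<And>s. R (s 0) (s 1) = sat mem p (mix s c)"
    using assms(2) unfolding D_def by blast
  \<comment> \<open>The Replacement scheme reads its second argument at position 1, whereas
    \<open>mix\<close> stores variable 1 at position 2; exchanging the two positions reconciles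
    them.\<close>
  define sw where "sw n = (if n = 1 then 2 else if n = 2 then 1 else n)" for n :: nat
  have inj: "inj_on sw (vars p)" by (auto simp: inj_on_def sw_def split: if_splits)
  define c' where "c' n = mix (\<lambda>_. undefined) c (sw n)" for n
  have *: "sat mem (ren sw p) (c'(0 := y, 1 := z)) \<longleftrightarrow> R y z" for y z
  proof -
    have "c'(0 := y, 1 := z) \<circ> sw = mix ((\<lambda>_. undefined)(0 := y, 1 := z)) c"
    proof
      fix n
      show "(c'(0 := y, 1 := z) \<circ> sw) n = mix ((\<lambda>_. undefined)(0 := y, 1 := z)) c n"
      proof (cases "n \<le> 2")
        case True
        then have "n = 0 \<or> n = 1 \<or> n = 2" by auto
        then show ?thesis by (auto simp: c'_def sw_def mix_def)
      next
        case False
        then show ?thesis by (auto simp: c'_def sw_def mix_def elim!: evenE)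
      qed
    qed
    then have "sat mem (ren sw p) (c'(0 := y, 1 := z)) =
        sat mem p (mix ((\<lambda>_. undefined)(0 := y, 1 := z)) c)"
      unfolding sat_ren[OF inj] by (rule arg_cong)
    also have "\<dots> = R y z"
      unfolding p[symmetric] by simp
    finally show ?thesis .
  qed
  have "\<forall>p s x. (\<forall>y. y \<epsilon> x \<longrightarrow> (\<exists>!z. sat mem p (s(0 := y, 1 := z)))) \<longrightarrow>
       (\<exists>u. \<forall>z. z \<epsilon> u \<longleftrightarrow> (\<exists>y. y \<epsilon> x \<and> sat mem p (s(0 := y, 1 := z))))"
    by (rule ax_repl)
  from this[rule_format, of u "ren sw p" c'] obtain v where
    "\<forall>z. z \<epsilon> v \<longleftrightarrow> (\<exists>y. y \<epsilon> u \<and> R y z)"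
    using assms(3) u unfolding * by auto
  then have "{y. \<exists>x\<in>A. R x y} = ext v" using u by (simp add: set_eq_iff Bex_def)
  then show ?thesis by simp
qed

lemma small_image:
  assumes "small A" "Dt (\<lambda>s. F (s 0))"
  shows "small (F ` A)"
proof -
  have D: "D (\<lambda>s. F (s 0) = s 1)"
    by (intro Dr Dt_app1[OF assms(2)])
  have "F ` A = {y. \<exists>x\<in>A. F x = y}" by auto
  then show ?thesis using small_image_rel[of A "\<lambda>x y. F x = y", OF assms(1) D] by simp
qed

text \<open>If no element has the extension described, the description collapses to the fixed
  element \<open>THE u. False\<close>. The graph is therefore definable in every case, and a
  description can be used as a term before its existence is known.\<close>

lemma Dt_the_set [Dr]:
  assumes "D (\<lambda>s. P (\<lambda>i. s (Suc i)) (s 0))"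
  shows "Dt (\<lambda>s. the_set mem (P s))"
proof -
  have P: "D (\<lambda>s. P (\<lambda>i. s (Suc (Suc i))) (s 0))"
    using D_ren[OF assms, of "case_nat 0 (\<lambda>i. Suc (Suc i))"] by (auto simp: inj_def split: nat.splits)
  have P': "D (\<lambda>s. P (\<lambda>i. s (Suc (Suc (Suc i)))) (s 0))"
    using D_ren[OF assms, of "case_nat 0 (\<lambda>i. Suc (Suc (Suc i)))"]
    by (auto simp: inj_def split: nat.splits)
  have eq: "u = the_set mem Q \<longleftrightarrow> (\<forall>z. z \<epsilon> u \<longleftrightarrow> Q z) \<or>
      \<not> (\<exists>u. \<forall>z. z \<epsilon> u \<longleftrightarrow> Q z) \<and> u = (THE u. False)" for u and Q :: "'a \<Rightarrow> bool"
  proof (cases "\<exists>u. \<forall>z. z \<epsilon> u \<longleftrightarrow> Q z")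
    case True
    then obtain v where v: "\<forall>z. z \<epsilon> v \<longleftrightarrow> Q z" by blast
    then have "{z. Q z} = ext v" by (simp add: set_eq_iff)
    then have "the_set mem Q = v" by (simp add: the_set_coll)
    moreover have "(\<forall>z. z \<epsilon> u \<longleftrightarrow> Q z) \<longleftrightarrow> u = v"
      using v extensional[of u v] by blast
    ultimately show ?thesis using True by blast
  next
    case False
    then have "(\<lambda>u. \<forall>z. z \<epsilon> u \<longleftrightarrow> Q z) = (\<lambda>u. False)"
      by (intro HOL.ext) iprover
    then have "the_set mem Q = (THE u. False)" unfolding the_set_def by (rule arg_cong)
    moreover have "\<not> (\<forall>z. z \<epsilon> u \<longleftrightarrow> Q z)"
      by (rule notI, rule notE[OF False], rule exI)
    ultimately show ?thesis using False by (simp only: simp_thms)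
  qed
  show ?thesis unfolding Dt_def eq by (intro Dr P P')
qed

lemma Dt_coll [Dr]: "D (\<lambda>s. s 0 \<in> A (\<lambda>i. s (Suc i))) \<Longrightarrow> Dt (\<lambda>s. coll (A s))"
  unfolding coll_def by (rule Dt_the_set)

text \<open>Replacement gives the set of the codes \<open>coll (F i)\<close>, and the union axiom
  flattens it.\<close>

lemma small_UN:
  assumes "small I" "\<And>i. i \<in> I \<Longrightarrow> small (F i)" "D (\<lambda>s. s 1 \<in> F (s 0))"
  shows "small (\<Union>i\<in>I. F i)"
proof -
  have "Dt (\<lambda>s. coll (F (s 0)))"
    by (intro Dt_coll) (use D_app2[of "\<lambda>x y. y \<in> F x", OF assms(3) Dt_var[of 1] Dt_var[of 0]] in simp)
  from small_Union[OF small_image[OF assms(1) this]]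
  have "small (\<Union>x\<in>I. ext (coll (F x)))" by simp
  then show ?thesis using assms(2) by (simp add: ext_coll cong: SUP_cong)
qed

lemma small_Un:
  assumes "small A" "small B"
  shows "small (A \<union> B)"
proof -
  have "small (\<Union>x\<in>{coll A, coll B}. ext x)" by (rule small_Union[OF small_pair])
  then show ?thesis using assms by (simp add: ext_coll)
qed

lemma small_insert: "small B \<Longrightarrow> small (insert x B)"
  using small_Un[OF small_single] by simp

lemma D_fam: "D (\<lambda>s. s 1 \<in> F (s 0)) \<Longrightarrow> Dt t \<Longrightarrow> Dt u \<Longrightarrow> D (\<lambda>s. t s \<in> F (u s))"
  by (rule D_app2[of "\<lambda>x y. y \<in> F x"])

section \<open>Ordered pairs, products and coded relations\<close>

lemma ext_upair: "ext (upair mem x y) = {x, y}"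
proof -
  have "{z. z = x \<or> z = y} = {x, y}" by auto
  then show ?thesis unfolding upair_def the_set_coll by (simp add: ext_coll small_pair)
qed

lemma pr_inject [simp]: "\<langle>x, y\<rangle> = \<langle>x', y'\<rangle> \<longleftrightarrow> x = x' \<and> y = y'"
proof
  assume "\<langle>x, y\<rangle> = \<langle>x', y'\<rangle>"
  then have "{upair mem x x, upair mem x y} = {upair mem x' x', upair mem x' y'}"
    unfolding opair_def by (metis ext_upair)
  moreover have "upair mem a b = upair mem c d \<longleftrightarrow> {a, b} = {c, d}" for a b c d
    by (metis ext_inj ext_upair)
  ultimately show "x = x' \<and> y = y'" by (auto simp: doubleton_eq_iff)
qed auto

lemma Dt_upair [Dr]: "Dt t \<Longrightarrow> Dt u \<Longrightarrow> Dt (\<lambda>s. upair mem (t s) (u s))"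
  by (rule Dt_app2) (unfold upair_def, intro Dr)

lemma Dt_pr [Dr]: "Dt t \<Longrightarrow> Dt u \<Longrightarrow> Dt (\<lambda>s. \<langle>t s, u s\<rangle>)"
  by (rule Dt_app2) (unfold opair_def, intro Dr)

definition times :: "'a set \<Rightarrow> 'a set \<Rightarrow> 'a set" (infixr "\<otimes>" 80) where
  "A \<otimes> B = {\<langle>x, y\<rangle> | x y. x \<in> A \<and> y \<in> B}"

lemma times_iff: "p \<in> A \<otimes> B \<longleftrightarrow> (\<exists>x y. p = \<langle>x, y\<rangle> \<and> x \<in> A \<and> y \<in> B)"
  by (auto simp: times_def)

lemma small_times:
  assumes "small A" "small B"
  shows "small (A \<otimes> B)"
proof -
  have "small (\<Union>x\<in>A. (\<lambda>y. \<langle>x, y\<rangle>) ` B)"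
  proof (rule small_UN[OF assms(1)])
    show "small ((\<lambda>y. \<langle>x, y\<rangle>) ` B)" for x
      by (rule small_image[OF assms(2)]) (intro Dr)
    have "D (\<lambda>s. \<exists>y. y \<in> B \<and> s 1 = \<langle>s 0, y\<rangle>)"
      by (intro Dr D_small[OF assms(2)])
    then show "D (\<lambda>s. s 1 \<in> (\<lambda>y. \<langle>s 0, y\<rangle>) ` B)"
      by (simp add: image_iff Bex_def)
  qed
  moreover have "A \<otimes> B = (\<Union>x\<in>A. (\<lambda>y. \<langle>x, y\<rangle>) ` B)" by (auto simp: times_def)
  ultimately show ?thesis by simp
qed

text \<open>Turns a definable relation between sets into an element of the structure, which is
  needed wherever a definition quantifies over functions.\<close>

lemma small_rel:
  assumes "small A" "small B" "D (\<lambda>s. R (s 0) (s 1))" "\<And>x y. R x y \<Longrightarrow> x \<in> A \<and> y \<in> B"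
  shows "\<exists>r. (\<forall>x y. \<langle>x, y\<rangle> \<epsilon> r \<longleftrightarrow> R x y) \<and> (\<forall>p. p \<epsilon> r \<longrightarrow> (\<exists>x y. p = \<langle>x, y\<rangle>))"
proof -
  have "small {p \<in> A \<otimes> B. \<exists>x y. p = \<langle>x, y\<rangle> \<and> R x y}"
    by (rule small_sep[OF small_times[OF assms(1,2)]]) (intro Dr D_app2[OF assms(3)])
  from mem_coll[OF this] show ?thesis
    by (intro exI[of _ "coll {p \<in> A \<otimes> B. \<exists>x y. p = \<langle>x, y\<rangle> \<and> R x y}"])
      (auto simp: times_def dest: assms(4))
qed

section \<open>Natural numbers of the structure\<close>

abbreviation z0 :: 'a where "z0 \<equiv> zero mem"
abbreviation sc :: "'a \<Rightarrow> 'a" where "sc \<equiv> succ mem"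
abbreviation N :: "'a set" where "N \<equiv> ext (omega mem)"

lemma not_in_zero [simp]: "\<not> x \<epsilon> z0"
proof -
  have "ext z0 = {}" unfolding zero_def the_set_coll using ext_coll[OF small_empty] by simp
  then show ?thesis by auto
qed

lemma in_succ [simp]: "x \<epsilon> sc y \<longleftrightarrow> x \<epsilon> y \<or> x = y"
proof -
  have "{z. z \<epsilon> y \<or> z = y} = insert y (ext y)" by auto
  then have "ext (sc y) = insert y (ext y)"
    unfolding succ_def the_set_coll by (simp add: ext_coll small_insert)
  then show ?thesis by (metis ext_iff insert_iff)
qed

lemma Dt_succ [Dr]: "Dt t \<Longrightarrow> Dt (\<lambda>s. sc (t s))"
  by (rule Dt_app1) (unfold succ_def, intro Dr)

definition ind_set :: "'a \<Rightarrow> bool" where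
  "ind_set u \<longleftrightarrow> z0 \<epsilon> u \<and> (\<forall>k. k \<epsilon> u \<longrightarrow> sc k \<epsilon> u)"

text \<open>The axiom of infinity provides one inductive set. The common elements of all inductive
  sets are separated from it, so the description of \<open>omega\<close> denotes.\<close>

lemma in_omega: "n \<epsilon> omega mem \<longleftrightarrow> (\<forall>u. ind_set u \<longrightarrow> n \<epsilon> u)"
proof -
  obtain e u where u: "e \<epsilon> u" "\<forall>z. \<not> z \<epsilon> e"
    "\<forall>n. n \<epsilon> u \<longrightarrow> (\<exists>m. m \<epsilon> u \<and> (\<forall>z. z \<epsilon> m \<longleftrightarrow> z \<epsilon> n \<or> z = n))"
    using ax_inf by blast
  have "e = z0" by (rule extensional) (use u in simp)
  moreover have "sc k \<epsilon> u" if k: "k \<epsilon> u" for k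
  proof -
    obtain m where m: "m \<epsilon> u" "\<forall>z. z \<epsilon> m \<longleftrightarrow> z \<epsilon> k \<or> z = k" using u(3) k by blast
    have "m = sc k" by (rule extensional) (use m in simp)
    with m show ?thesis by simp
  qed
  ultimately have ind: "ind_set u" using u unfolding ind_set_def by blast
  have "small {n \<in> ext u. \<forall>u. ind_set u \<longrightarrow> n \<epsilon> u}"
    unfolding ind_set_def by (rule small_sep[OF small_ext]) (intro Dr)
  moreover have "{n \<in> ext u. \<forall>u. ind_set u \<longrightarrow> n \<epsilon> u} = {n. \<forall>u. ind_set u \<longrightarrow> n \<epsilon> u}"
    using ind by auto
  ultimately show ?thesis
    unfolding omega_def the_set_coll ind_set_def[symmetric] using mem_coll by simp
qed

lemma zero_N [simp]: "z0 \<epsilon> omega mem"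
  by (simp add: in_omega ind_set_def)

lemma succ_N [simp]: "n \<epsilon> omega mem \<Longrightarrow> sc n \<epsilon> omega mem"
  by (simp add: in_omega ind_set_def)

lemma N_induct:
  assumes "n \<in> N" "D (\<lambda>s. P (s 0))" "P z0" "\<And>n. n \<in> N \<Longrightarrow> P n \<Longrightarrow> P (sc n)"
  shows "P n"
proof -
  have s: "small {n \<in> N. P n}" by (rule small_sep[OF small_ext assms(2)])
  have "ind_set (coll {n \<in> N. P n})"
    unfolding ind_set_def mem_coll[OF s] using assms(3,4) by simp
  then have "n \<epsilon> coll {n \<in> N. P n}" using assms(1) in_omega by simp
  then show ?thesis unfolding mem_coll[OF s] by simp
qed

lemma mem_irrefl [simp]: "\<not> x \<epsilon> x"
  using foundation[of x "coll {x}"] small_single[of x] by (auto simp: mem_coll)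

lemma mem_asym: "x \<epsilon> y \<Longrightarrow> \<not> y \<epsilon> x"
  using foundation[of x "coll {x, y}"] small_pair[of x y] by (auto simp: mem_coll)

lemma succ_inj [simp]: "sc x = sc y \<longleftrightarrow> x = y"
  by (metis in_succ mem_asym)

lemma succ_neq_zero [simp]: "sc x \<noteq> z0" "z0 \<noteq> sc x"
  by (metis in_succ not_in_zero)+

lemma succ_neq [simp]: "sc x \<noteq> x" "x \<noteq> sc x"
  by (metis in_succ mem_irrefl)+

lemma zero_in_succ: "n \<in> N \<Longrightarrow> z0 \<epsilon> sc n"
proof (erule N_induct)
  show "D (\<lambda>s. z0 \<epsilon> sc (s 0))" by (intro Dr)
qed auto

lemma succ_mono: "n \<in> N \<Longrightarrow> m \<epsilon> n \<Longrightarrow> sc m \<epsilon> sc n"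
proof -
  assume "n \<in> N"
  then have "\<forall>m. m \<epsilon> n \<longrightarrow> sc m \<epsilon> sc n"
  proof (rule N_induct)
    show "D (\<lambda>s. \<forall>m. m \<epsilon> s 0 \<longrightarrow> sc m \<epsilon> sc (s 0))" by (intro Dr)
  qed auto
  then show "m \<epsilon> n \<Longrightarrow> sc m \<epsilon> sc n" by blast
qed

lemma N_linear: "m \<in> N \<Longrightarrow> n \<in> N \<Longrightarrow> m \<epsilon> n \<or> m = n \<or> n \<epsilon> m"
proof -
  assume m: "m \<in> N" and "n \<in> N"
  then show ?thesis
  proof (rule_tac N_induct[OF \<open>n \<in> N\<close>])
    show "D (\<lambda>s. m \<epsilon> s 0 \<or> m = s 0 \<or> s 0 \<epsilon> m)" by (intro Dr)
    show "m \<epsilon> z0 \<or> m = z0 \<or> z0 \<epsilon> m" using zero_in_succ[OF m] by auto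
    show "m \<epsilon> sc k \<or> m = sc k \<or> sc k \<epsilon> m" if "k \<in> N" "m \<epsilon> k \<or> m = k \<or> k \<epsilon> m" for k
      using that succ_mono[OF m] by auto
  qed
qed

lemma N_cases: "n \<in> N \<Longrightarrow> n = z0 \<or> (\<exists>m\<in>N. n = sc m)"
proof (erule N_induct)
  show "D (\<lambda>s. s 0 = z0 \<or> (\<exists>m\<in>N. s 0 = sc m))" by (intro Dr)
qed auto

text \<open>The values are read off set-sized approximations: \<open>Ap f n\<close> forces the
  recursion up to \<open>n\<close> and leaves \<open>f\<close> unconstrained beyond. Existence of an
  approximation and agreement of all approximations at \<open>n\<close> are proved in one
  induction.\<close>

lemma N_rec:
  assumes G: "Dt (\<lambda>s. G (s 0) (s 1))"
  shows "\<exists>F. Dt (\<lambda>s. F (s 0)) \<and> F z0 = a \<and> (\<forall>n\<in>N. F (sc n) = G n (F n))"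
proof -
  define Ap where "Ap f n \<longleftrightarrow> (\<forall>y. \<langle>z0, y\<rangle> \<epsilon> f \<longleftrightarrow> y = a) \<and>
    (\<forall>k. k \<epsilon> n \<longrightarrow> (\<forall>y. \<langle>sc k, y\<rangle> \<epsilon> f \<longleftrightarrow> (\<exists>z. \<langle>k, z\<rangle> \<epsilon> f \<and> y = G k z)))" for f n
  have DAp: "D (\<lambda>s. Ap (t s) (u s))" if "Dt t" "Dt u" for t u
  proof (rule D_app2[OF _ that])
    show "D (\<lambda>s. Ap (s 0) (s 1))" unfolding Ap_def by (intro Dr Dt_app2[OF G])
  qed
  define Q where "Q n \<longleftrightarrow> (\<exists>f. Ap f n) \<and> (\<exists>y. \<forall>f. Ap f n \<longrightarrow> (\<forall>z. \<langle>n, z\<rangle> \<epsilon> f \<longleftrightarrow> z = y))" for n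
  have Q: "Q n" if "n \<in> N" for n
  proof (rule N_induct[OF that])
    show "D (\<lambda>s. Q (s 0))" unfolding Q_def by (intro Dr DAp)
    show "Q z0" unfolding Q_def
    proof (intro conjI exI)
      show "Ap (coll {\<langle>z0, a\<rangle>}) z0" by (simp add: Ap_def mem_coll small_single)
      show "\<forall>f. Ap f z0 \<longrightarrow> (\<forall>z. \<langle>z0, z\<rangle> \<epsilon> f \<longleftrightarrow> z = a)" by (simp add: Ap_def)
    qed
    fix n assume n: "n \<in> N" and "Q n"
    then obtain f y where f: "Ap f n" and y: "\<And>f z. Ap f n \<Longrightarrow> \<langle>n, z\<rangle> \<epsilon> f \<longleftrightarrow> z = y"
      unfolding Q_def by blast
    have down: "Ap f n" if "Ap f (sc n)" for f using that unfolding Ap_def by auto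
    \<comment> \<open>Since \<open>f\<close> may contain anything at arguments beyond
      \<open>n\<close>, it is first restricted to arguments in \<open>sc n\<close>; only then is the
      place of the new value free.\<close>
    define f' where "f' = coll (insert \<langle>sc n, G n y\<rangle> {p \<in> ext f. \<exists>k z. p = \<langle>k, z\<rangle> \<and> k \<epsilon> sc n})"
    have "small {p \<in> ext f. \<exists>k z. p = \<langle>k, z\<rangle> \<and> k \<epsilon> sc n}"
      by (rule small_sep[OF small_ext]) (intro Dr)
    then have f': "\<langle>k, z\<rangle> \<epsilon> f' \<longleftrightarrow> k = sc n \<and> z = G n y \<or> \<langle>k, z\<rangle> \<epsilon> f \<and> k \<epsilon> sc n" for k z
      unfolding f'_def by (auto simp: mem_coll small_insert)
    have ns: "\<not> sc n \<epsilon> n" by (meson in_succ mem_asym)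
    have "Ap f' (sc n)"
      unfolding Ap_def
    proof (intro conjI allI impI)
      show "\<langle>z0, z\<rangle> \<epsilon> f' \<longleftrightarrow> z = a" for z
        using f zero_in_succ[OF n] unfolding Ap_def f' by simp
      fix k z assume "k \<epsilon> sc n"
      then consider "k = n" | "k \<epsilon> n" by auto
      then show "\<langle>sc k, z\<rangle> \<epsilon> f' \<longleftrightarrow> (\<exists>w. \<langle>k, w\<rangle> \<epsilon> f' \<and> z = G k w)"
      proof cases
        case 1
        then show ?thesis using y[OF f] ns unfolding f' by (auto)
      next
        case 2
        then have "sc k \<epsilon> sc n" "k \<noteq> n" "k \<epsilon> sc n" "k \<noteq> sc n" using succ_mono[OF n] ns by auto
        then show ?thesis using f 2 unfolding f' Ap_def by auto
      qed
    qed
    moreover have "\<langle>sc n, z\<rangle> \<epsilon> g \<longleftrightarrow> z = G n y" if "Ap g (sc n)" for g z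
      using that y[OF down[OF that]] unfolding Ap_def by auto
    ultimately show "Q (sc n)" unfolding Q_def by blast
  qed
  define V where "V n y \<longleftrightarrow> (\<exists>f. Ap f n \<and> \<langle>n, y\<rangle> \<epsilon> f)" for n y
  have V1: "\<exists>!y. V n y" if n: "n \<in> N" for n
  proof -
    obtain f y where f: "Ap f n" and y: "\<And>f z. Ap f n \<Longrightarrow> \<langle>n, z\<rangle> \<epsilon> f \<longleftrightarrow> z = y"
      using Q[OF n] unfolding Q_def by blast
    have "V n z \<longleftrightarrow> z = y" for z unfolding V_def using f y by auto
    then show ?thesis by simp
  qed
  \<comment> \<open>The default value outside \<open>N\<close> lets one formula define the graph for
    all arguments.\<close>
  define F where "F n = (if n \<in> N then THE y. V n y else z0)" for n
  have FV: "V n (F n)" if "n \<in> N" for n using theI'[OF V1[OF that]] that by (simp add: F_def)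
  have "y = F n \<longleftrightarrow> n \<in> N \<and> V n y \<or> n \<notin> N \<and> y = z0" for n y
    using FV V1 by (auto simp: F_def)
  then have "Dt (\<lambda>s. F (s 0))"
    unfolding Dt_def V_def by simp (intro Dr DAp)
  moreover have "F z0 = a"
    using FV[of z0] by (auto simp: V_def Ap_def)
  moreover have "F (sc n) = G n (F n)" if "n \<in> N" for n
  proof -
    have "V (sc n) (F (sc n))" using FV[of "sc n"] that by simp
    then obtain f where "Ap f (sc n)" "\<langle>sc n, F (sc n)\<rangle> \<epsilon> f" unfolding V_def by blast
    then obtain z where z: "\<langle>n, z\<rangle> \<epsilon> f" "F (sc n) = G n z" "Ap f n" by (auto simp: Ap_def)
    then have "V n z" unfolding V_def by blast
    then show ?thesis using z FV[OF that] V1[OF that] by blast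
  qed
  ultimately show ?thesis by blast
qed

section \<open>Rank and Scott's trick\<close>

definition trans_set :: "'a \<Rightarrow> bool" where
  "trans_set t \<longleftrightarrow> (\<forall>y z. y \<epsilon> t \<longrightarrow> z \<epsilon> y \<longrightarrow> z \<epsilon> t)"

lemma D_trans_set [Dr]: "Dt t \<Longrightarrow> D (\<lambda>s. trans_set (t s))"
  by (rule D_app1) (unfold trans_set_def, intro Dr)

text \<open>Iterating the union operation from the singleton of \<open>x\<close> along
  \<open>N\<close> and collecting all stages yields a transitive closure.\<close>

lemma ex_trans_set: "\<exists>t. trans_set t \<and> x \<epsilon> t"
proof -
  have "Dt (\<lambda>s. the_set mem (\<lambda>z. \<exists>y. y \<epsilon> s 1 \<and> z \<epsilon> y))" by (intro Dr)
  from N_rec[of "\<lambda>n u. the_set mem (\<lambda>z. \<exists>y. y \<epsilon> u \<and> z \<epsilon> y)" "coll {x}", OF this]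
  obtain F where F: "Dt (\<lambda>s. F (s 0))" "F z0 = coll {x}"
    "\<And>n. n \<in> N \<Longrightarrow> F (sc n) = the_set mem (\<lambda>z. \<exists>y. y \<epsilon> F n \<and> z \<epsilon> y)" by blast
  have FS: "z \<epsilon> F (sc n) \<longleftrightarrow> (\<exists>y. y \<epsilon> F n \<and> z \<epsilon> y)" if "n \<in> N" for n z
  proof -
    have "{z. \<exists>y. y \<epsilon> F n \<and> z \<epsilon> y} = (\<Union>y\<in>ext (F n). ext y)" by (auto simp: ext_def)
    then show ?thesis unfolding F(3)[OF that] the_set_coll
      using mem_coll[OF small_Union[OF small_ext]] by (simp add: Bex_def)
  qed
  have s: "small (\<Union>n\<in>N. ext (F n))"
    by (rule small_UN) (auto intro!: Dr Dt_app1[OF F(1)])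
  have "x \<epsilon> coll (\<Union>n\<in>N. ext (F n))"
    unfolding mem_coll[OF s] using F(2) by (auto simp: mem_coll small_single intro!: bexI[of _ z0])
  moreover have "trans_set (coll (\<Union>n\<in>N. ext (F n)))"
    unfolding trans_set_def mem_coll[OF s]
  proof (intro allI impI)
    fix y z assume "y \<in> (\<Union>n\<in>N. ext (F n))" "z \<epsilon> y"
    then obtain n where n: "n \<in> N" "y \<epsilon> F n" by auto
    then have "z \<epsilon> F (sc n)" using FS[OF n(1)] \<open>z \<epsilon> y\<close> by blast
    then show "z \<in> (\<Union>n\<in>N. ext (F n))" using succ_N n by (intro UN_I[of "sc n"]) auto
  qed
  ultimately show ?thesis by blast
qed

text \<open>Foundation speaks of sets only. The counterexamples inside a transitive set around
  \<open>x\<close> form a set, and a minimal one among them is minimal outright because its elements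
  remain in that transitive set.\<close>

lemma mem_induct:
  assumes "D (\<lambda>s. P (s 0))" "\<And>x. (\<And>y. y \<epsilon> x \<Longrightarrow> P y) \<Longrightarrow> P x"
  shows "P x"
proof (rule ccontr)
  assume x: "\<not> P x"
  obtain t where t: "trans_set t" "x \<epsilon> t" using ex_trans_set by blast
  have s: "small {y \<in> ext t. \<not> P y}" by (rule small_sep[OF small_ext D_not[OF assms(1)]])
  have "x \<epsilon> coll {y \<in> ext t. \<not> P y}" unfolding mem_coll[OF s] using x t by simp
  from foundation[OF this] obtain y where
    "y \<epsilon> coll {y \<in> ext t. \<not> P y}" "\<And>z. z \<epsilon> coll {y \<in> ext t. \<not> P y} \<Longrightarrow> \<not> z \<epsilon> y" by blast
  then have y: "y \<epsilon> t" "\<not> P y" "\<And>z. z \<epsilon> t \<Longrightarrow> \<not> P z \<Longrightarrow> \<not> z \<epsilon> y"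
    unfolding mem_coll[OF s] by auto
  have "P z" if "z \<epsilon> y" for z using that y t(1) unfolding trans_set_def by blast
  with assms(2) y show False by blast
qed

lemma is_functionD: "is_function mem f \<Longrightarrow> \<langle>x, y\<rangle> \<epsilon> f \<Longrightarrow> \<langle>x, z\<rangle> \<epsilon> f \<Longrightarrow> y = z"
  unfolding is_function_def by blast

text \<open>A version of \<open>rank_function\<close> that speaks of pairs instead of
  \<open>app\<close> and \<open>domain_of\<close>, so that its definability can be read off.\<close>

definition rank_approx :: "'a \<Rightarrow> 'a \<Rightarrow> bool" where
  "rank_approx r t \<longleftrightarrow> is_function mem r \<and> (\<forall>x. x \<epsilon> t \<longleftrightarrow> (\<exists>k. \<langle>x, k\<rangle> \<epsilon> r)) \<and>
    (\<forall>x k. \<langle>x, k\<rangle> \<epsilon> r \<longrightarrow> (\<forall>z. z \<epsilon> k \<longleftrightarrow> (\<exists>y. y \<epsilon> x \<and> (\<exists>l. \<langle>y, l\<rangle> \<epsilon> r \<and> z \<epsilon> sc l))))"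

definition rank_rel :: "'a \<Rightarrow> 'a \<Rightarrow> bool" where
  "rank_rel x k \<longleftrightarrow> (\<exists>t r. trans_set t \<and> rank_approx r t \<and> \<langle>x, k\<rangle> \<epsilon> r)"

lemma D_is_function [Dr]: "Dt t \<Longrightarrow> D (\<lambda>s. is_function mem (t s))"
  by (rule D_app1) (unfold is_function_def, intro Dr)

lemma D_rank_approx [Dr]: "Dt t \<Longrightarrow> Dt u \<Longrightarrow> D (\<lambda>s. rank_approx (t s) (u s))"
  by (rule D_app2) (unfold rank_approx_def, intro Dr)

lemma D_rank_rel [Dr]: "Dt t \<Longrightarrow> Dt u \<Longrightarrow> D (\<lambda>s. rank_rel (t s) (u s))"
  by (rule D_app2) (unfold rank_rel_def, intro Dr)

lemma rank_rel_unique: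
  assumes "rank_rel x k" "rank_rel x k'"
  shows "k = k'"
proof -
  have "\<forall>k k'. rank_rel x k \<longrightarrow> rank_rel x k' \<longrightarrow> k = k'"
  proof (rule mem_induct[of _ x])
    show "D (\<lambda>s. \<forall>k k'. rank_rel (s 0) k \<longrightarrow> rank_rel (s 0) k' \<longrightarrow> k = k')" by (intro Dr)
    fix x assume IH: "\<And>y. y \<epsilon> x \<Longrightarrow> \<forall>k k'. rank_rel y k \<longrightarrow> rank_rel y k' \<longrightarrow> k = k'"
    show "\<forall>k k'. rank_rel x k \<longrightarrow> rank_rel x k' \<longrightarrow> k = k'"
    proof (intro allI impI)
      fix k k' assume "rank_rel x k" "rank_rel x k'"
      then obtain t r t' r' where r: "trans_set t" "rank_approx r t" "\<langle>x, k\<rangle> \<epsilon> r"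
        "trans_set t'" "rank_approx r' t'" "\<langle>x, k'\<rangle> \<epsilon> r'" unfolding rank_rel_def by blast
      have "\<langle>y, l\<rangle> \<epsilon> r \<longleftrightarrow> \<langle>y, l\<rangle> \<epsilon> r'" if y: "y \<epsilon> x" for y l
      proof -
        have "x \<epsilon> t" "x \<epsilon> t'" using r(2,3,5,6) unfolding rank_approx_def by blast+
        then have "y \<epsilon> t" "y \<epsilon> t'" using r(1,4) y unfolding trans_set_def by blast+
        then obtain m m' where m: "\<langle>y, m\<rangle> \<epsilon> r" "\<langle>y, m'\<rangle> \<epsilon> r'" using r unfolding rank_approx_def by blast
        then have "rank_rel y m" "rank_rel y m'" using r unfolding rank_rel_def by blast+
        then have "m = m'" using IH[OF y] by blast
        moreover have "is_function mem r" "is_function mem r'" using r(2,5) unfolding rank_approx_def by simp_all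
        then have "\<langle>y, l\<rangle> \<epsilon> r \<Longrightarrow> l = m" "\<langle>y, l\<rangle> \<epsilon> r' \<Longrightarrow> l = m'"
          using m is_functionD by blast+
        ultimately show ?thesis using m by blast
      qed
      then have *: "(\<exists>y. y \<epsilon> x \<and> (\<exists>l. \<langle>y, l\<rangle> \<epsilon> r \<and> z \<epsilon> sc l)) \<longleftrightarrow>
          (\<exists>y. y \<epsilon> x \<and> (\<exists>l. \<langle>y, l\<rangle> \<epsilon> r' \<and> z \<epsilon> sc l))" for z
        by (simp cong: conj_cong)
      have "z \<epsilon> k \<longleftrightarrow> z \<epsilon> k'" for z
      proof -
        have "z \<epsilon> k \<longleftrightarrow> (\<exists>y. y \<epsilon> x \<and> (\<exists>l. \<langle>y, l\<rangle> \<epsilon> r \<and> z \<epsilon> sc l))"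
          using r(2,3) unfolding rank_approx_def by blast
        moreover have "z \<epsilon> k' \<longleftrightarrow> (\<exists>y. y \<epsilon> x \<and> (\<exists>l. \<langle>y, l\<rangle> \<epsilon> r' \<and> z \<epsilon> sc l))"
          using r(5,6) unfolding rank_approx_def by blast
        ultimately show ?thesis using * by simp
      qed
      then show "k = k'" by (rule extensional)
    qed
  qed
  then show ?thesis using assms by blast
qed

text \<open>An approximation that ranks \<open>x\<close> also ranks the elements of
  \<open>x\<close>, and uniqueness identifies those values with \<open>rank_rel\<close>. The
  recursion equation thus holds without reference to an approximation.\<close>

lemma rank_rel_elem:
  assumes "rank_rel x k"
  shows "z \<epsilon> k \<longleftrightarrow> (\<exists>y. y \<epsilon> x \<and> (\<exists>l. rank_rel y l \<and> z \<epsilon> sc l))" and "y \<epsilon> x \<Longrightarrow> \<exists>l. rank_rel y l"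
proof -
  obtain t r where r: "trans_set t" "rank_approx r t" "\<langle>x, k\<rangle> \<epsilon> r" using assms unfolding rank_rel_def by blast
  have ex: "\<exists>l. \<langle>y, l\<rangle> \<epsilon> r" if "y \<epsilon> x" for y
    using r that unfolding rank_approx_def trans_set_def by blast
  have "\<langle>y, l\<rangle> \<epsilon> r \<longleftrightarrow> rank_rel y l" if y: "y \<epsilon> x" for y l
  proof
    show "\<langle>y, l\<rangle> \<epsilon> r \<Longrightarrow> rank_rel y l" using r unfolding rank_rel_def by blast
    assume l: "rank_rel y l"
    obtain m where m: "\<langle>y, m\<rangle> \<epsilon> r" using ex[OF y] by blast
    then have "rank_rel y m" using r unfolding rank_rel_def by blast
    then show "\<langle>y, l\<rangle> \<epsilon> r" using m rank_rel_unique[OF l] by blast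
  qed
  moreover have "z \<epsilon> k \<longleftrightarrow> (\<exists>y. y \<epsilon> x \<and> (\<exists>l. \<langle>y, l\<rangle> \<epsilon> r \<and> z \<epsilon> sc l))"
    using r(2,3) unfolding rank_approx_def by blast
  ultimately show "z \<epsilon> k \<longleftrightarrow> (\<exists>y. y \<epsilon> x \<and> (\<exists>l. rank_rel y l \<and> z \<epsilon> sc l))" by blast
  show "y \<epsilon> x \<Longrightarrow> \<exists>l. rank_rel y l" using ex r unfolding rank_rel_def by blast
qed

text \<open>Otherwise, collect the ranked members of a transitive set around \<open>x\<close>.
  Together with \<open>x\<close> they form a transitive set, Replacement gathers their ranks into
  one function, and \<open>x\<close> receives the value dictated by its elements.\<close>

lemma rank_rel_exists: "\<exists>k. rank_rel x k"
proof (rule mem_induct[of _ x])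
  show "D (\<lambda>s. \<exists>k. rank_rel (s 0) k)" by (intro Dr)
  fix x assume IH: "\<And>y. y \<epsilon> x \<Longrightarrow> \<exists>k. rank_rel y k"
  show "\<exists>k. rank_rel x k"
  proof (rule ccontr)
    assume nx: "\<nexists>k. rank_rel x k"
    obtain t where t: "trans_set t" "x \<epsilon> t" using ex_trans_set by blast
    define t1 where "t1 = {z \<in> ext t. \<exists>k. rank_rel z k}"
    have s1: "small t1" unfolding t1_def by (rule small_sep[OF small_ext]) (intro Dr)
    have s2: "small (\<Union>z\<in>t1. {\<langle>z, k\<rangle> |k. rank_rel z k})"
    proof (rule small_UN[OF s1])
      fix z assume "z \<in> t1"
      then obtain k where "rank_rel z k" unfolding t1_def by blast
      then have "{\<langle>z, k\<rangle> |k. rank_rel z k} = {\<langle>z, k\<rangle>}" using rank_rel_unique by auto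
      then show "small {\<langle>z, k\<rangle> |k. rank_rel z k}" by (simp add: small_single)
    qed (intro Dr)
    have s3: "small (\<Union>y\<in>ext x. {z. \<exists>k. rank_rel y k \<and> z \<epsilon> sc k})"
    proof (rule small_UN[OF small_ext])
      fix y assume "y \<in> ext x"
      then obtain k where k: "rank_rel y k" using IH by auto
      then have "{z. \<exists>k. rank_rel y k \<and> z \<epsilon> sc k} = ext (sc k)" using rank_rel_unique by (auto simp: ext_def)
      then show "small {z. \<exists>k. rank_rel y k \<and> z \<epsilon> sc k}" by simp
    qed (intro Dr)
    define k where "k = coll (\<Union>y\<in>ext x. {z. \<exists>k. rank_rel y k \<and> z \<epsilon> sc k})"
    define t2 where "t2 = coll (insert x t1)"
    define r where "r = coll (insert \<langle>x, k\<rangle> (\<Union>z\<in>t1. {\<langle>z, k\<rangle> |k. rank_rel z k}))"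
    have t2: "z \<epsilon> t2 \<longleftrightarrow> z = x \<or> z \<in> t1" for z
      unfolding t2_def by (simp add: mem_coll small_insert s1)
    have r: "p \<epsilon> r \<longleftrightarrow> p = \<langle>x, k\<rangle> \<or> (\<exists>z l. z \<in> t1 \<and> rank_rel z l \<and> p = \<langle>z, l\<rangle>)" for p
      unfolding r_def by (auto simp: mem_coll small_insert s2)
    have xt: "x \<notin> t1" using nx unfolding t1_def by blast
    have k: "z \<epsilon> k \<longleftrightarrow> (\<exists>y. y \<epsilon> x \<and> (\<exists>l. rank_rel y l \<and> z \<epsilon> sc l))" for z
      unfolding k_def mem_coll[OF s3] by (simp add: Bex_def)
    have sub: "y \<in> t1" if "y \<epsilon> x" for y
      using that t IH unfolding t1_def trans_set_def by auto
    have tr: "y \<in> t1" if "z \<in> t1" "y \<epsilon> z" for y z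
      using that t rank_rel_elem(2) unfolding t1_def trans_set_def by auto
    have "trans_set t2" unfolding trans_set_def t2 using sub tr by blast
    moreover have rp: "\<langle>y, l\<rangle> \<epsilon> r \<longleftrightarrow> y = x \<and> l = k \<or> y \<in> t1 \<and> rank_rel y l" for y l
      by (auto simp: r)
    have rt: "\<langle>y, l\<rangle> \<epsilon> r \<longleftrightarrow> rank_rel y l" if "y \<in> t1" for y l
      using that xt by (auto simp: rp)
    have "rank_approx r t2"
      unfolding rank_approx_def
    proof (intro conjI allI impI)
      show "is_function mem r" unfolding is_function_def
        using xt rank_rel_unique by (auto simp: r rp)
      show "y \<epsilon> t2 \<longleftrightarrow> (\<exists>l. \<langle>y, l\<rangle> \<epsilon> r)" for y
        unfolding t2 rp t1_def by auto
      fix y l z assume "\<langle>y, l\<rangle> \<epsilon> r"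
      then consider "y = x" "l = k" | "y \<in> t1" "rank_rel y l" unfolding rp by blast
      then show "z \<epsilon> l \<longleftrightarrow> (\<exists>w. w \<epsilon> y \<and> (\<exists>m. \<langle>w, m\<rangle> \<epsilon> r \<and> z \<epsilon> sc m))"
      proof cases
        case 1
        then show ?thesis using k sub rt by blast
      next
        case 2
        then show ?thesis using rank_rel_elem(1)[OF 2(2)] tr[OF 2(1)] rt by blast
      qed
    qed
    moreover have "\<langle>x, k\<rangle> \<epsilon> r" by (simp add: r)
    ultimately show False using nx unfolding rank_rel_def by blast
  qed
qed

text \<open>By the definition of the ordered pair, both components of a pair in \<open>f\<close> lie
  two unions below \<open>f\<close>, so the description of the domain denotes.\<close>

lemma domain_of_iff:
  assumes "is_function mem f"
  shows "x \<epsilon> domain_of mem f \<longleftrightarrow> (\<exists>y. \<langle>x, y\<rangle> \<epsilon> f)"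
proof -
  have sU: "small (\<Union>v\<in>(\<Union>u\<in>ext f. ext u). ext v)"
    by (intro small_Union) (use small_Union[OF small_ext] in simp)
  have "upair mem x x \<epsilon> \<langle>x, y\<rangle>" "x \<epsilon> upair mem x x" for x y
    using ext_upair unfolding opair_def by (metis ext_iff insertI1)+
  then have "{x. \<exists>y. \<langle>x, y\<rangle> \<epsilon> f} \<subseteq> (\<Union>v\<in>(\<Union>u\<in>ext f. ext u). ext v)"
    by (fastforce simp: ext_def)
  then have "small {x. \<exists>y. \<langle>x, y\<rangle> \<epsilon> f}"
    by (rule small_subset[OF sU]) (intro Dr)
  from mem_coll[OF this] show ?thesis unfolding domain_of_def the_set_coll by simp
qed

lemma range_of_iff:
  assumes "is_function mem f"
  shows "y \<epsilon> range_of mem f \<longleftrightarrow> (\<exists>x. \<langle>x, y\<rangle> \<epsilon> f)"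
proof -
  have sU: "small (\<Union>v\<in>(\<Union>u\<in>ext f. ext u). ext v)"
    by (intro small_Union) (use small_Union[OF small_ext] in simp)
  have "upair mem x y \<epsilon> \<langle>x, y\<rangle>" "y \<epsilon> upair mem x y" for x y
    using ext_upair unfolding opair_def by (metis ext_iff insert_iff)+
  then have "{y. \<exists>x. \<langle>x, y\<rangle> \<epsilon> f} \<subseteq> (\<Union>v\<in>(\<Union>u\<in>ext f. ext u). ext v)"
    by (fastforce simp: ext_def)
  then have "small {y. \<exists>x. \<langle>x, y\<rangle> \<epsilon> f}"
    by (rule small_subset[OF sU]) (intro Dr)
  from mem_coll[OF this] show ?thesis unfolding range_of_def the_set_coll by simp
qed

lemma app_eq:
  assumes "is_function mem f" "\<langle>x, y\<rangle> \<epsilon> f"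
  shows "app mem f x = y"
  unfolding app_def by (rule the_equality) (use assms in \<open>auto simp: is_function_def\<close>)

lemma app_in:
  assumes "is_function mem f" "x \<epsilon> domain_of mem f"
  shows "\<langle>x, app mem f x\<rangle> \<epsilon> f"
  using assms app_eq by (auto simp: domain_of_iff)

lemma rank_function_iff:
  assumes "trans_set t"
  shows "rank_function mem r t \<longleftrightarrow> rank_approx r t"
proof (cases "is_function mem r \<and> domain_of mem r = t")
  case True
  then have f: "is_function mem r" "\<And>x. x \<epsilon> t \<longleftrightarrow> (\<exists>k. \<langle>x, k\<rangle> \<epsilon> r)" by (auto simp: domain_of_iff)
  have ap: "\<langle>x, k\<rangle> \<epsilon> r \<longleftrightarrow> x \<epsilon> t \<and> k = app mem r x" for x k
    using f True app_eq app_in by blast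
  have *: "(\<exists>y. y \<epsilon> x \<and> z \<epsilon> sc (app mem r y)) \<longleftrightarrow> (\<exists>y. y \<epsilon> x \<and> (\<exists>l. \<langle>y, l\<rangle> \<epsilon> r \<and> z \<epsilon> sc l))"
    if "x \<epsilon> t" for x z
    using assms that unfolding trans_set_def ap by blast
  have **: "(\<forall>x k. \<langle>x, k\<rangle> \<epsilon> r \<longrightarrow> Q x k) \<longleftrightarrow> (\<forall>x. x \<epsilon> t \<longrightarrow> Q x (app mem r x))" for Q
    unfolding ap by blast
  have "rank_approx r t \<longleftrightarrow> (\<forall>x. x \<epsilon> t \<longrightarrow> (\<forall>z. z \<epsilon> app mem r x \<longleftrightarrow> (\<exists>y. y \<epsilon> x \<and> (\<exists>l. \<langle>y, l\<rangle> \<epsilon> r \<and> z \<epsilon> sc l))))"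
    unfolding rank_approx_def ** using f by blast
  also have "\<dots> \<longleftrightarrow> rank_function mem r t"
    using True * unfolding rank_function_def by (simp del: in_succ)
  finally show ?thesis ..
next
  case False
  moreover have "domain_of mem r = t" if "rank_approx r t"
    by (rule extensional) (use that in \<open>auto simp: rank_approx_def domain_of_iff\<close>)
  ultimately show ?thesis unfolding rank_function_def rank_approx_def by blast
qed

lemma rank_eq: "rank mem x = k \<longleftrightarrow> rank_rel x k"
proof -
  have "(\<exists>t r. (\<forall>y. y \<epsilon> t \<longrightarrow> subset_of mem y t) \<and> x \<epsilon> t \<and> rank_function mem r t \<and> k = app mem r x)
      \<longleftrightarrow> rank_rel x k" for k
  proof
    assume "\<exists>t r. (\<forall>y. y \<epsilon> t \<longrightarrow> subset_of mem y t) \<and> x \<epsilon> t \<and> rank_function mem r t \<and> k = app mem r x"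
    then obtain t r where t: "trans_set t" "x \<epsilon> t" "rank_function mem r t" "k = app mem r x"
      unfolding trans_set_def subset_of_def by blast
    then have "rank_approx r t" by (simp add: rank_function_iff)
    moreover have "\<langle>x, k\<rangle> \<epsilon> r" using t app_in unfolding rank_function_def by blast
    ultimately show "rank_rel x k" using t unfolding rank_rel_def by blast
  next
    assume "rank_rel x k"
    then obtain t r where t: "trans_set t" "rank_approx r t" "\<langle>x, k\<rangle> \<epsilon> r" unfolding rank_rel_def by blast
    then have "x \<epsilon> t" "k = app mem r x" using app_eq unfolding rank_approx_def by blast+
    then show "\<exists>t r. (\<forall>y. y \<epsilon> t \<longrightarrow> subset_of mem y t) \<and> x \<epsilon> t \<and> rank_function mem r t \<and> k = app mem r x"
      using t rank_function_iff[OF t(1)] unfolding trans_set_def subset_of_def by blast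
  qed
  then have "rank mem x = (THE k. rank_rel x k)" unfolding rank_def by simp
  moreover obtain k' where k': "rank_rel x k'" using rank_rel_exists by blast
  ultimately show ?thesis using rank_rel_unique by (metis the_equality)
qed

lemma Dt_rank [Dr]: "Dt t \<Longrightarrow> Dt (\<lambda>s. rank mem (t s))"
proof (erule Dt_app1[rotated])
  have "D (\<lambda>s. rank_rel (s 1) (s 0))" by (intro Dr)
  then show "Dt (\<lambda>s. rank mem (s 0))" unfolding Dt_def by (simp add: rank_eq[symmetric] eq_commute)
qed

lemma in_rank: "z \<epsilon> rank mem x \<longleftrightarrow> (\<exists>y. y \<epsilon> x \<and> (z \<epsilon> rank mem y \<or> z = rank mem y))"
proof -
  have "rank_rel x (rank mem x)" using rank_eq by blast
  from rank_rel_elem(1)[OF this, of z] show ?thesis unfolding rank_eq[symmetric] by simp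
qed

lemma rank_trans: "z \<epsilon> rank mem x \<Longrightarrow> w \<epsilon> z \<Longrightarrow> w \<epsilon> rank mem x"
proof -
  have "\<forall>z w. z \<epsilon> rank mem x \<longrightarrow> w \<epsilon> z \<longrightarrow> w \<epsilon> rank mem x"
  proof (rule mem_induct[of _ x])
    show "D (\<lambda>s. \<forall>z w. z \<epsilon> rank mem (s 0) \<longrightarrow> w \<epsilon> z \<longrightarrow> w \<epsilon> rank mem (s 0))" by (intro Dr)
    fix x assume "\<And>y. y \<epsilon> x \<Longrightarrow> \<forall>z w. z \<epsilon> rank mem y \<longrightarrow> w \<epsilon> z \<longrightarrow> w \<epsilon> rank mem y"
    then show "\<forall>z w. z \<epsilon> rank mem x \<longrightarrow> w \<epsilon> z \<longrightarrow> w \<epsilon> rank mem x"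
      unfolding in_rank[of _ x] by blast
  qed
  then show "z \<epsilon> rank mem x \<Longrightarrow> w \<epsilon> z \<Longrightarrow> w \<epsilon> rank mem x" by blast
qed

text \<open>By a double membership induction: if neither rank belongs to the other, the ranks of the
  elements on each side belong to the opposite rank, and transitivity of ranks makes the two
  extensions equal.\<close>

lemma rank_linear:
  "rank mem x \<epsilon> rank mem y \<or> rank mem x = rank mem y \<or> rank mem y \<epsilon> rank mem x" (is "?T x y")
proof -
  have "\<forall>y. ?T x y"
  proof (rule mem_induct[of _ x])
    show "D (\<lambda>s. \<forall>y. ?T (s 0) y)" by (intro Dr)
    fix x assume IH: "\<And>x'. x' \<epsilon> x \<Longrightarrow> \<forall>y. ?T x' y"
    show "\<forall>y. ?T x y"
    proof
      fix y
      show "?T x y"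
      proof (rule mem_induct[of _ y])
        show "D (\<lambda>s. ?T x (s 0))" by (intro Dr)
        fix y assume IH': "\<And>y'. y' \<epsilon> y \<Longrightarrow> ?T x y'"
        show "?T x y"
        proof (cases "rank mem x \<epsilon> rank mem y \<or> rank mem y \<epsilon> rank mem x")
          case False
          have "rank mem x = rank mem y"
          proof (rule extensional, rule iffI)
            fix z assume "z \<epsilon> rank mem x"
            then obtain x' where x': "x' \<epsilon> x" "z \<epsilon> rank mem x' \<or> z = rank mem x'"
              using in_rank by blast
            then have "rank mem x' \<epsilon> rank mem x" using in_rank by blast
            then have "rank mem x' \<epsilon> rank mem y" using IH[OF x'(1)] False rank_trans by metis
            then show "z \<epsilon> rank mem y" using x'(2) rank_trans by blast
          next
            fix z assume "z \<epsilon> rank mem y"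
            then obtain y' where y': "y' \<epsilon> y" "z \<epsilon> rank mem y' \<or> z = rank mem y'"
              using in_rank by blast
            then have "rank mem y' \<epsilon> rank mem y" using in_rank by blast
            then have "rank mem y' \<epsilon> rank mem x" using IH'[OF y'(1)] False rank_trans by metis
            then show "z \<epsilon> rank mem x" using y'(2) rank_trans by blast
          qed
          then show ?thesis by blast
        qed blast
      qed
    qed
  qed
  then show ?thesis by blast
qed

lemma D_subset_of [Dr]: "Dt t \<Longrightarrow> Dt u \<Longrightarrow> D (\<lambda>s. subset_of mem (t s) (u s))"
  by (rule D_app2) (unfold subset_of_def, intro Dr)

text \<open>This is a level of the cumulative hierarchy. The members of such an \<open>x\<close>
  have rank at most that of some \<open>b\<close> in \<open>a\<close>, so \<open>x\<close> is a
  subset of the union of earlier levels and the power set axiom applies.\<close>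

lemma small_rank_le: "small {x. subset_of mem (rank mem x) (rank mem a)}"
proof (rule mem_induct[of _ a])
  have "D (\<lambda>s. \<exists>u. \<forall>x. x \<epsilon> u \<longleftrightarrow> subset_of mem (rank mem x) (rank mem (s 0)))" by (intro Dr)
  then show "D (\<lambda>s. small {x. subset_of mem (rank mem x) (rank mem (s 0))})"
    by (simp add: small_def set_eq_iff eq_commute)
  fix a assume IH: "\<And>b. b \<epsilon> a \<Longrightarrow> small {x. subset_of mem (rank mem x) (rank mem b)}"
  define M where "M = (\<Union>b\<in>ext a. {x. subset_of mem (rank mem x) (rank mem b)})"
  have M: "small M" unfolding M_def
    by (rule small_UN) (use IH in \<open>auto intro!: Dr\<close>)
  have "{x. subset_of mem (rank mem x) (rank mem a)} \<subseteq> {u. ext u \<subseteq> M}"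
  proof (intro subsetI CollectI)
    fix x y assume x: "x \<in> {x. subset_of mem (rank mem x) (rank mem a)}" and y: "y \<in> ext x"
    then have "rank mem y \<epsilon> rank mem a" using in_rank[of _ x] unfolding subset_of_def by auto
    then obtain b where "b \<epsilon> a" "rank mem y \<epsilon> rank mem b \<or> rank mem y = rank mem b"
      using in_rank by blast
    then show "y \<in> M" unfolding M_def subset_of_def using rank_trans by (auto simp: Bex_def)
  qed
  then show "small {x. subset_of mem (rank mem x) (rank mem a)}"
    by (rule small_subset[OF small_Pow[OF M]]) (intro Dr)
qed

text \<open>The ranks of members of \<open>P\<close> that do not exceed the rank of \<open>a\<close>
  form a set. Foundation gives a minimal one, and linearity makes it least for the whole
  class.\<close>

lemma min_rank:
  assumes "D (\<lambda>s. P (s 0))" "P a"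
  shows "\<exists>x. P x \<and> (\<forall>y. P y \<longrightarrow> subset_of mem (rank mem x) (rank mem y))"
proof -
  define S where "S = rank mem ` {x \<in> {x. subset_of mem (rank mem x) (rank mem a)}. P x}"
  have S: "small S" unfolding S_def
    by (rule small_image[OF small_sep[OF small_rank_le assms(1)]]) (intro Dr)
  have "rank mem a \<in> S" using assms(2) by (auto simp: S_def subset_of_def)
  then have "rank mem a \<epsilon> coll S" by (simp add: mem_coll S)
  from foundation[OF this] obtain k where k: "k \<in> S" "\<And>z. z \<in> S \<Longrightarrow> \<not> z \<epsilon> k"
    unfolding mem_coll[OF S] by blast
  then obtain x where x: "P x" "k = rank mem x" "subset_of mem (rank mem x) (rank mem a)"
    unfolding S_def by blast
  have "subset_of mem (rank mem x) (rank mem y)" if "P y" for y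
  proof (cases "rank mem y \<epsilon> rank mem x")
    case True
    then have "subset_of mem (rank mem y) (rank mem a)"
      using x(3) rank_trans unfolding subset_of_def by blast
    then have "rank mem y \<in> S" using that unfolding S_def by blast
    then show ?thesis using k(2) x(2) True by blast
  next
    case False
    then have "rank mem x \<epsilon> rank mem y \<or> rank mem x = rank mem y" using rank_linear by blast
    then show ?thesis using rank_trans[of "rank mem x" y] unfolding subset_of_def by auto
  qed
  then show ?thesis using x(1) by blast
qed

lemma in_scott:
  assumes "D (\<lambda>s. P (s 0))" "P a"
  shows "x \<epsilon> scott mem P \<longleftrightarrow> P x \<and> (\<forall>y. P y \<longrightarrow> subset_of mem (rank mem x) (rank mem y))"
proof -
  have "small {x. P x \<and> (\<forall>y. P y \<longrightarrow> subset_of mem (rank mem x) (rank mem y))}"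
  proof (rule small_subset[OF small_rank_le[of a]])
    show "{x. P x \<and> (\<forall>y. P y \<longrightarrow> subset_of mem (rank mem x) (rank mem y))} \<subseteq>
        {x. subset_of mem (rank mem x) (rank mem a)}" using assms(2) by blast
    show "D (\<lambda>s. s 0 \<in> {x. P x \<and> (\<forall>y. P y \<longrightarrow> subset_of mem (rank mem x) (rank mem y))})"
      by (intro Dr D_app1[OF assms(1)])
  qed
  from mem_coll[OF this] show ?thesis unfolding scott_def the_set_coll by simp
qed

lemma scott_nonempty:
  assumes "D (\<lambda>s. P (s 0))" "P a"
  shows "\<exists>x. x \<epsilon> scott mem P \<and> P x"
  using min_rank[of P, OF assms] in_scott[of P, OF assms] by blast

lemma Dt_scott:
  assumes "D (\<lambda>s. P (\<lambda>i. s (Suc i)) (s 0))"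
  shows "Dt (\<lambda>s. scott mem (P s))"
proof -
  have "D (\<lambda>s. P (\<lambda>i. s (Suc (Suc i))) (s 0))"
    using D_ren[OF assms, of "case_nat 0 (\<lambda>i. Suc (Suc i))"] by (auto simp: inj_def split: nat.splits)
  then show ?thesis unfolding scott_def by (intro Dr assms)
qed

section \<open>Sequences and countable choice\<close>

lemma in_seq_of:
  assumes "Dt (\<lambda>s. t (s 0))"
  shows "p \<epsilon> seq_of mem t \<longleftrightarrow> (\<exists>n. n \<in> N \<and> p = \<langle>n, t n\<rangle>)"
proof -
  have "small ((\<lambda>n. \<langle>n, t n\<rangle>) ` N)"
    by (rule small_image[OF small_ext]) (intro Dr Dt_app1[OF assms])
  moreover have "(\<lambda>n. \<langle>n, t n\<rangle>) ` N = {p. \<exists>n. n \<epsilon> omega mem \<and> p = \<langle>n, t n\<rangle>}" by (auto simp: ext_def)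
  ultimately show ?thesis unfolding seq_of_def the_set_coll using mem_coll by simp
qed

lemma seq_of:
  assumes "Dt (\<lambda>s. t (s 0))"
  shows "sequence mem (seq_of mem t)" "n \<in> N \<Longrightarrow> app mem (seq_of mem t) n = t n"
proof -
  have f: "is_function mem (seq_of mem t)"
    unfolding is_function_def in_seq_of[OF assms] by auto
  moreover have "domain_of mem (seq_of mem t) = omega mem"
    by (rule extensional) (simp add: domain_of_iff f in_seq_of assms)
  ultimately show "sequence mem (seq_of mem t)" unfolding sequence_def by blast
  show "n \<in> N \<Longrightarrow> app mem (seq_of mem t) n = t n"
    by (rule app_eq[OF f]) (simp add: in_seq_of assms)
qed

text \<open>Off \<open>omega\<close> the value of \<open>app\<close> is unspecified; the default
  \<open>z0\<close> replaces it by a value for which the graph is definable.\<close>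

lemma sequence_term:
  assumes "sequence mem f"
  shows "\<exists>F. Dt (\<lambda>s. F (s 0)) \<and> (\<forall>n\<in>N. F n = app mem f n)"
proof -
  have f: "is_function mem f" "\<And>n. n \<in> N \<longleftrightarrow> (\<exists>y. \<langle>n, y\<rangle> \<epsilon> f)"
    using assms domain_of_iff[of f] unfolding sequence_def by auto
  define F where "F n = (if n \<in> N then app mem f n else z0)" for n
  have "y = F n \<longleftrightarrow> \<langle>n, y\<rangle> \<epsilon> f \<or> n \<notin> N \<and> y = z0" for n y
    using f app_eq[OF f(1)] unfolding F_def by auto
  then have "Dt (\<lambda>s. F (s 0))" unfolding Dt_def by simp (intro Dr)
  then show ?thesis unfolding F_def by auto
qed

text \<open>\<open>AC_omega\<close> chooses from a sequence of sets, whereas the solutions of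
  \<open>P n\<close> may form a proper class; their members of minimal rank form a set that depends
  definably on \<open>n\<close>.\<close>

lemma choice:
  assumes "AC_omega mem" "D (\<lambda>s. P (s 0) (s 1))" "\<And>n. n \<in> N \<Longrightarrow> \<exists>x. P n x"
  shows "\<exists>F. Dt (\<lambda>s. F (s 0)) \<and> (\<forall>n\<in>N. P n (F n))"
proof -
  have DP: "D (\<lambda>s. P n (s 0))" for n by (intro D_app2[OF assms(2)] Dr)
  have T: "Dt (\<lambda>s. scott mem (P (s 0)))"
    by (rule Dt_scott) (intro D_app2[OF assms(2)] Dr)
  have sc: "\<exists>x. x \<epsilon> scott mem (P n)" "x \<epsilon> scott mem (P n) \<Longrightarrow> P n x" if n: "n \<in> N" for n x
  proof -
    obtain a where a: "P n a" using assms(3)[OF n] by blast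
    show "\<exists>x. x \<epsilon> scott mem (P n)" using scott_nonempty[of "P n", OF DP a] by blast
    show "x \<epsilon> scott mem (P n) \<Longrightarrow> P n x" using in_scott[of "P n", OF DP a] by blast
  qed
  note S = seq_of[of "\<lambda>n. scott mem (P n)", OF T]
  have "\<exists>x. x \<epsilon> app mem (seq_of mem (\<lambda>n. scott mem (P n))) n" if "n \<epsilon> omega mem" for n
    using S(2)[of n] sc(1)[of n] that by simp
  then obtain f where f: "sequence mem f"
    "\<And>n. n \<in> N \<Longrightarrow> app mem f n \<epsilon> app mem (seq_of mem (\<lambda>n. scott mem (P n))) n"
    using assms(1) S(1) unfolding AC_omega_def ext_iff by blast
  obtain F where F: "Dt (\<lambda>s. F (s 0))" "\<And>n. n \<in> N \<Longrightarrow> F n = app mem f n"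
    using sequence_term[OF f(1)] by blast
  have "P n (F n)" if "n \<in> N" for n
    using f(2)[OF that] F(2)[OF that] S(2)[OF that] sc(2)[OF that] by simp
  then show ?thesis using F(1) by blast
qed

section \<open>Partial surjections\<close>

definition onto :: "('a \<Rightarrow> 'a \<Rightarrow> bool) \<Rightarrow> 'a set \<Rightarrow> 'a set \<Rightarrow> bool" where
  "onto R A B \<longleftrightarrow> (\<forall>x y. R x y \<longrightarrow> x \<in> A \<and> y \<in> B) \<and> (\<forall>x y z. R x y \<longrightarrow> R x z \<longrightarrow> y = z) \<and>
    (\<forall>y\<in>B. \<exists>x. R x y)"

definition le :: "'a set \<Rightarrow> 'a set \<Rightarrow> bool" (infix "\<preceq>" 50) where
  "B \<preceq> A \<longleftrightarrow> (\<exists>r. onto (\<lambda>x y. \<langle>x, y\<rangle> \<epsilon> r) A B)"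

definition eqv :: "'a set \<Rightarrow> 'a set \<Rightarrow> bool" (infix "\<approx>" 50) where
  "A \<approx> B \<longleftrightarrow> A \<preceq> B \<and> B \<preceq> A"

text \<open>Only the part of \<open>R\<close> between \<open>A\<close> and \<open>B\<close> is
  coded, so functionality is checked for arguments and values in these sets alone.\<close>

lemma leI:
  assumes "small A" "small B" "D (\<lambda>s. R (s 0) (s 1))"
    and "\<And>x y z. x \<in> A \<Longrightarrow> y \<in> B \<Longrightarrow> z \<in> B \<Longrightarrow> R x y \<Longrightarrow> R x z \<Longrightarrow> y = z"
    and "\<And>y. y \<in> B \<Longrightarrow> \<exists>x\<in>A. R x y"
  shows "B \<preceq> A"
proof -
  have "D (\<lambda>s. s 0 \<in> A \<and> s 1 \<in> B \<and> R (s 0) (s 1))"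
    by (intro Dr assms(3) D_small[OF assms(1)] D_small[OF assms(2)])
  from small_rel[of A B "\<lambda>x y. x \<in> A \<and> y \<in> B \<and> R x y", OF assms(1,2) this]
  obtain r where r: "\<And>x y. \<langle>x, y\<rangle> \<epsilon> r \<longleftrightarrow> x \<in> A \<and> y \<in> B \<and> R x y" by auto
  have "onto (\<lambda>x y. \<langle>x, y\<rangle> \<epsilon> r) A B"
    unfolding onto_def r using assms(4,5) by blast
  then show ?thesis unfolding le_def by blast
qed

lemma leE:
  assumes "B \<preceq> A"
  obtains R where "\<And>t u. Dt t \<Longrightarrow> Dt u \<Longrightarrow> D (\<lambda>s. R (t s) (u s))"
    and "\<And>x y. R x y \<Longrightarrow> x \<in> A" "\<And>x y. R x y \<Longrightarrow> y \<in> B"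
    and "\<And>x y z. R x y \<Longrightarrow> R x z \<Longrightarrow> y = z" and "\<And>y. y \<in> B \<Longrightarrow> \<exists>x. R x y"
proof -
  obtain r where r: "onto (\<lambda>x y. \<langle>x, y\<rangle> \<epsilon> r) A B" using assms unfolding le_def by blast
  show ?thesis
    by (rule that[of "\<lambda>x y. \<langle>x, y\<rangle> \<epsilon> r"]) (use r in \<open>auto simp: onto_def intro!: Dr\<close>)
qed

lemma le_refl: "small A \<Longrightarrow> A \<preceq> A"
  by (rule leI[where R = "(=)"]) (auto intro!: Dr)

lemma le_trans:
  assumes "small A" "small C" "C \<preceq> B" "B \<preceq> A"
  shows "C \<preceq> A"
proof -
  from assms(3) obtain R where R: "\<And>t u. Dt t \<Longrightarrow> Dt u \<Longrightarrow> D (\<lambda>s. R (t s) (u s))"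
    "\<And>x y. R x y \<Longrightarrow> x \<in> B" "\<And>x y z. R x y \<Longrightarrow> R x z \<Longrightarrow> y = z" "\<And>y. y \<in> C \<Longrightarrow> \<exists>x. R x y"
    by (elim leE) blast
  from assms(4) obtain S where S: "\<And>t u. Dt t \<Longrightarrow> Dt u \<Longrightarrow> D (\<lambda>s. S (t s) (u s))"
    "\<And>x y. S x y \<Longrightarrow> x \<in> A" "\<And>x y z. S x y \<Longrightarrow> S x z \<Longrightarrow> y = z" "\<And>y. y \<in> B \<Longrightarrow> \<exists>x. S x y"
    by (elim leE) blast
  show ?thesis
  proof (rule leI[where R = "\<lambda>x z. \<exists>y. S x y \<and> R y z"])
    show "D (\<lambda>s. \<exists>y. S (s 0) y \<and> R y (s 1))" by (intro Dr R(1) S(1))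
    show "y = z" if "\<exists>w. S x w \<and> R w y" "\<exists>w. S x w \<and> R w z" for x y z
      using that R(3) S(3) by metis
    show "\<exists>x\<in>A. \<exists>w. S x w \<and> R w y" if "y \<in> C" for y
      using R(4)[OF that] R(2) S(4,2) by blast
  qed (use assms in simp_all)
qed

lemma subset_le: "small A \<Longrightarrow> small B \<Longrightarrow> B \<subseteq> A \<Longrightarrow> B \<preceq> A"
  by (rule leI[where R = "(=)"]) (auto intro!: Dr)

lemma image_le:
  assumes "small A" "Dt (\<lambda>s. f (s 0))"
  shows "f ` A \<preceq> A"
proof (rule leI[where R = "\<lambda>x y. y = f x"])
  show "D (\<lambda>s. s 1 = f (s 0))" by (intro Dr Dt_app1[OF assms(2)])
qed (use assms small_image in auto)

lemma inj_image_le: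
  assumes "small A" "Dt (\<lambda>s. f (s 0))" "inj_on f A"
  shows "A \<preceq> f ` A"
proof (rule leI[where R = "\<lambda>x y. x = f y"])
  show "D (\<lambda>s. s 0 = f (s 1))" by (intro Dr Dt_app1[OF assms(2)])
qed (use assms small_image in \<open>auto simp: inj_on_def\<close>)

lemma inj_image_eqv: "small A \<Longrightarrow> Dt (\<lambda>s. f (s 0)) \<Longrightarrow> inj_on f A \<Longrightarrow> f ` A \<approx> A"
  unfolding eqv_def using image_le inj_image_le by blast

lemma eqv_refl: "small A \<Longrightarrow> A \<approx> A"
  by (simp add: eqv_def le_refl)

lemma eqv_sym: "A \<approx> B \<Longrightarrow> B \<approx> A"
  by (simp add: eqv_def)

lemma eqv_trans: "small A \<Longrightarrow> small C \<Longrightarrow> A \<approx> B \<Longrightarrow> B \<approx> C \<Longrightarrow> A \<approx> C"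
  unfolding eqv_def using le_trans by blast

subsection \<open>Binary sums\<close>

abbreviation z1 :: 'a where "z1 \<equiv> sc z0"

definition plus :: "'a set \<Rightarrow> 'a set \<Rightarrow> 'a set" (infixr "\<oplus>" 65) where
  "A \<oplus> B = {p. (\<exists>x. x \<in> A \<and> p = \<langle>x, z0\<rangle>) \<or> (\<exists>y. y \<in> B \<and> p = \<langle>y, z1\<rangle>)}"

lemma plus_iff: "p \<in> A \<oplus> B \<longleftrightarrow> (\<exists>x. x \<in> A \<and> p = \<langle>x, z0\<rangle>) \<or> (\<exists>y. y \<in> B \<and> p = \<langle>y, z1\<rangle>)"
  by (simp add: plus_def)

lemma plus_pr [simp]: "\<langle>x, z0\<rangle> \<in> A \<oplus> B \<longleftrightarrow> x \<in> A" "\<langle>x, z1\<rangle> \<in> A \<oplus> B \<longleftrightarrow> x \<in> B"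
  by (auto simp: plus_iff)

lemma plusE:
  assumes "p \<in> A \<oplus> B"
  obtains x where "x \<in> A" "p = \<langle>x, z0\<rangle>" | y where "y \<in> B" "p = \<langle>y, z1\<rangle>"
  using assms by (auto simp: plus_iff)

lemma D_plus [Dr]:
  "D (\<lambda>s. (\<exists>x. x \<in> A s \<and> t s = \<langle>x, z0\<rangle>) \<or> (\<exists>y. y \<in> B s \<and> t s = \<langle>y, z1\<rangle>)) \<Longrightarrow> D (\<lambda>s. t s \<in> A s \<oplus> B s)"
  by (simp add: plus_iff)

lemma small_plus [simp]:
  assumes "small A" "small B"
  shows "small (A \<oplus> B)"
proof (rule small_subset[of "(A \<union> B) \<otimes> {z0, z1}"])
  show "small ((A \<union> B) \<otimes> {z0, z1})" by (intro small_times small_Un small_pair assms)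
  show "A \<oplus> B \<subseteq> (A \<union> B) \<otimes> {z0, z1}" by (auto simp: plus_iff times_iff)
  show "D (\<lambda>s. s 0 \<in> A \<oplus> B)" by (intro Dr D_small[OF assms(1)] D_small[OF assms(2)])
qed

lemma plus_mono:
  assumes "small A'" "small B'" "small A" "small B" "A \<preceq> A'" "B \<preceq> B'"
  shows "A \<oplus> B \<preceq> A' \<oplus> B'"
proof -
  from assms(5) obtain R where R: "\<And>t u. Dt t \<Longrightarrow> Dt u \<Longrightarrow> D (\<lambda>s. R (t s) (u s))"
    "\<And>x y. R x y \<Longrightarrow> x \<in> A'" "\<And>x y z. R x y \<Longrightarrow> R x z \<Longrightarrow> y = z" "\<And>y. y \<in> A \<Longrightarrow> \<exists>x. R x y"
    by (elim leE) blast
  from assms(6) obtain S where S: "\<And>t u. Dt t \<Longrightarrow> Dt u \<Longrightarrow> D (\<lambda>s. S (t s) (u s))"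
    "\<And>x y. S x y \<Longrightarrow> x \<in> B'" "\<And>x y z. S x y \<Longrightarrow> S x z \<Longrightarrow> y = z" "\<And>y. y \<in> B \<Longrightarrow> \<exists>x. S x y"
    by (elim leE) blast
  let ?R = "\<lambda>p q. (\<exists>x y. p = \<langle>x, z0\<rangle> \<and> q = \<langle>y, z0\<rangle> \<and> R x y) \<or> (\<exists>x y. p = \<langle>x, z1\<rangle> \<and> q = \<langle>y, z1\<rangle> \<and> S x y)"
  show ?thesis
  proof (rule leI[where R = ?R])
    show "D (\<lambda>s. ?R (s 0) (s 1))" by (intro Dr R(1) S(1))
    show "\<exists>x\<in>A' \<oplus> B'. ?R x y" if "y \<in> A \<oplus> B" for y
      using that
    proof (cases rule: plusE)
      case (1 a)
      then obtain x where "R x a" "x \<in> A'" using R by blast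
      then show ?thesis using 1 by (intro bexI[of _ "\<langle>x, z0\<rangle>"]) auto
    next
      case (2 b)
      then obtain x where "S x b" "x \<in> B'" using S by blast
      then show ?thesis using 2 by (intro bexI[of _ "\<langle>x, z1\<rangle>"]) auto
    qed
  qed (use assms R(3) S(3) in auto)
qed

lemma plus_commute_le: "small A \<Longrightarrow> small B \<Longrightarrow> A \<oplus> B \<preceq> B \<oplus> A"
proof -
  assume s: "small A" "small B"
  let ?R = "\<lambda>p q. \<exists>x. (p = \<langle>x, z0\<rangle> \<and> q = \<langle>x, z1\<rangle>) \<or> (p = \<langle>x, z1\<rangle> \<and> q = \<langle>x, z0\<rangle>)"
  show ?thesis
  proof (rule leI[where R = ?R])
    show "D (\<lambda>s. ?R (s 0) (s 1))" by (intro Dr)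
    show "\<exists>x\<in>B \<oplus> A. ?R x y" if "y \<in> A \<oplus> B" for y
      using that by (auto simp: plus_iff)
  qed (use s in auto)
qed

lemma plus_assoc_le:
  assumes "small A" "small B" "small C"
  shows "(A \<oplus> B) \<oplus> C \<preceq> A \<oplus> (B \<oplus> C)"
proof -
  let ?R = "\<lambda>p q. \<exists>x. (p = \<langle>x, z0\<rangle> \<and> q = \<langle>\<langle>x, z0\<rangle>, z0\<rangle>) \<or> (p = \<langle>\<langle>x, z0\<rangle>, z1\<rangle> \<and> q = \<langle>\<langle>x, z1\<rangle>, z0\<rangle>) \<or>
    (p = \<langle>\<langle>x, z1\<rangle>, z1\<rangle> \<and> q = \<langle>x, z1\<rangle>)"
  show ?thesis
  proof (rule leI[where R = ?R])
    show "D (\<lambda>s. ?R (s 0) (s 1))" by (intro Dr)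
    show "\<exists>x\<in>A \<oplus> (B \<oplus> C). ?R x y" if "y \<in> (A \<oplus> B) \<oplus> C" for y
      using that
      by (elim plusE) (auto intro: bexI[of _ "\<langle>a, z0\<rangle>" for a] bexI[of _ "\<langle>\<langle>a, b\<rangle>, z1\<rangle>" for a b])
  qed (use assms in auto)
qed

lemma plus_commute: "small A \<Longrightarrow> small B \<Longrightarrow> A \<oplus> B \<approx> B \<oplus> A"
  by (simp add: eqv_def plus_commute_le)

lemma plus_cong:
  "small A \<Longrightarrow> small B \<Longrightarrow> small A' \<Longrightarrow> small B' \<Longrightarrow> A \<approx> A' \<Longrightarrow> B \<approx> B' \<Longrightarrow> A \<oplus> B \<approx> A' \<oplus> B'"
  by (simp add: eqv_def plus_mono)

text \<open>The second inequality follows from the first one by commuting both sums, so only one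
  bracketing has to be computed.\<close>

lemma plus_assoc:
  assumes "small A" "small B" "small C"
  shows "(A \<oplus> B) \<oplus> C \<approx> A \<oplus> (B \<oplus> C)"
proof -
  have "A \<oplus> (B \<oplus> C) \<preceq> (B \<oplus> C) \<oplus> A" by (intro plus_commute_le small_plus assms)
  moreover have "(B \<oplus> C) \<oplus> A \<preceq> (C \<oplus> B) \<oplus> A"
    by (intro plus_mono plus_commute_le le_refl small_plus assms)
  moreover have "(C \<oplus> B) \<oplus> A \<preceq> C \<oplus> (B \<oplus> A)" by (intro plus_assoc_le assms)
  moreover have "C \<oplus> (B \<oplus> A) \<preceq> (B \<oplus> A) \<oplus> C" by (intro plus_commute_le small_plus assms)
  moreover have "(B \<oplus> A) \<oplus> C \<preceq> (A \<oplus> B) \<oplus> C"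
    by (intro plus_mono plus_commute_le le_refl small_plus assms)
  ultimately have "A \<oplus> (B \<oplus> C) \<preceq> (A \<oplus> B) \<oplus> C"
    by (meson assms small_plus le_trans)
  then show ?thesis using plus_assoc_le assms by (simp add: eqv_def)
qed

lemma Un_le_plus: "small A \<Longrightarrow> small B \<Longrightarrow> A \<union> B \<preceq> A \<oplus> B"
proof -
  assume s: "small A" "small B"
  let ?R = "\<lambda>p x. p = \<langle>x, z0\<rangle> \<or> p = \<langle>x, z1\<rangle>"
  show ?thesis
  proof (rule leI[where R = ?R])
    show "D (\<lambda>s. ?R (s 0) (s 1))" by (intro Dr)
  qed (use s in \<open>auto simp: small_Un plus_iff\<close>)
qed

lemma Un_eqv_plus:
  assumes "small A" "small B" "A \<inter> B = {}"
  shows "A \<union> B \<approx> A \<oplus> B"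
proof -
  let ?R = "\<lambda>x p. (x \<in> A \<and> p = \<langle>x, z0\<rangle>) \<or> (x \<in> B \<and> p = \<langle>x, z1\<rangle>)"
  have "A \<oplus> B \<preceq> A \<union> B"
  proof (rule leI[where R = ?R])
    show "D (\<lambda>s. ?R (s 0) (s 1))" by (intro Dr D_small[OF assms(1)] D_small[OF assms(2)])
  qed (use assms in \<open>auto simp: small_Un plus_iff\<close>)
  then show ?thesis using Un_le_plus assms by (simp add: eqv_def)
qed

lemma le_plus1: "small A \<Longrightarrow> small B \<Longrightarrow> A \<preceq> A \<oplus> B"
proof -
  assume s: "small A" "small B"
  show ?thesis
  proof (rule leI[where R = "\<lambda>p x. p = \<langle>x, z0\<rangle>"])
    show "D (\<lambda>s. s 0 = \<langle>s 1, z0\<rangle>)" by (intro Dr)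
  qed (use s in auto)
qed

lemma plus_empty: "small A \<Longrightarrow> A \<oplus> {} \<approx> A"
  using Un_eqv_plus[of A "{}"] by (simp add: small_empty eqv_sym)

text \<open>The class of all sets equivalent to a given one turns equivalence into equality and makes
  sums rearrangeable by rewriting.\<close>

definition q :: "'a set \<Rightarrow> 'a set set" where
  "q A = {B. small B \<and> A \<approx> B}"

text \<open>The explicit smallness conditions make commutativity and associativity hold for
  arbitrary arguments, so that these laws can be applied as unconditional rewrite rules.\<close>

definition padd :: "'a set set \<Rightarrow> 'a set set \<Rightarrow> 'a set set" (infixr "\<uplus>" 65) where
  "X \<uplus> Y = {C. small C \<and> (\<exists>A\<in>X. \<exists>B\<in>Y. small A \<and> small B \<and> C \<approx> A \<oplus> B)}"

lemma q_eq: "small A \<Longrightarrow> small B \<Longrightarrow> q A = q B \<longleftrightarrow> A \<approx> B"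
  unfolding q_def by (auto dest: eqv_sym intro: eqv_refl eqv_trans)

lemma q_plus: "small A \<Longrightarrow> small B \<Longrightarrow> q (A \<oplus> B) = q A \<uplus> q B"
  unfolding q_def padd_def
  by (auto intro: eqv_refl dest: eqv_sym)
    (meson eqv_sym eqv_trans plus_cong small_plus)+

lemma padd_commute: "X \<uplus> Y = Y \<uplus> X"
proof -
  have "X \<uplus> Y \<subseteq> Y \<uplus> X" for X Y
  proof
    fix C assume "C \<in> X \<uplus> Y"
    then obtain A B where m: "A \<in> X" "B \<in> Y" "small A" "small B" "small C" "C \<approx> A \<oplus> B"
      unfolding padd_def by blast
    then have "C \<approx> B \<oplus> A" using plus_commute small_plus eqv_trans by meson
    then show "C \<in> Y \<uplus> X" unfolding padd_def using m by blast
  qed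
  then show ?thesis by blast
qed

lemma padd_assoc_sub: "(X \<uplus> Y) \<uplus> Z \<subseteq> X \<uplus> (Y \<uplus> Z)"
proof
  fix C assume "C \<in> (X \<uplus> Y) \<uplus> Z"
  then obtain P E A B where s: "small C" "small P" "small E" "small A" "small B"
    and m: "A \<in> X" "B \<in> Y" "E \<in> Z" and e: "C \<approx> P \<oplus> E" "P \<approx> A \<oplus> B"
    unfolding padd_def by blast
  have "P \<oplus> E \<approx> (A \<oplus> B) \<oplus> E" by (intro plus_cong e eqv_refl small_plus s)
  then have "C \<approx> A \<oplus> (B \<oplus> E)"
    by (meson e(1) eqv_trans plus_assoc s small_plus)
  moreover have "B \<oplus> E \<in> Y \<uplus> Z" unfolding padd_def using s m eqv_refl small_plus by blast
  ultimately show "C \<in> X \<uplus> (Y \<uplus> Z)" unfolding padd_def[of X] using s m small_plus by blast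
qed

lemma padd_assoc: "(X \<uplus> Y) \<uplus> Z = X \<uplus> (Y \<uplus> Z)"
proof
  have "X \<uplus> (Y \<uplus> Z) = (Z \<uplus> Y) \<uplus> X" by (metis padd_commute)
  also have "\<dots> \<subseteq> Z \<uplus> (Y \<uplus> X)" by (rule padd_assoc_sub)
  also have "\<dots> = (X \<uplus> Y) \<uplus> Z" by (metis padd_commute)
  finally show "X \<uplus> (Y \<uplus> Z) \<subseteq> (X \<uplus> Y) \<uplus> Z" .
qed (rule padd_assoc_sub)

lemma padd_left_commute: "X \<uplus> (Y \<uplus> Z) = Y \<uplus> (X \<uplus> Z)"
  by (metis padd_assoc padd_commute)

lemmas padd_ac = padd_assoc padd_commute padd_left_commute

lemma q_Un: "small A \<Longrightarrow> small B \<Longrightarrow> A \<inter> B = {} \<Longrightarrow> q (A \<union> B) = q A \<uplus> q B"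
  using Un_eqv_plus q_eq q_plus small_Un small_plus by metis

lemma q_partition: "small A \<Longrightarrow> small B \<Longrightarrow> B \<subseteq> A \<Longrightarrow> small (A - B) \<Longrightarrow> q A = q B \<uplus> q (A - B)"
  using q_Un[of B "A - B"] by (simp add: Un_absorb1)

lemma le_cong: "small A \<Longrightarrow> small B \<Longrightarrow> small A' \<Longrightarrow> small B' \<Longrightarrow> q A = q A' \<Longrightarrow> q B = q B' \<Longrightarrow> A \<preceq> B \<Longrightarrow> A' \<preceq> B'"
  using q_eq le_trans unfolding eqv_def by metis

subsection \<open>Absorption\<close>

definition absorbs :: "'a set \<Rightarrow> 'a set \<Rightarrow> bool" where
  "absorbs A Y \<longleftrightarrow> A \<oplus> Y \<preceq> A"

text \<open>The inequality from \<open>A\<close> to the sum always holds, and absorption is its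
  converse. In this equational form absorbed summands can be added or deleted by rewriting.\<close>

lemma absorbs_iff: "small A \<Longrightarrow> small Y \<Longrightarrow> absorbs A Y \<longleftrightarrow> q A \<uplus> q Y = q A"
  unfolding absorbs_def using le_plus1[of A Y]
  by (simp add: eqv_def flip: q_plus q_eq) (simp add: q_eq eqv_def)

lemma absorbs_mono:
  assumes "small A" "small Y" "small Y'" "absorbs A Y" "Y' \<preceq> Y"
  shows "absorbs A Y'"
proof -
  have "A \<oplus> Y' \<preceq> A \<oplus> Y" by (intro plus_mono le_refl assms)
  then show ?thesis using assms le_trans small_plus unfolding absorbs_def by blast
qed

lemma absorbs_subset: "small A \<Longrightarrow> small Y \<Longrightarrow> small Y' \<Longrightarrow> absorbs A Y \<Longrightarrow> Y' \<subseteq> Y \<Longrightarrow> absorbs A Y'"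
  using absorbs_mono subset_le by blast

lemma absorbs_cong: "small A \<Longrightarrow> small B \<Longrightarrow> small Y \<Longrightarrow> q A = q B \<Longrightarrow> absorbs A Y \<Longrightarrow> absorbs B Y"
  by (simp add: absorbs_iff)

lemma absorbs_plus: "small A \<Longrightarrow> small B \<Longrightarrow> small Y \<Longrightarrow> absorbs A Y \<Longrightarrow> absorbs (A \<oplus> B) Y"
  by (simp add: absorbs_iff q_plus) (metis padd_assoc padd_commute)

lemma absorbs_plus2: "small A \<Longrightarrow> small Z \<Longrightarrow> small Y \<Longrightarrow> absorbs A Y \<Longrightarrow> absorbs A Z \<Longrightarrow> absorbs A (Y \<oplus> Z)"
  by (simp add: absorbs_iff q_plus) (metis padd_assoc)

lemma absorbs_superset:
  assumes "small A" "small U" "small (A - U)" "small Y" "U \<subseteq> A" "absorbs U Y"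
  shows "absorbs A Y"
proof -
  have "absorbs (U \<oplus> (A - U)) Y" by (intro absorbs_plus assms)
  then show ?thesis using q_partition[of A U] assms q_plus absorbs_cong small_plus by metis
qed

subsection \<open>Families and countable sums\<close>

text \<open>Indices are arbitrary elements, which keeps shifted and recursively defined families
  free of side conditions; only \<open>SG\<close> confines the index to \<open>N\<close>.\<close>

definition fam :: "('a \<Rightarrow> 'a set) \<Rightarrow> bool" where
  "fam F \<longleftrightarrow> (\<forall>n. small (F n)) \<and> D (\<lambda>s. s 1 \<in> F (s 0))"

lemma fam_small: "fam F \<Longrightarrow> small (F n)"
  by (simp add: fam_def)

lemma fam_D: "fam F \<Longrightarrow> Dt t \<Longrightarrow> Dt u \<Longrightarrow> D (\<lambda>s. t s \<in> F (u s))"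
  unfolding fam_def by (auto intro: D_fam)

lemma famI: "(\<And>n. small (F n)) \<Longrightarrow> D (\<lambda>s. s 1 \<in> F (s 0)) \<Longrightarrow> fam F"
  by (simp add: fam_def)

lemma fam_const: "small A \<Longrightarrow> fam (\<lambda>n. A)"
  by (rule famI) (auto intro: D_small Dt_var)

lemma fam_ext: "Dt (\<lambda>s. G (s 0)) \<Longrightarrow> fam (\<lambda>n. ext (G n))"
  by (rule famI) (auto intro!: Dr Dt_app1[of G])

lemma fam_comp:
  assumes "fam F" "Dt (\<lambda>s. G (s 0))"
  shows "fam (\<lambda>n. F (G n))"
  by (rule famI) (use assms in \<open>auto intro!: fam_small fam_D Dr Dt_app1[of G]\<close>)

lemma fam_plus: "fam F \<Longrightarrow> fam G \<Longrightarrow> fam (\<lambda>n. F n \<oplus> G n)"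
  by (rule famI) (auto simp: fam_small intro!: Dr fam_D)

lemma fam_subset:
  assumes "fam F" "\<And>n. G n \<subseteq> F n" "D (\<lambda>s. s 1 \<in> G (s 0))"
  shows "fam G"
proof (rule famI)
  show "small (G n)" for n
    by (rule small_subset[OF fam_small[OF assms(1), of n] assms(2)])
      (use D_fam[OF assms(3) Dt_var[of 0] Dt_const] in simp)
qed (rule assms(3))

lemma fam_Dt: "fam F \<Longrightarrow> Dt t \<Longrightarrow> Dt (\<lambda>s. coll (F (t s)))"
  by (rule Dt_app1[of "\<lambda>n. coll (F n)"]) (auto intro!: Dr fam_D)

lemma D_le_ext: "Dt t \<Longrightarrow> Dt u \<Longrightarrow> D (\<lambda>s. ext (t s) \<preceq> ext (u s))"
  by (rule D_app2) (unfold le_def onto_def, intro Dr)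

lemma D_le: "fam F \<Longrightarrow> fam G \<Longrightarrow> Dt t \<Longrightarrow> Dt u \<Longrightarrow> D (\<lambda>s. F (t s) \<preceq> G (u s))"
  using D_le_ext[OF fam_Dt fam_Dt, of F t G u] by (simp add: ext_coll fam_small)

lemma D_absorbs: "fam F \<Longrightarrow> fam G \<Longrightarrow> Dt t \<Longrightarrow> D (\<lambda>s. absorbs (F (t s)) (G (t s)))"
  unfolding absorbs_def by (rule D_le[where F = "\<lambda>n. F n \<oplus> G n"]) (auto intro: fam_plus)

definition SG :: "('a \<Rightarrow> 'a set) \<Rightarrow> 'a set" where
  "SG F = {p. \<exists>n x. n \<in> N \<and> x \<in> F n \<and> p = \<langle>x, n\<rangle>}"

lemma SG_pr [simp]: "\<langle>x, n\<rangle> \<in> SG F \<longleftrightarrow> n \<in> N \<and> x \<in> F n"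
  by (auto simp: SG_def)

lemma SG_iff: "p \<in> SG F \<longleftrightarrow> (\<exists>n x. n \<in> N \<and> x \<in> F n \<and> p = \<langle>x, n\<rangle>)"
  by (auto simp: SG_def)

lemma D_SG [Dr]: "D (\<lambda>s. \<exists>n x. n \<in> N \<and> x \<in> F s n \<and> t s = \<langle>x, n\<rangle>) \<Longrightarrow> D (\<lambda>s. t s \<in> SG (F s))"
  by (simp add: SG_iff)

lemma small_UN_fam: "fam F \<Longrightarrow> small (\<Union>n\<in>N. F n)"
  by (rule small_UN) (auto simp: fam_def)

lemma small_SG:
  assumes "fam F"
  shows "small (SG F)"
proof (rule small_subset[OF small_times[OF small_UN_fam[OF assms] small_ext[of "omega mem"]]])
  show "SG F \<subseteq> (\<Union>n\<in>N. F n) \<otimes> N" by (auto simp: SG_def times_def simp del: ext_iff)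
  show "D (\<lambda>s. s 0 \<in> SG F)" by (intro Dr fam_D[OF assms])
qed

lemma UN_le_SG:
  assumes "fam F"
  shows "(\<Union>n\<in>N. F n) \<preceq> SG F"
proof (rule leI[where R = "\<lambda>p x. \<exists>n. p = \<langle>x, n\<rangle>"])
  show "D (\<lambda>s. \<exists>n. s 0 = \<langle>s 1, n\<rangle>)" by (intro Dr)
qed (use assms in \<open>auto simp: small_SG small_UN_fam SG_iff\<close>)

lemma disjoint_UN_eqv_SG:
  assumes "fam F" "\<And>n m x. n \<in> N \<Longrightarrow> m \<in> N \<Longrightarrow> x \<in> F n \<Longrightarrow> x \<in> F m \<Longrightarrow> n = m"
  shows "(\<Union>n\<in>N. F n) \<approx> SG F"
proof -
  have "SG F \<preceq> (\<Union>n\<in>N. F n)"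
  proof (rule leI[where R = "\<lambda>x p. \<exists>n. p = \<langle>x, n\<rangle>"])
    show "D (\<lambda>s. \<exists>n. s 1 = \<langle>s 0, n\<rangle>)" by (intro Dr)
    show "y = z" if "y \<in> SG F" "z \<in> SG F" "\<exists>n. y = \<langle>x, n\<rangle>" "\<exists>n. z = \<langle>x, n\<rangle>" for x y z
      using that assms(2) by auto
  qed (use assms(1) in \<open>auto simp: small_SG small_UN_fam SG_iff\<close>)
  then show ?thesis using UN_le_SG[OF assms(1)] by (simp add: eqv_def)
qed

lemma SG_cong_set: "(\<And>n. n \<in> N \<Longrightarrow> F n = G n) \<Longrightarrow> SG F = SG G"
  by (auto simp: SG_iff)

lemma SG_split:
  assumes "fam F"
  shows "SG F \<approx> F z0 \<oplus> SG (\<lambda>n. F (sc n))"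
proof -
  have f: "fam (\<lambda>n. F (sc n))" by (rule fam_comp[OF assms]) (intro Dr)
  let ?R = "\<lambda>p r. \<exists>x n. p = \<langle>x, n\<rangle> \<and> ((n = z0 \<and> r = \<langle>x, z0\<rangle>) \<or> (\<exists>m. n = sc m \<and> r = \<langle>\<langle>x, m\<rangle>, z1\<rangle>))"
  have D: "D (\<lambda>s. ?R (s 0) (s 1))" "D (\<lambda>s. ?R (s 1) (s 0))" by (intro Dr)+
  have s: "small (SG F)" "small (F z0 \<oplus> SG (\<lambda>n. F (sc n)))"
    using assms f by (simp_all add: small_SG fam_small)
  have "F z0 \<oplus> SG (\<lambda>n. F (sc n)) \<preceq> SG F"
    by (rule leI[OF s D(1)]) (auto simp: plus_iff SG_iff)
  moreover have "SG F \<preceq> F z0 \<oplus> SG (\<lambda>n. F (sc n))"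
  proof (rule leI[OF s(2,1) D(2)])
    fix y assume "y \<in> SG F"
    then obtain n x where n: "n \<in> N" "x \<in> F n" "y = \<langle>x, n\<rangle>" by (auto simp: SG_iff)
    from N_cases[OF n(1)] show "\<exists>p\<in>F z0 \<oplus> SG (\<lambda>n. F (sc n)). ?R y p"
    proof
      assume "n = z0"
      then show ?thesis using n by (intro bexI[of _ "\<langle>x, z0\<rangle>"]) auto
    next
      assume "\<exists>m\<in>N. n = sc m"
      then obtain m where "m \<in> N" "n = sc m" by blast
      then show ?thesis using n by (intro bexI[of _ "\<langle>\<langle>x, m\<rangle>, z1\<rangle>"]) auto
    qed
  qed auto
  ultimately show ?thesis by (simp add: eqv_def)
qed

lemma SG_plus:
  assumes "fam F" "fam G"
  shows "SG (\<lambda>n. F n \<oplus> G n) \<approx> SG F \<oplus> SG G"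
proof -
  let ?R = "\<lambda>p r. \<exists>x n i. p = \<langle>\<langle>x, i\<rangle>, n\<rangle> \<and> r = \<langle>\<langle>x, n\<rangle>, i\<rangle>"
  have D: "D (\<lambda>s. ?R (s 0) (s 1))" "D (\<lambda>s. ?R (s 1) (s 0))" by (intro Dr)+
  have s: "small (SG (\<lambda>n. F n \<oplus> G n))" "small (SG F \<oplus> SG G)"
    using assms by (simp_all add: small_SG fam_plus)
  have "SG F \<oplus> SG G \<preceq> SG (\<lambda>n. F n \<oplus> G n)"
    by (rule leI[OF s D(1)]) (auto simp: plus_iff SG_iff)
  moreover have "SG (\<lambda>n. F n \<oplus> G n) \<preceq> SG F \<oplus> SG G"
    by (rule leI[OF s(2,1) D(2)]) (auto simp: plus_iff SG_iff)
  ultimately show ?thesis by (simp add: eqv_def)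
qed

end

section \<open>Countable choice for sums and absorption\<close>

locale zf_ac = zf +
  assumes AC: "AC_omega mem"
begin

lemma choose_onto:
  assumes "fam F" "fam G" "\<And>n. n \<in> N \<Longrightarrow> F n \<preceq> G n"
  obtains h where "Dt (\<lambda>s. h (s 0))" "\<And>n. n \<in> N \<Longrightarrow> onto (\<lambda>x y. \<langle>x, y\<rangle> \<epsilon> h n) (G n) (F n)"
proof -
  have "D (\<lambda>s. onto (\<lambda>x y. \<langle>x, y\<rangle> \<epsilon> s 1) (G (s 0)) (F (s 0)))"
    unfolding onto_def by (intro Dr fam_D[OF assms(1)] fam_D[OF assms(2)])
  from choice[of "\<lambda>n h. onto (\<lambda>x y. \<langle>x, y\<rangle> \<epsilon> h) (G n) (F n)", OF AC this]
  show ?thesis using assms(3) that unfolding le_def by blast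
qed

lemma SG_mono:
  assumes "fam F" "fam G" "\<And>n. n \<in> N \<Longrightarrow> F n \<preceq> G n"
  shows "SG F \<preceq> SG G"
proof -
  from choose_onto[OF assms] obtain h where h: "Dt (\<lambda>s. h (s 0))"
    "\<And>n. n \<in> N \<Longrightarrow> onto (\<lambda>x y. \<langle>x, y\<rangle> \<epsilon> h n) (G n) (F n)" by blast
  let ?R = "\<lambda>p r. \<exists>x y n. n \<in> N \<and> p = \<langle>x, n\<rangle> \<and> r = \<langle>y, n\<rangle> \<and> \<langle>x, y\<rangle> \<epsilon> h n"
  show ?thesis
  proof (rule leI[where R = ?R])
    show "D (\<lambda>s. ?R (s 0) (s 1))" by (intro Dr Dt_app1[OF h(1)])
    show "y = z" if "?R x y" "?R x z" for x y z
      using that h(2) unfolding onto_def by auto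
    show "\<exists>x\<in>SG G. ?R x y" if y: "y \<in> SG F" for y
    proof -
      obtain n b where n: "n \<in> N" "b \<in> F n" "y = \<langle>b, n\<rangle>" using y by (auto simp: SG_iff)
      then obtain a where "\<langle>a, b\<rangle> \<epsilon> h n" "a \<in> G n" using h(2)[OF n(1)] unfolding onto_def by blast
      then show ?thesis using n by (intro bexI[of _ "\<langle>a, n\<rangle>"]) auto
    qed
  qed (use assms in \<open>simp_all add: small_SG\<close>)
qed

lemma SG_cong: "fam F \<Longrightarrow> fam G \<Longrightarrow> (\<And>n. n \<in> N \<Longrightarrow> F n \<approx> G n) \<Longrightarrow> SG F \<approx> SG G"
  unfolding eqv_def using SG_mono by blast

text \<open>If \<open>h\<^sub>n\<close> witnesses that \<open>A\<close> absorbs \<open>Y\<^sub>n\<close>, run the schedule \<open>H\<^sub>n\<^sub>+\<^sub>1 = H\<^sub>n h\<^sub>n H\<^sub>n\<close>.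
  The points that leave \<open>A\<close> during the second run of \<open>H\<^sub>n\<close> are mapped by \<open>h\<^sub>n H\<^sub>n\<close> onto the points
  that leave \<open>A\<close> during the first one, so the points that leave at all cover themselves and
  every \<open>Y\<^sub>n\<close>.\<close>

theorem absorbs_SG:
  assumes A: "small A" and Y: "fam Y" and ab: "\<And>n. n \<in> N \<Longrightarrow> absorbs A (Y n)"
  shows "absorbs A (SG Y)"
proof -
  have "fam (\<lambda>n. A \<oplus> Y n)" "fam (\<lambda>n. A)" by (intro fam_plus fam_const A Y)+
  from choose_onto[OF this] ab obtain h where h: "Dt (\<lambda>s. h (s 0))"
    "\<And>n. n \<in> N \<Longrightarrow> onto (\<lambda>x y. \<langle>x, y\<rangle> \<epsilon> h n) A (A \<oplus> Y n)" unfolding absorbs_def by blast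
  define hA where "hA n x a \<longleftrightarrow> \<langle>x, \<langle>a, z0\<rangle>\<rangle> \<epsilon> h n" for n x a
  define hY where "hY n x y \<longleftrightarrow> \<langle>x, \<langle>y, z1\<rangle>\<rangle> \<epsilon> h n" for n x y
  have hD1: "D (\<lambda>s. hA (t s) (u s) (v s))" if "Dt t" "Dt u" "Dt v" for t u v
    unfolding hA_def using that by (intro Dr Dt_app1[OF h(1)])
  have hD2: "D (\<lambda>s. hY (t s) (u s) (v s))" if "Dt t" "Dt u" "Dt v" for t u v
    unfolding hY_def using that by (intro Dr Dt_app1[OF h(1)])
  note hD = hD1 hD2
  have hA: "hA n x a \<Longrightarrow> x \<in> A \<and> a \<in> A" "hA n x a \<Longrightarrow> hA n x b \<Longrightarrow> a = b" "a \<in> A \<Longrightarrow> \<exists>x. hA n x a"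
    and hY: "hY n x y \<Longrightarrow> x \<in> A \<and> y \<in> Y n" "hY n x y \<Longrightarrow> hY n x z \<Longrightarrow> y = z" "y \<in> Y n \<Longrightarrow> \<exists>x. hY n x y"
    and hAY: "hA n x a \<Longrightarrow> \<not> hY n x y" if "n \<in> N" for n x a b y z
    using h(2)[OF that] unfolding onto_def hA_def hY_def
    by (metis plus_pr pr_inject succ_neq_zero(2))+
  \<comment> \<open>A single marker for having left \<open>A\<close>. It differs from every pair
    with second component \<open>z0\<close>, the code of a point still in \<open>A\<close>, and
    \<open>B\<close> contains both kinds.\<close>
  define e where "e = \<langle>z0, z1\<rangle>"
  have e: "e \<noteq> \<langle>a, z0\<rangle>" "\<langle>a, z0\<rangle> \<noteq> e" for a by (simp_all add: e_def)
  define B where "B = A \<oplus> {z0}"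
  have B: "small B" "e \<in> B" "\<langle>a, z0\<rangle> \<in> B \<longleftrightarrow> a \<in> A" for a
    using A by (simp_all add: B_def small_single e_def)
  \<comment> \<open>The composite that runs \<open>H\<close>, then \<open>h n\<close>, then
    \<open>H\<close> again; a point receives the marker as soon as one of the three sends it out of
    \<open>A\<close>.\<close>
  define step where "step n H p \<longleftrightarrow> (\<exists>x b. p = \<langle>x, b\<rangle> \<and> (b = e \<and> \<langle>x, e\<rangle> \<epsilon> H \<or>
      (\<exists>a. \<langle>x, \<langle>a, z0\<rangle>\<rangle> \<epsilon> H \<and> (b = e \<and> (\<exists>y. hY n a y) \<or> (\<exists>a'. hA n a a' \<and> \<langle>a', b\<rangle> \<epsilon> H)))))" for n H p
  have Dstep: "D (\<lambda>s. step (t s) (u s) (v s))" if "Dt t" "Dt u" "Dt v" for t u v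
    by (rule D_app3[OF _ that]) (unfold step_def, intro Dr hD)
  have "Dt (\<lambda>s. coll {p \<in> A \<otimes> B. step (s 0) (s 1) p})"
    by (intro Dr Dstep D_small[OF small_times[OF A B(1)]])
  from N_rec[of "\<lambda>n H. coll {p \<in> A \<otimes> B. step n H p}" "coll ((\<lambda>x. \<langle>x, \<langle>x, z0\<rangle>\<rangle>) ` A)", OF this]
  obtain F where F: "Dt (\<lambda>s. F (s 0))" "F z0 = coll ((\<lambda>x. \<langle>x, \<langle>x, z0\<rangle>\<rangle>) ` A)"
    "\<And>n. n \<in> N \<Longrightarrow> F (sc n) = coll {p \<in> A \<otimes> B. step n (F n) p}" by blast
  define G where "G n x a \<longleftrightarrow> \<langle>x, \<langle>a, z0\<rangle>\<rangle> \<epsilon> F n" for n x a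
  define L where "L n x \<longleftrightarrow> \<langle>x, e\<rangle> \<epsilon> F n" for n x
  have GD: "D (\<lambda>s. G (t s) (u s) (v s))" if "Dt t" "Dt u" "Dt v" for t u v
    unfolding G_def using that by (intro Dr Dt_app1[OF F(1)])
  have LD: "D (\<lambda>s. L (t s) (u s))" if "Dt t" "Dt u" for t u
    unfolding L_def using that by (intro Dr Dt_app1[OF F(1)])
  have F0: "p \<epsilon> F z0 \<longleftrightarrow> (\<exists>x\<in>A. p = \<langle>x, \<langle>x, z0\<rangle>\<rangle>)" for p
  proof -
    have "small ((\<lambda>x. \<langle>x, \<langle>x, z0\<rangle>\<rangle>) ` A)" by (rule small_image[OF A]) (intro Dr)
    then show ?thesis unfolding F(2) by (auto simp: mem_coll)
  qed
  have FS: "\<langle>x, b\<rangle> \<epsilon> F (sc n) \<longleftrightarrow> x \<in> A \<and> b \<in> B \<and> step n (F n) \<langle>x, b\<rangle>" if "n \<in> N" for n x b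
  proof -
    have "small {p \<in> A \<otimes> B. step n (F n) p}"
      by (rule small_sep[OF small_times[OF A B(1)]]) (intro Dr Dstep)
    then show ?thesis unfolding F(3)[OF that] by (auto simp: mem_coll times_iff)
  qed
  have G0: "G z0 x a \<longleftrightarrow> x \<in> A \<and> x = a" and L0: "\<not> L z0 x" for x a
    unfolding G_def L_def F0 using e by auto
  have GS: "G (sc n) x c \<longleftrightarrow> x \<in> A \<and> c \<in> A \<and> (\<exists>a a'. G n x a \<and> hA n a a' \<and> G n a' c)"
    and LS: "L (sc n) x \<longleftrightarrow> x \<in> A \<and> (L n x \<or> (\<exists>a. G n x a \<and> ((\<exists>y. hY n a y) \<or> (\<exists>a'. hA n a a' \<and> L n a'))))"
    if "n \<in> N" for n x c
    unfolding G_def L_def FS[OF that] step_def using e B by auto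
  \<comment> \<open>The last conjunct is what the construction lives on: the points that stay in
    \<open>A\<close> throughout schedule \<open>n\<close> are still mapped onto all of
    \<open>A\<close>.\<close>
  have inv: "(\<forall>x a b. G n x a \<longrightarrow> G n x b \<longrightarrow> a = b) \<and> (\<forall>x a. G n x a \<longrightarrow> x \<in> A \<and> a \<in> A \<and> \<not> L n x) \<and>
      (\<forall>a\<in>A. \<exists>x. G n x a)" if "n \<in> N" for n
  proof (rule N_induct[OF that])
    show "D (\<lambda>s. (\<forall>x a b. G (s 0) x a \<longrightarrow> G (s 0) x b \<longrightarrow> a = b) \<and>
        (\<forall>x a. G (s 0) x a \<longrightarrow> x \<in> A \<and> a \<in> A \<and> \<not> L (s 0) x) \<and> (\<forall>a\<in>A. \<exists>x. G (s 0) x a))"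
      by (intro Dr GD LD D_small[OF A])
    fix n assume n: "n \<in> N" and IH: "(\<forall>x a b. G n x a \<longrightarrow> G n x b \<longrightarrow> a = b) \<and>
      (\<forall>x a. G n x a \<longrightarrow> x \<in> A \<and> a \<in> A \<and> \<not> L n x) \<and> (\<forall>a\<in>A. \<exists>x. G n x a)"
    note hh = hA[OF n] hY[OF n] hAY[OF n]
    show "(\<forall>x a b. G (sc n) x a \<longrightarrow> G (sc n) x b \<longrightarrow> a = b) \<and>
      (\<forall>x a. G (sc n) x a \<longrightarrow> x \<in> A \<and> a \<in> A \<and> \<not> L (sc n) x) \<and> (\<forall>a\<in>A. \<exists>x. G (sc n) x a)"
    proof (intro conjI allI impI ballI)
      show "a = b" if "G (sc n) x a" "G (sc n) x b" for x a b
        using that IH hh(2) unfolding GS[OF n] by metis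
      show "x \<in> A" "a \<in> A" if "G (sc n) x a" for x a using that unfolding GS[OF n] by blast+
      show "\<not> L (sc n) x" if "G (sc n) x a" for x a
        using that IH hh(2) hAY[OF n] unfolding GS[OF n] LS[OF n] by metis
      show "\<exists>x. G (sc n) x a" if "a \<in> A" for a
        using that IH hh(1,3) unfolding GS[OF n] by metis
    qed
  qed (auto simp: G0 L0)
  \<comment> \<open>Leaving is permanent, so the stage at which a point first leaves is unique; this
    makes the relation \<open>?T\<close> below functional.\<close>
  have Lmono: "L m x" if "m \<in> N" "n \<epsilon> m" "L (sc n) x" for m n x
  proof -
    have "\<forall>n. n \<epsilon> m \<longrightarrow> L (sc n) x \<longrightarrow> L m x"
    proof (rule N_induct[OF that(1)])
      show "D (\<lambda>s. \<forall>n. n \<epsilon> s 0 \<longrightarrow> L (sc n) x \<longrightarrow> L (s 0) x)" by (intro Dr LD)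
      fix m assume m: "m \<in> N" "\<forall>n. n \<epsilon> m \<longrightarrow> L (sc n) x \<longrightarrow> L m x"
      have "L m x \<Longrightarrow> L (sc m) x"
        using LS[OF m(1)] F(3) m(1) inv FS
        by (metis L0 L_def N_cases)
      then show "\<forall>n. n \<epsilon> sc m \<longrightarrow> L (sc n) x \<longrightarrow> L (sc m) x" using m(2) by auto
    qed simp
    then show ?thesis using that by blast
  qed
  \<comment> \<open>A point that never leaves represents itself. One that first leaves at stage
    \<open>sc n\<close> is evaluated after schedule \<open>n\<close> and one application of
    \<open>h n\<close>: the result is either an element of \<open>Y n\<close> or a point of
    \<open>A\<close> that leaves during the second run.\<close>
  let ?T = "\<lambda>x b. (x \<in> A \<and> (\<forall>n\<in>N. \<not> L n x) \<and> b = \<langle>x, z0\<rangle>) \<or>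
    (\<exists>n\<in>N. L (sc n) x \<and> \<not> L n x \<and> (\<exists>a. G n x a \<and> ((\<exists>y. hY n a y \<and> b = \<langle>\<langle>y, n\<rangle>, z1\<rangle>) \<or>
      (\<exists>a'. hA n a a' \<and> b = \<langle>a', z0\<rangle>))))"
  show ?thesis
    unfolding absorbs_def
  proof (rule leI[where R = ?T])
    show "D (\<lambda>s. ?T (s 0) (s 1))" by (intro Dr GD LD hD D_small[OF A])
    show "small (A \<oplus> SG Y)" using A Y by (simp add: small_SG)
    show "y = z" if T: "?T x y" "?T x z" for x y z
    proof (cases "\<forall>n\<in>N. \<not> L n x")
      case True
      then show ?thesis using T succ_N by auto
    next
      case False
      then obtain n m where n: "n \<in> N" "L (sc n) x" "\<not> L n x" and m: "m \<in> N" "L (sc m) x" "\<not> L m x"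
        and ny: "\<exists>a. G n x a \<and> ((\<exists>w. hY n a w \<and> y = \<langle>\<langle>w, n\<rangle>, z1\<rangle>) \<or> (\<exists>a'. hA n a a' \<and> y = \<langle>a', z0\<rangle>))"
        and mz: "\<exists>a. G m x a \<and> ((\<exists>w. hY m a w \<and> z = \<langle>\<langle>w, m\<rangle>, z1\<rangle>) \<or> (\<exists>a'. hA m a a' \<and> z = \<langle>a', z0\<rangle>))"
        using T by blast
      have "n = m" using N_linear[OF n(1) m(1)] Lmono n m by blast
      then show ?thesis using ny mz inv[OF n(1)] hA(2)[OF n(1)] hY(2)[OF n(1)] hAY[OF n(1)] by metis
    qed
    show "\<exists>x\<in>A. ?T x b" if b: "b \<in> A \<oplus> SG Y" for b
      using b
    proof (cases rule: plusE)
      case (1 c)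
      show ?thesis
      proof (cases "\<forall>n\<in>N. \<not> L n c")
        case True
        then show ?thesis using 1 by blast
      next
        case False
        then obtain n where n: "n \<in> N" "L n c" by blast
        \<comment> \<open>Since \<open>c\<close> leaves by stage \<open>n\<close>, a point that
          schedule \<open>n\<close> followed by \<open>h n\<close> takes to \<open>c\<close>
          survives stage \<open>n\<close> and leaves at the next one.\<close>
        obtain a where a: "hA n a c" "a \<in> A" using hA[OF n(1)] 1(1) by blast
        obtain x where x: "G n x a" using inv[OF n(1)] a(2) by blast
        then have "x \<in> A" "\<not> L n x" using inv[OF n(1)] by blast+
        moreover have "L (sc n) x" using LS[OF n(1)] x a n calculation by blast
        ultimately show ?thesis using n x a 1 by blast
      qed
    next
      case (2 p)
      then obtain n y where n: "n \<in> N" "y \<in> Y n" "p = \<langle>y, n\<rangle>" by (auto simp: SG_iff)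
      obtain a where a: "hY n a y" "a \<in> A" using hY[OF n(1)] n(2) by blast
      obtain x where x: "G n x a" using inv[OF n(1)] a(2) by blast
      then have "x \<in> A" "\<not> L n x" using inv[OF n(1)] by blast+
      moreover have "L (sc n) x" using LS[OF n(1)] x a n calculation by blast
      ultimately show ?thesis using n x a 2 by blast
    qed
  qed (rule A)
qed

lemma absorbs_UN: "small A \<Longrightarrow> fam Y \<Longrightarrow> (\<And>n. n \<in> N \<Longrightarrow> absorbs A (Y n)) \<Longrightarrow> absorbs A (\<Union>n\<in>N. Y n)"
  by (rule absorbs_mono[OF _ small_SG small_UN_fam absorbs_SG UN_le_SG])

end

context zf
begin

section \<open>Orbits of partial functions\<close>

definition D2 :: "('a \<Rightarrow> 'a \<Rightarrow> bool) \<Rightarrow> bool" where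
  "D2 R \<longleftrightarrow> D (\<lambda>s. R (s 0) (s 1))"

lemma D2D: "D2 R \<Longrightarrow> Dt t \<Longrightarrow> Dt u \<Longrightarrow> D (\<lambda>s. R (t s) (u s))"
  unfolding D2_def by (rule D_app2)

text \<open>Paths have a length in the natural numbers of the structure, so this is not the transitive
  closure of HOL: the sets \<open>S\<close> range over elements of the structure.\<close>

definition reach :: "('a \<Rightarrow> 'a \<Rightarrow> bool) \<Rightarrow> 'a \<Rightarrow> 'a \<Rightarrow> bool" where
  "reach R x y \<longleftrightarrow> (\<forall>S. x \<epsilon> S \<and> (\<forall>u v. u \<epsilon> S \<longrightarrow> R u v \<longrightarrow> v \<epsilon> S) \<longrightarrow> y \<epsilon> S)"

lemma D_reach: "D2 R \<Longrightarrow> Dt t \<Longrightarrow> Dt u \<Longrightarrow> D (\<lambda>s. reach R (t s) (u s))"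
  by (rule D_app2) (unfold reach_def, intro Dr D2D)

lemma reach_refl: "reach R x x"
  by (simp add: reach_def)

lemma reach_step: "R x y \<Longrightarrow> reach R y z \<Longrightarrow> reach R x z"
  unfolding reach_def by blast

lemma reach_snoc: "reach R x y \<Longrightarrow> R y z \<Longrightarrow> reach R x z"
  unfolding reach_def by blast

lemma reach_trans: "reach R x y \<Longrightarrow> reach R y z \<Longrightarrow> reach R x z"
  unfolding reach_def by blast

lemma reach_mono: "(\<And>x y. R x y \<Longrightarrow> R' x y) \<Longrightarrow> reach R x y \<Longrightarrow> reach R' x y"
  unfolding reach_def by blast

text \<open>The bound \<open>C\<close> makes induction along paths an instance of Separation: the
  solutions of a definable predicate among \<open>C\<close> and the starting point form a set over
  which \<open>reach\<close> quantifies.\<close>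

definition bounded_rel :: "('a \<Rightarrow> 'a \<Rightarrow> bool) \<Rightarrow> bool" where
  "bounded_rel R \<longleftrightarrow> D2 R \<and> (\<exists>C. small C \<and> (\<forall>x y. R x y \<longrightarrow> y \<in> C))"

lemma reach_induct:
  assumes "reach R x y" "bounded_rel R" "D (\<lambda>s. P (s 0))" "P x" "\<And>u v. P u \<Longrightarrow> R u v \<Longrightarrow> P v"
  shows "P y"
proof -
  obtain C where C: "small C" "\<And>x y. R x y \<Longrightarrow> y \<in> C" using assms(2) unfolding bounded_rel_def by blast
  have s: "small {z \<in> insert x C. P z}" by (rule small_sep[OF small_insert[OF C(1)] assms(3)])
  have "y \<epsilon> coll {z \<in> insert x C. P z}"
    using assms(1)[unfolded reach_def, rule_format, of "coll {z \<in> insert x C. P z}"]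
    unfolding mem_coll[OF s] using assms(4,5) C(2) by blast
  then show ?thesis unfolding mem_coll[OF s] by simp
qed

lemma reach_converse_induct:
  assumes "reach R x y" "bounded_rel R" "D (\<lambda>s. P (s 0))" "P y" "\<And>u v. P v \<Longrightarrow> R u v \<Longrightarrow> P u"
  shows "P x"
proof -
  have "P y \<longrightarrow> P x"
    by (rule reach_induct[of R x y "\<lambda>w. P w \<longrightarrow> P x", OF assms(1,2)])
      (use assms in \<open>auto intro!: Dr\<close>)
  then show ?thesis using assms(4) by blast
qed

lemma reach_cases:
  assumes "reach R x y" "bounded_rel R"
  shows "x = y \<or> (\<exists>z. R x z \<and> reach R z y)"
proof (rule reach_induct[of R x y "\<lambda>w. x = w \<or> (\<exists>z. R x z \<and> reach R z w)", OF assms])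
  have "D2 R" using assms(2) by (simp add: bounded_rel_def)
  then show "D (\<lambda>s. x = s 0 \<or> (\<exists>z. R x z \<and> reach R z (s 0)))" by (intro Dr D2D D_reach)
qed (auto intro: reach_refl reach_snoc)

lemma reach_plus:
  assumes "reach R x u" "R u w" "bounded_rel R"
  shows "\<exists>p. R x p \<and> reach R p w"
proof -
  have "x = u \<or> (\<exists>z. R x z \<and> reach R z u)" by (rule reach_cases[OF assms(1,3)])
  then show ?thesis
  proof
    assume "x = u"
    then show ?thesis using assms(2) reach_refl[of R w] by blast
  next
    assume "\<exists>z. R x z \<and> reach R z u"
    then show ?thesis using reach_snoc[of R _ u w] assms(2) by blast
  qed
qed

definition functional :: "('a \<Rightarrow> 'a \<Rightarrow> bool) \<Rightarrow> bool" where
  "functional R \<longleftrightarrow> (\<forall>x y z. R x y \<longrightarrow> R x z \<longrightarrow> y = z)"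

lemma functionalD: "functional R \<Longrightarrow> R x y \<Longrightarrow> R x z \<Longrightarrow> y = z"
  unfolding functional_def by blast

text \<open>Paths of a functional relation do not branch, so every point reachable from
  \<open>p\<close> still reaches \<open>w\<close>; the terminal point \<open>w'\<close> can do so
  only by being \<open>w\<close>.\<close>

lemma reach_terminal_unique:
  assumes f: "functional R" and b: "bounded_rel R"
    and w: "reach R p w" "\<And>v. \<not> R w v" and w': "reach R p w'" "\<And>v. \<not> R w' v"
  shows "w = w'"
proof -
  have "D2 R" using b by (simp add: bounded_rel_def)
  have "reach R w' w"
  proof (rule reach_induct[of R p w' "\<lambda>z. reach R z w", OF w'(1) b])
    show "D (\<lambda>s. reach R (s 0) w)" by (intro Dr D_reach \<open>D2 R\<close>)
    fix u v assume "reach R u w" "R u v"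
    then show "reach R v w" using reach_cases[OF _ b, of u w] w(2) functionalD[OF f] by blast
  qed (rule w(1))
  then show ?thesis using reach_cases[OF _ b, of w' w] w'(2) by blast
qed

text \<open>Points of \<open>X\<close> become terminal, so a path of this relation that ends in
  \<open>X\<close> meets \<open>X\<close> there for the first time.\<close>

definition off :: "('a \<Rightarrow> 'a \<Rightarrow> bool) \<Rightarrow> 'a set \<Rightarrow> 'a \<Rightarrow> 'a \<Rightarrow> bool" where
  "off R X x y \<longleftrightarrow> x \<notin> X \<and> R x y"

definition first_return :: "('a \<Rightarrow> 'a \<Rightarrow> bool) \<Rightarrow> 'a set \<Rightarrow> 'a \<Rightarrow> 'a \<Rightarrow> bool" where
  "first_return R X u w \<longleftrightarrow> w \<in> X \<and> (\<exists>p. R u p \<and> reach (off R X) p w)"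

lemma bounded_rel_off: "bounded_rel R \<Longrightarrow> small X \<Longrightarrow> bounded_rel (off R X)"
  unfolding bounded_rel_def off_def D2_def by (auto intro!: Dr D_small D_app2[of R])

lemma D2_first_return: "bounded_rel R \<Longrightarrow> small X \<Longrightarrow> D2 (first_return R X)"
  using bounded_rel_off[of R X] unfolding D2_def[of "first_return R X"] first_return_def bounded_rel_def
  by (auto intro!: Dr D_small D2D D_reach)

lemma first_unique:
  assumes "functional R" "bounded_rel R" "small X"
    "reach (off R X) p w" "w \<in> X" "reach (off R X) p w'" "w' \<in> X"
  shows "w = w'"
  by (rule reach_terminal_unique[of "off R X", OF _ bounded_rel_off[OF assms(2,3)] assms(4) _ assms(6)])
    (use assms in \<open>auto simp: off_def functional_def\<close>)

lemma first_return_unique: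
  assumes "functional R" "bounded_rel R" "small X" "first_return R X u w" "first_return R X u w'"
  shows "w = w'"
proof -
  obtain p p' where p: "w \<in> X" "R u p" "reach (off R X) p w" "w' \<in> X" "R u p'" "reach (off R X) p' w'"
    using assms(4,5) unfolding first_return_def by auto
  then have "p' = p" using functionalD[OF assms(1)] by blast
  with p show ?thesis using first_unique[of R X p w w', OF assms(1-3)] by blast
qed

lemma first_return_reach: "first_return R X u w \<Longrightarrow> reach R u w"
  unfolding first_return_def using reach_mono[of "off R X" R] by (auto simp: off_def intro: reach_step)

text \<open>The point sought is the last visit to \<open>X\<close> before the arrival at
  \<open>w\<close>; it is found by induction backwards along the path.\<close>

lemma first_return_exists:
  assumes "bounded_rel R" "small X" "z \<in> X" "w \<in> X" "R z p" "reach R p w"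
  shows "\<exists>x\<in>X. first_return R X x w \<and> reach R z x"
proof -
  have d: "D2 R" "D2 (off R X)" using assms(1) bounded_rel_off[OF assms(1,2)] by (simp_all add: bounded_rel_def)
  have "reach (off R X) p w \<or> (\<exists>x\<in>X. reach R p x \<and> first_return R X x w)"
  proof (rule reach_converse_induct[of R p w
        "\<lambda>u. reach (off R X) u w \<or> (\<exists>x\<in>X. reach R u x \<and> first_return R X x w)", OF assms(6,1)])
    show "D (\<lambda>s. reach (off R X) (s 0) w \<or> (\<exists>x\<in>X. reach R (s 0) x \<and> first_return R X x w))"
      by (intro Dr D_reach d D_small[OF assms(2)] D2D[OF D2_first_return[OF assms(1,2)]])
    fix u v assume "reach (off R X) v w \<or> (\<exists>x\<in>X. reach R v x \<and> first_return R X x w)" "R u v"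
    then show "reach (off R X) u w \<or> (\<exists>x\<in>X. reach R u x \<and> first_return R X x w)"
      using assms(4) reach_step[of R u v] reach_step[of "off R X" u v w] reach_refl[of R u]
      unfolding off_def first_return_def by blast
  qed (simp add: reach_refl)
  then show ?thesis
  proof
    assume "reach (off R X) p w"
    then have "first_return R X z w" using assms unfolding first_return_def by blast
    then show ?thesis using assms(3) reach_refl by blast
  next
    assume "\<exists>x\<in>X. reach R p x \<and> first_return R X x w"
    then show ?thesis using assms(5) reach_step by blast
  qed
qed

lemma absorbs_disjoint:
  assumes "small U" "small Y" "U \<inter> Y = {}" "U \<union> Y \<preceq> U"
  shows "absorbs U Y"
  unfolding absorbs_def
  by (rule le_trans[of U _ "U \<union> Y"])
    (use assms Un_eqv_plus[of U Y] in \<open>simp_all add: eqv_def\<close>)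

section \<open>Splitting an absorbed set\<close>

text \<open>Every point has predecessors without end. A point of \<open>Z\<close> is charged to
  \<open>P2\<close> if some ancestor has its whole backward tree inside \<open>P2\<close>, since
  that tree absorbs it. Otherwise each of its predecessors lies in \<open>P1\<close> or has an
  ancestor there, and skipping the excursions into \<open>P2\<close> leaves a map that lives on
  \<open>P1\<close>.\<close>

lemma absorbs_split_disjoint:
  assumes s: "small P1" "small P2" "small Z"
    and dj: "P1 \<inter> P2 = {}" "P1 \<inter> Z = {}" "P2 \<inter> Z = {}"
    and le: "P1 \<union> P2 \<union> Z \<preceq> P1 \<union> P2"
  obtains Z1 Z2 where "small Z1" "small Z2" "Z1 \<union> Z2 = Z" "Z1 \<inter> Z2 = {}" "absorbs P1 Z1" "absorbs P2 Z2"
proof -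
  let ?P = "P1 \<union> P2"
  from le obtain R where RD: "\<And>t u. Dt t \<Longrightarrow> Dt u \<Longrightarrow> D (\<lambda>s. R (t s) (u s))"
    and R: "\<And>x y. R x y \<Longrightarrow> x \<in> ?P" "\<And>x y. R x y \<Longrightarrow> y \<in> ?P \<union> Z"
    and Rf: "\<And>x y z. R x y \<Longrightarrow> R x z \<Longrightarrow> y = z" and Ro: "\<And>y. y \<in> ?P \<union> Z \<Longrightarrow> \<exists>x. R x y"
    by (elim leE) blast
  have D2: "D2 R" unfolding D2_def by (intro RD Dr)
  have functional: "functional R" unfolding functional_def using Rf by blast
  have "small (?P \<union> Z)" by (intro small_Un s)
  then have b: "bounded_rel R" unfolding bounded_rel_def using D2 R(2) by blast
  note DR = D_reach[OF D2]
  define Z2 where "Z2 = {z \<in> Z. \<exists>u\<in>P2. reach R u z \<and> (\<forall>w. reach R w u \<longrightarrow> w \<in> P2)}"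
  define Z1 where "Z1 = Z - Z2"
  have sZ2: "small Z2" unfolding Z2_def
    by (rule small_sep[OF s(3)]) (intro Dr DR D_small[OF s(2)])
  have sZ1: "small Z1" unfolding Z1_def
    by (rule small_subset[OF s(3)]) (auto intro!: Dr D_small[OF s(3)] D_small[OF sZ2])
  define Q where "Q = {u \<in> P2. (\<exists>z\<in>Z2. reach R u z) \<and> (\<forall>w. reach R w u \<longrightarrow> w \<in> P2)}"
  have sQ: "small Q" unfolding Q_def
    by (rule small_sep[OF s(2)]) (intro Dr DR D_small[OF s(2)] D_small[OF sZ2])
  define K where "K = {u \<in> P1. \<exists>z\<in>Z1. reach R u z}"
  have sK: "small K" unfolding K_def
    by (rule small_sep[OF s(1)]) (intro Dr DR D_small[OF sZ1])
  have zu: "z = z'" if "reach R u z" "reach R u z'" "z \<in> Z" "z' \<in> Z" for u z z'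
    by (rule reach_terminal_unique[of R, OF functional b that(1) _ that(2)]) (use R(1) that dj in blast)+
  \<comment> \<open>The map follows \<open>R\<close> as long as the image stays in \<open>Q\<close>;
    where the path would leave \<open>Q\<close>, it jumps to the point of \<open>Z2\<close> at which
    the path ends.\<close>
  have Q2: "Q \<union> Z2 \<preceq> Q"
  proof (rule leI[where R = "\<lambda>u v. (v \<in> Q \<and> R u v) \<or> (v \<in> Z2 \<and> reach R u v \<and> \<not> (\<exists>p\<in>Q. R u p))"])
    show "D (\<lambda>s. (s 1 \<in> Q \<and> R (s 0) (s 1)) \<or> (s 1 \<in> Z2 \<and> reach R (s 0) (s 1) \<and> \<not> (\<exists>p\<in>Q. R (s 0) p)))"
      by (intro Dr DR RD D_small[OF sQ] D_small[OF sZ2])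
    show "y = z" if "(y \<in> Q \<and> R x y) \<or> (y \<in> Z2 \<and> reach R x y \<and> \<not> (\<exists>p\<in>Q. R x p))"
      "(z \<in> Q \<and> R x z) \<or> (z \<in> Z2 \<and> reach R x z \<and> \<not> (\<exists>p\<in>Q. R x p))" for x y z
      using that Rf zu unfolding Z2_def by blast
    fix v assume "v \<in> Q \<union> Z2"
    then show "\<exists>u\<in>Q. (v \<in> Q \<and> R u v) \<or> (v \<in> Z2 \<and> reach R u v \<and> \<not> (\<exists>p\<in>Q. R u p))"
    proof
      assume v: "v \<in> Q"
      then obtain u where u: "R u v" using Ro unfolding Q_def by blast
      have "w \<in> P2" if "reach R w u" for w
        using v reach_snoc[of R w u v] that u unfolding Q_def by blast
      moreover have "\<exists>z\<in>Z2. reach R u z" using v reach_step[of R u v] u unfolding Q_def by blast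
      ultimately have "u \<in> Q" unfolding Q_def using reach_refl by blast
      then show ?thesis using u v by blast
    next
      assume v: "v \<in> Z2"
      then obtain u0 where u0: "u0 \<in> P2" "reach R u0 v" "\<forall>w. reach R w u0 \<longrightarrow> w \<in> P2"
        unfolding Z2_def by blast
      then have Q0: "u0 \<in> Q" using v unfolding Q_def by blast
      show ?thesis
      proof (rule ccontr)
        \<comment> \<open>If no point of \<open>Q\<close> jumped to \<open>v\<close>, the whole path
          from \<open>u0\<close> would stay in \<open>Q\<close>, including its end \<open>v\<close>,
          which lies in \<open>Z\<close>.\<close>
        assume c: "\<not> ?thesis"
        have "v \<in> Q \<and> reach R u0 v"
        proof (rule reach_induct[of R u0 v "\<lambda>u. u \<in> Q \<and> reach R u0 u", OF u0(2) b])
          show "D (\<lambda>s. s 0 \<in> Q \<and> reach R u0 (s 0))" by (intro Dr DR D_small[OF sQ])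
          fix x y assume x: "x \<in> Q \<and> reach R u0 x" and y: "R x y"
          obtain z where z: "z \<in> Z2" "reach R x z" using x unfolding Q_def by blast
          then have "z = v" using zu[of u0 z v] u0(2) v x reach_trans unfolding Z2_def by blast
          then have "\<exists>p\<in>Q. R x p" using c x v z by blast
          then have "y \<in> Q" using Rf y by blast
          then show "y \<in> Q \<and> reach R u0 y" using x y reach_snoc by blast
        qed (use Q0 reach_refl in blast)
        then show False using v dj unfolding Q_def Z2_def by blast
      qed
    qed
  qed (use sQ sZ2 small_Un in auto)
  have a2: "absorbs P2 Z2"
  proof (rule absorbs_superset[of _ Q])
    show "absorbs Q Z2" by (rule absorbs_disjoint) (use sQ sZ2 Q2 dj in \<open>auto simp: Q_def Z2_def\<close>)
    show "small (P2 - Q)"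
      by (rule small_subset[OF s(2)]) (auto intro!: Dr D_small[OF s(2)] D_small[OF sQ])
  qed (use s sQ sZ2 in \<open>auto simp: Q_def\<close>)
  \<comment> \<open>With \<open>Z\<close> included, a return from \<open>P1\<close> is either a
    point of \<open>P1\<close> or a terminal point of \<open>Z\<close>, and detours through
    \<open>P2\<close> are skipped.\<close>
  let ?X = "P1 \<union> Z"
  have sX: "small ?X" using s small_Un by blast
  have K1: "K \<union> Z1 \<preceq> K"
  proof (rule leI[where R = "first_return R ?X"])
    show "D (\<lambda>s. first_return R ?X (s 0) (s 1))" using D2_first_return[OF b sX] unfolding D2_def .
    show "y = z" if "first_return R ?X x y" "first_return R ?X x z" for x y z
      by (rule first_return_unique[OF functional b sX that])
    fix w assume w: "w \<in> K \<union> Z1"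
    then obtain z where z: "z \<in> Z1" "reach R w z" using reach_refl unfolding K_def by blast
    obtain u where u: "R u w" using Ro[of w] w unfolding K_def Z1_def by blast
    have "reach R u z" by (rule reach_step[of R u w z, OF u z(2)])
    \<comment> \<open>As \<open>z\<close> is not in \<open>Z2\<close> and \<open>u\<close> reaches
      it, the backward tree of \<open>u\<close> cannot lie inside \<open>P2\<close>.\<close>
    have "\<exists>x\<in>P1. reach R x u"
    proof (cases "u \<in> P1")
      case True
      then show ?thesis using reach_refl by blast
    next
      case False
      then have "u \<in> P2" using R(1)[OF u] by blast
      then obtain x where x: "reach R x u" "x \<notin> P2"
        using z(1) \<open>reach R u z\<close> unfolding Z1_def Z2_def by blast
      then have "x \<in> ?P" using reach_cases[OF x(1) b] R(1) u by blast
      then show ?thesis using x by blast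
    qed
    then obtain x where x: "x \<in> P1" "reach R x u" by blast
    obtain p where p: "R x p" "reach R p w" using reach_plus[of R x u w, OF x(2) u b] by blast
    have "x \<in> ?X" "w \<in> ?X" using x w unfolding K_def Z1_def by blast+
    from first_return_exists[of R ?X x w p, OF b sX this p] obtain x' where x': "x' \<in> ?X" "first_return R ?X x' w" by blast
    then have "x' \<in> ?P" using R(1) unfolding first_return_def by blast
    then have "x' \<in> P1" using x'(1) dj by blast
    moreover have "reach R x' z" using first_return_reach[OF x'(2)] z(2) reach_trans by blast
    ultimately have "x' \<in> K" using z(1) unfolding K_def by blast
    then show "\<exists>x\<in>K. first_return R ?X x w" using x'(2) by blast
  qed (use sK sZ1 small_Un in auto)
  have a1: "absorbs P1 Z1"
  proof (rule absorbs_superset[of _ K])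
    show "absorbs K Z1" by (rule absorbs_disjoint) (use sK sZ1 K1 dj in \<open>auto simp: K_def Z1_def\<close>)
    show "small (P1 - K)"
      by (rule small_subset[OF s(1)]) (auto intro!: Dr D_small[OF s(1)] D_small[OF sK])
  qed (use s sK sZ1 in \<open>auto simp: K_def\<close>)
  show ?thesis
    by (rule that[OF sZ1 sZ2 _ _ a1 a2]) (auto simp: Z1_def Z2_def)
qed

lemma absorbs_split:
  assumes s: "small A1" "small A2" "small Y" and ab: "absorbs (A1 \<oplus> A2) Y"
  obtains Y1 Y2 where "small Y1" "small Y2" "Y1 \<union> Y2 = Y" "Y1 \<inter> Y2 = {}" "absorbs A1 Y1" "absorbs A2 Y2"
proof -
  define c where "c i x = \<langle>x, i\<rangle>" for i x
  have cD: "Dt (\<lambda>s. c i (s 0))" for i unfolding c_def by (intro Dr)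
  have ci: "inj_on (c i) A" for i A by (auto simp: inj_on_def c_def)
  \<comment> \<open>A third tag besides those of the two summands, for a disjoint copy of
    \<open>Y\<close>.\<close>
  define i2 where "i2 = sc z1"
  have i2: "i2 \<noteq> z0" "i2 \<noteq> z1" "z0 \<noteq> i2" "z1 \<noteq> i2" by (simp_all add: i2_def)
  let ?P1 = "c z0 ` A1" and ?P2 = "c z1 ` A2" and ?Z = "c i2 ` Y"
  have sP: "small ?P1" "small ?P2" "small ?Z" by (intro small_image s cD)+
  have dj: "?P1 \<inter> ?P2 = {}" "?P1 \<inter> ?Z = {}" "?P2 \<inter> ?Z = {}" using i2 by (auto simp: c_def)
  have qc: "q (c i ` A) = q A" if "small A" for i A
    using inj_image_eqv[OF that cD ci] q_eq small_image[OF that cD] that by blast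
  have "?P1 \<union> ?P2 \<union> ?Z \<preceq> ?P1 \<union> ?P2"
  proof (rule le_cong[of "(A1 \<oplus> A2) \<oplus> Y" "A1 \<oplus> A2"])
    show "q (A1 \<oplus> A2) = q (?P1 \<union> ?P2)" using s sP dj by (simp add: q_plus q_Un qc)
    then show "q ((A1 \<oplus> A2) \<oplus> Y) = q (?P1 \<union> ?P2 \<union> ?Z)"
      using s sP dj by (simp add: q_plus q_Un qc small_Un Int_Un_distrib2)
    show "(A1 \<oplus> A2) \<oplus> Y \<preceq> A1 \<oplus> A2" using ab unfolding absorbs_def .
  qed (use s sP small_Un in auto)
  from absorbs_split_disjoint[OF sP dj this] obtain Z1 Z2 where Z: "small Z1" "small Z2"
    "Z1 \<union> Z2 = ?Z" "Z1 \<inter> Z2 = {}" "absorbs ?P1 Z1" "absorbs ?P2 Z2" by blast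
  define Y1 where "Y1 = {y \<in> Y. c i2 y \<in> Z1}"
  define Y2 where "Y2 = {y \<in> Y. c i2 y \<in> Z2}"
  have sY: "small Y1" "small Y2" unfolding Y1_def Y2_def
    by (rule small_sep[OF s(3)], intro D_small[OF Z(1)] D_small[OF Z(2)] cD)+
  have ZY: "Z1 = c i2 ` Y1" "Z2 = c i2 ` Y2" using Z(3) unfolding Y1_def Y2_def by fast+
  have "absorbs A1 Y1" "absorbs A2 Y2"
    using Z(5,6) s sP Z sY by (simp_all add: absorbs_iff qc) (simp_all add: ZY qc)
  moreover have "Y1 \<union> Y2 = Y" using Z(3) unfolding Y1_def Y2_def by blast
  moreover have "Y1 \<inter> Y2 = {}" using Z(4) unfolding Y1_def Y2_def by blast
  ultimately show ?thesis using that sY by blast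
qed

section \<open>Classes preserved by a pair of surjections\<close>

text \<open>Throughout, \<open>f\<close> maps \<open>A\<close> onto \<open>B\<close> and \<open>g\<close> maps \<open>B\<close> onto \<open>A\<close>. The sets \<open>X \<subseteq> A\<close> and
  \<open>T \<subseteq> B\<close> correspond under \<open>f\<close>; they agree up to subsets that \<open>A\<close> absorbs.\<close>

definition cmp :: "('a \<Rightarrow> 'a \<Rightarrow> bool) \<Rightarrow> ('a \<Rightarrow> 'a \<Rightarrow> bool) \<Rightarrow> 'a \<Rightarrow> 'a \<Rightarrow> bool" where
  "cmp f g x z \<longleftrightarrow> (\<exists>y. f x y \<and> g y z)"

definition minimal :: "('a \<Rightarrow> 'a \<Rightarrow> bool) \<Rightarrow> 'a set \<Rightarrow> 'a set" where
  "minimal R X = {x \<in> X. \<not> (\<exists>u\<in>X. \<exists>p. R u p \<and> reach R p x)}"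

definition surj_pair :: "('a \<Rightarrow> 'a \<Rightarrow> bool) \<Rightarrow> ('a \<Rightarrow> 'a \<Rightarrow> bool) \<Rightarrow> 'a set \<Rightarrow> 'a set \<Rightarrow> bool" where
  "surj_pair f g A B \<longleftrightarrow> small A \<and> small B \<and> D2 f \<and> D2 g \<and> onto f A B \<and> onto g B A"

lemma surj_pairD:
  assumes "surj_pair f g A B"
  shows "small A" "small B" "D2 f" "D2 g" "D2 (cmp f g)" "bounded_rel (cmp f g)"
    "functional (cmp f g)" "\<And>y. y \<in> A \<Longrightarrow> \<exists>x. cmp f g x y"
    "\<And>x y. cmp f g x y \<Longrightarrow> x \<in> A \<and> y \<in> A"
    "\<And>x y. f x y \<Longrightarrow> x \<in> A \<and> y \<in> B" "\<And>x y z. f x y \<Longrightarrow> f x z \<Longrightarrow> y = z" "\<And>y. y \<in> B \<Longrightarrow> \<exists>x. f x y"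
    "\<And>x y. g x y \<Longrightarrow> x \<in> B \<and> y \<in> A" "\<And>x y z. g x y \<Longrightarrow> g x z \<Longrightarrow> y = z" "\<And>y. y \<in> A \<Longrightarrow> \<exists>x. g x y"
proof -
  show *: "small A" "small B" "D2 f" "D2 g" using assms by (simp_all add: surj_pair_def)
  show **: "D2 (cmp f g)" unfolding D2_def cmp_def by (intro Dr D2D[OF *(3)] D2D[OF *(4)])
  show ***: "functional (cmp f g)" "\<And>y. y \<in> A \<Longrightarrow> \<exists>x. cmp f g x y"
    "\<And>x y. cmp f g x y \<Longrightarrow> x \<in> A \<and> y \<in> A"
    "\<And>x y. f x y \<Longrightarrow> x \<in> A \<and> y \<in> B" "\<And>x y z. f x y \<Longrightarrow> f x z \<Longrightarrow> y = z" "\<And>y. y \<in> B \<Longrightarrow> \<exists>x. f x y"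
    "\<And>x y. g x y \<Longrightarrow> x \<in> B \<and> y \<in> A" "\<And>x y z. g x y \<Longrightarrow> g x z \<Longrightarrow> y = z" "\<And>y. y \<in> A \<Longrightarrow> \<exists>x. g x y"
    using assms unfolding surj_pair_def onto_def cmp_def functional_def by metis+
  show "bounded_rel (cmp f g)" unfolding bounded_rel_def using * ** ***(3) by blast
qed

lemma small_minimal:
  assumes "bounded_rel R" "small X"
  shows "small (minimal R X)"
proof -
  have "D2 R" using assms(1) by (simp add: bounded_rel_def)
  then show ?thesis unfolding minimal_def
    by (intro small_sep[OF assms(2)]) (intro Dr D2D D_reach D_small[OF assms(2)])
qed

text \<open>\<open>U\<close> consists of the proper ancestors of minimal points. By minimality it
  contains none of these points, and since the composite is onto \<open>A\<close>, it maps
  \<open>U\<close> onto \<open>U\<close> together with all of them.\<close>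

lemma absorbs_minimal:
  assumes p: "surj_pair f g A B" and X: "small X" "X \<subseteq> A"
  shows "absorbs A (minimal (cmp f g) X)"
proof -
  note P = surj_pairD[OF p]
  let ?R = "cmp f g"
  let ?M = "minimal ?R X"
  have sM: "small ?M" by (rule small_minimal[OF P(6) X(1)])
  define U where "U = {u \<in> A. \<exists>r\<in>?M. \<exists>p. ?R u p \<and> reach ?R p r}"
  have sU: "small U" unfolding U_def
    by (rule small_sep[OF P(1)]) (intro Dr D_small[OF sM] D2D[OF P(5)] D_reach[OF P(5)])
  have dj: "U \<inter> ?M = {}" unfolding U_def minimal_def by blast
  have "U \<union> ?M \<preceq> U"
  proof (rule leI[where R = ?R])
    show "D (\<lambda>s. ?R (s 0) (s 1))" using P(5) unfolding D2_def .
    fix y assume y: "y \<in> U \<union> ?M"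
    then have "y \<in> A" using X(2) unfolding U_def minimal_def by blast
    then obtain x where x: "?R x y" using P(8) by blast
    have "\<exists>r\<in>?M. reach ?R y r" using y reach_refl[of ?R y] reach_step[of ?R y] unfolding U_def by blast
    then have "x \<in> U" unfolding U_def using x P(9) by blast
    then show "\<exists>x\<in>U. ?R x y" using x by blast
  qed (use sU sM functionalD[OF P(7)] small_Un in auto)
  then have "absorbs U ?M" using absorbs_disjoint sU sM dj by blast
  moreover have "small (A - U)"
    by (rule small_subset[OF P(1)]) (auto intro!: Dr D_small[OF P(1)] D_small[OF sU])
  ultimately show ?thesis using absorbs_superset[of A U] P(1) sU sM unfolding U_def by blast
qed

text \<open>In one direction the map is \<open>f\<close>; in the other, \<open>t\<close> goes to the
  first point of \<open>X\<close> at or after its value under \<open>g\<close>. A point outside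
  \<open>V\<close> is not minimal and hence is such a first return, and closure of \<open>V\<close>
  under descendants ensures that the preimage it comes from is not in the image of
  \<open>V\<close>.\<close>

lemma class_eqv:
  assumes p: "surj_pair f g A B" and X: "small X" "X \<subseteq> A" and T: "small T" "T \<subseteq> B"
    and XT: "\<And>x y. f x y \<Longrightarrow> x \<in> X \<longleftrightarrow> y \<in> T"
    and V: "small V" "V \<subseteq> X" "minimal (cmp f g) X \<subseteq> V"
      "\<And>v x. v \<in> V \<Longrightarrow> reach (cmp f g) v x \<Longrightarrow> x \<in> X \<Longrightarrow> x \<in> V"
  shows "X - V \<approx> T - {t. \<exists>v\<in>V. f v t}"
proof -
  note P = surj_pairD[OF p]
  let ?R = "cmp f g"
  let ?Y = "{t. \<exists>v\<in>V. f v t}"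
  have sXV: "small (X - V)"
    by (rule small_subset[OF X(1)]) (auto intro!: Dr D_small[OF X(1)] D_small[OF V(1)])
  have sTY: "small (T - ?Y)"
    by (rule small_subset[OF T(1)]) (auto intro!: Dr D_small[OF T(1)] D_small[OF V(1)] D2D[OF P(3)])
  have "T - ?Y \<preceq> X - V"
  proof (rule leI[where R = f])
    show "D (\<lambda>s. f (s 0) (s 1))" using P(3) unfolding D2_def .
    show "\<exists>x\<in>X - V. f x t" if "t \<in> T - ?Y" for t
      using that P(12)[of t] XT T(2) by blast
  qed (use sXV sTY P(11) in auto)
  moreover have "X - V \<preceq> T - ?Y"
  proof (rule leI[where R = "\<lambda>t w. w \<in> X \<and> (\<exists>p. g t p \<and> reach (off ?R X) p w)"])
    have "D2 (off ?R X)" using bounded_rel_off[OF P(6) X(1)] by (simp add: bounded_rel_def)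
    then show "D (\<lambda>s. s 1 \<in> X \<and> (\<exists>p. g (s 0) p \<and> reach (off ?R X) p (s 1)))"
      by (intro Dr D_small[OF X(1)] D2D[OF P(4)] D_reach)
    show "y = z" if "y \<in> X \<and> (\<exists>p. g t p \<and> reach (off ?R X) p y)" "z \<in> X \<and> (\<exists>p. g t p \<and> reach (off ?R X) p z)"
      for t y z
      using that P(14) first_unique[OF P(7) P(6) X(1)] by metis
    fix w assume w: "w \<in> X - V"
    then have "w \<notin> minimal ?R X" using V(3) by blast
    then obtain u p where u: "u \<in> X" "?R u p" "reach ?R p w" using w unfolding minimal_def by blast
    obtain x where x: "x \<in> X" "first_return ?R X x w"
      using first_return_exists[of ?R X u w p, OF P(6) X(1) u(1) _ u(2,3)] w by blast
    then obtain t p' where t: "f x t" "g t p'" "reach (off ?R X) p' w"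
      unfolding first_return_def cmp_def by blast
    have "t \<notin> ?Y"
    proof
      assume "t \<in> ?Y"
      then obtain v where v: "v \<in> V" "f v t" by blast
      then have "first_return ?R X v w" using t w unfolding first_return_def cmp_def by blast
      then show False using first_return_reach V(4) v w by blast
    qed
    then show "\<exists>t\<in>T - ?Y. w \<in> X \<and> (\<exists>p. g t p \<and> reach (off ?R X) p w)" using t XT x w by blast
  qed (use sXV sTY in auto)
  ultimately show ?thesis by (simp add: eqv_def)
qed

end

context zf_ac
begin

text \<open>Each forward image of \<open>S\<close> is a surjective image of the previous one and
  therefore absorbed; the union of all of them is closed under \<open>R\<close> and is absorbed by
  \<open>absorbs_UN\<close>.\<close>

lemma absorbs_orbit:
  assumes R: "bounded_rel R" "functional R" and A: "small A"
    and S: "small S" "absorbs A S"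
  shows "\<exists>W. small W \<and> absorbs A W \<and> S \<subseteq> W \<and> (\<forall>x y. x \<in> W \<longrightarrow> reach R x y \<longrightarrow> y \<in> W)"
proof -
  have D: "D2 R" using R(1) by (simp add: bounded_rel_def)
  obtain C where C: "small C" "\<And>x y. R x y \<Longrightarrow> y \<in> C" using R(1) unfolding bounded_rel_def by blast
  have "Dt (\<lambda>s. coll {z \<in> C. \<exists>x. x \<epsilon> s 1 \<and> R x z})" by (intro Dr D_small[OF C(1)] D2D[OF D])
  from N_rec[of "\<lambda>n u. coll {z \<in> C. \<exists>x. x \<epsilon> u \<and> R x z}" "coll S", OF this]
  obtain F where F: "Dt (\<lambda>s. F (s 0))" "F z0 = coll S"
    "\<And>n. n \<in> N \<Longrightarrow> F (sc n) = coll {z \<in> C. \<exists>x. x \<epsilon> F n \<and> R x z}" by blast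
  have sm: "small {z \<in> C. \<exists>x. x \<epsilon> u \<and> R x z}" for u
    by (rule small_sep[OF C(1)]) (intro Dr D2D[OF D])
  have FS: "ext (F (sc n)) = {z. \<exists>x. x \<epsilon> F n \<and> R x z}" if "n \<in> N" for n
    unfolding F(3)[OF that] ext_coll[OF sm] using C(2) by blast
  have fam: "fam (\<lambda>n. ext (F n))" by (rule fam_ext[OF F(1)])
  have ab: "absorbs A (ext (F n))" if "n \<in> N" for n
  proof (rule N_induct[OF that])
    show "D (\<lambda>s. absorbs A (ext (F (s 0))))"
      by (rule D_absorbs[of "\<lambda>_. A", OF fam_const[OF A] fam Dt_var])
    show "absorbs A (ext (F z0))" using S by (simp add: F(2) ext_coll)
    fix n assume n: "n \<in> N" and IH: "absorbs A (ext (F n))"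
    have "ext (F (sc n)) \<preceq> ext (F n)"
    proof (rule leI[where R = R])
      show "D (\<lambda>s. R (s 0) (s 1))" using D unfolding D2_def .
      show "\<exists>x\<in>ext (F n). R x y" if "y \<in> ext (F (sc n))" for y
        using that unfolding FS[OF n] by auto
    qed (use functionalD[OF R(2)] in auto)
    then show "absorbs A (ext (F (sc n)))" using absorbs_mono[OF A _ _ IH] by simp
  qed
  let ?W = "\<Union>n\<in>N. ext (F n)"
  have "absorbs A ?W" using absorbs_UN[OF A fam ab] .
  moreover have sW: "small ?W" by (rule small_UN_fam[OF fam])
  moreover have "S \<subseteq> ?W" using F(2) S(1) by (auto simp: ext_coll intro!: bexI[of _ z0]) (simp add: mem_coll)
  moreover have "y \<in> ?W" if "x \<in> ?W" "reach R x y" for x y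
  proof (rule reach_induct[of R x y "\<lambda>z. z \<in> ?W", OF that(2) R(1)])
    show "D (\<lambda>s. s 0 \<in> ?W)" by (intro D_small[OF sW] Dr)
    fix u v assume "u \<in> ?W" "R u v"
    then obtain n where n: "n \<in> N" "u \<epsilon> F n" by auto
    then have "v \<in> ext (F (sc n))" using FS[OF n(1)] \<open>R u v\<close> by blast
    then show "v \<in> ?W" using n(1) by (intro UN_I[of "sc n"]) auto
  qed (rule that(1))
  ultimately show ?thesis by blast
qed

text \<open>Removing the minimal points alone is not enough for \<open>class_eqv\<close>, which asks
  for a set closed under descendants in \<open>X\<close>. The orbits of the minimal points supply it
  and are still absorbed, and the image of the removed part under \<open>f\<close> is absorbed with
  it.\<close>

theorem class_principle:
  assumes p: "surj_pair f g A B" and X: "small X" "X \<subseteq> A" and T: "small T" "T \<subseteq> B"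
    and XT: "\<And>x y. f x y \<Longrightarrow> x \<in> X \<longleftrightarrow> y \<in> T"
  obtains V Y where "small V" "V \<subseteq> X" "absorbs A V" "small Y" "Y \<subseteq> T" "absorbs A Y"
    "small (X - V)" "small (T - Y)" "X - V \<approx> T - Y"
proof -
  note P = surj_pairD[OF p]
  let ?M = "minimal (cmp f g) X"
  have sM: "small ?M" by (rule small_minimal[OF P(6) X(1)])
  from absorbs_orbit[OF P(6) P(7) P(1) sM absorbs_minimal[OF p X]]
  obtain W where W: "small W" "absorbs A W" "?M \<subseteq> W"
    "\<And>x y. x \<in> W \<Longrightarrow> reach (cmp f g) x y \<Longrightarrow> y \<in> W" by blast
  define V where "V = X \<inter> W"
  define Y where "Y = {t. \<exists>v\<in>V. f v t}"
  have sV: "small V" unfolding V_def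
    by (rule small_subset[OF X(1)]) (auto intro!: Dr D_small[OF X(1)] D_small[OF W(1)])
  have YT: "Y \<subseteq> T" using XT unfolding Y_def V_def by blast
  have sY: "small Y"
    by (rule small_subset[OF T(1) YT]) (unfold Y_def, intro Dr D_small[OF sV] D2D[OF P(3)])
  have aV: "absorbs A V" by (rule absorbs_subset[OF P(1) W(1) sV W(2)]) (simp add: V_def)
  have "Y \<preceq> V"
  proof (rule leI[where R = f])
    show "D (\<lambda>s. f (s 0) (s 1))" using P(3) unfolding D2_def .
  qed (use sV sY P(11) in \<open>auto simp: Y_def\<close>)
  then have aY: "absorbs A Y" using absorbs_mono[OF P(1) sV sY aV] by blast
  have e: "X - V \<approx> T - Y"
    unfolding Y_def
  proof (rule class_eqv[OF p X T XT sV])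
    show "?M \<subseteq> V" using W(3) unfolding V_def minimal_def by blast
    show "x \<in> V" if "v \<in> V" "reach (cmp f g) v x" "x \<in> X" for v x
      using that W(4) unfolding V_def by blast
  qed (auto simp: V_def)
  have "small (X - V)"
    by (rule small_subset[OF X(1)]) (auto intro!: Dr D_small[OF X(1)] D_small[OF sV])
  moreover have "small (T - Y)"
    by (rule small_subset[OF T(1)]) (auto intro!: Dr D_small[OF T(1)] D_small[OF sY])
  ultimately show ?thesis using that[OF sV _ aV sY YT aY _ _ e] V_def by blast
qed

end

section \<open>Rules for differences, comparisons and split classes\<close>

context zf
begin

lemma small_Int: "small A \<Longrightarrow> small B \<Longrightarrow> small (A \<inter> B)"
  by (rule small_subset[of A]) (auto intro!: Dr D_small)

lemma small_Diff: "small A \<Longrightarrow> small B \<Longrightarrow> small (A - B)"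
  by (rule small_subset[of A]) (auto intro!: Dr D_small)

text \<open>Unlike \<open>D_le\<close>, this admits arbitrary definable set expressions on both
  sides, as the compound sums in later induction hypotheses require.\<close>

lemma D_le_gen:
  assumes "\<And>s. small (S s)" "\<And>s. small (T s)"
    "D (\<lambda>s. s 0 \<in> S (\<lambda>i. s (Suc i)))" "D (\<lambda>s. s 0 \<in> T (\<lambda>i. s (Suc i)))"
  shows "D (\<lambda>s. S s \<preceq> T s)"
  using D_le_ext[OF Dt_coll[OF assms(3)] Dt_coll[OF assms(4)]] assms(1,2) by (simp add: ext_coll)

lemma le_onto: "B \<preceq> A \<Longrightarrow> \<exists>R. D2 R \<and> onto R A B"
proof -
  assume "B \<preceq> A"
  then obtain r where "onto (\<lambda>x y. \<langle>x, y\<rangle> \<epsilon> r) A B" unfolding le_def by blast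
  moreover have "D2 (\<lambda>x y. \<langle>x, y\<rangle> \<epsilon> r)" unfolding D2_def by (intro Dr)
  ultimately show ?thesis by blast
qed

lemma le_plus2: "small A \<Longrightarrow> small B \<Longrightarrow> B \<preceq> A \<oplus> B"
  using le_trans[OF _ _ le_plus1 plus_commute_le] by simp

lemma absorbs_le: "small A \<Longrightarrow> small Y \<Longrightarrow> absorbs A Y \<Longrightarrow> Y \<preceq> A"
  unfolding absorbs_def using le_trans[OF _ _ le_plus2] by blast

lemma absorbs_split_q:
  assumes "small A1" "small A2" "small Y" "absorbs (A1 \<oplus> A2) Y"
  obtains Y1 Y2 where "small Y1" "small Y2" "q Y = q Y1 \<uplus> q Y2" "q A1 \<uplus> q Y1 = q A1" "q A2 \<uplus> q Y2 = q A2"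
proof -
  obtain Y1 Y2 where Y: "small Y1" "small Y2" "Y1 \<union> Y2 = Y" "Y1 \<inter> Y2 = {}" "absorbs A1 Y1" "absorbs A2 Y2"
    by (rule absorbs_split[OF assms])
  show ?thesis
    by (rule that[OF Y(1,2)]) (use Y assms q_Un[of Y1 Y2] in \<open>auto simp: absorbs_iff\<close>)
qed

end

context zf_ac
begin

section \<open>Finite refinement\<close>

text \<open>The cells are the intersections of the parts of \<open>A\<close> with the preimages of
  the parts of \<open>B\<close>, corrected by absorbed pieces. Splitting decides to which cell a
  piece goes, so that each sum of two cells exceeds its target only by pieces which that target
  absorbs.\<close>

theorem refinement:
  assumes s: "small A1" "small A2" "small B1" "small B2" and e: "A1 \<oplus> A2 \<approx> B1 \<oplus> B2"
  shows "\<exists>C1 C2 C3 C4. small C1 \<and> small C2 \<and> small C3 \<and> small C4 \<and>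
    A1 \<approx> C1 \<oplus> C2 \<and> A2 \<approx> C3 \<oplus> C4 \<and> B1 \<approx> C1 \<oplus> C3 \<and> B2 \<approx> C2 \<oplus> C4"
proof -
  define A where "A = A1 \<oplus> A2"
  define B where "B = B1 \<oplus> B2"
  have sA: "small A" "small B" using s by (simp_all add: A_def B_def)
  have qAB: "q A = q B" using e sA q_eq unfolding A_def B_def by blast
  obtain f g where f: "D2 f" "onto f A B" and g: "D2 g" "onto g B A"
    using e le_onto unfolding eqv_def A_def B_def by metis
  have pr: "surj_pair f g A B" unfolding surj_pair_def using sA f g by blast
  define c where "c i x = \<langle>x, i\<rangle>" for i x
  have cD: "Dt (\<lambda>s. c i (s 0))" for i unfolding c_def by (intro Dr)
  have ci: "inj_on (c i) A" for i A by (auto simp: inj_on_def c_def)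
  have qc: "q (c i ` A) = q A" if "small A" for i A
    using inj_image_eqv[OF that cD ci] q_eq small_image[OF that cD] that by blast
  define P1 where "P1 = c z0 ` A1"
  define P2 where "P2 = c z1 ` A2"
  define T1 where "T1 = c z0 ` B1"
  define T2 where "T2 = c z1 ` B2"
  have sP: "small P1" "small P2" "small T1" "small T2"
    unfolding P1_def P2_def T1_def T2_def by (intro small_image s cD)+
  have AP: "A = P1 \<union> P2" "P1 \<inter> P2 = {}" "B = T1 \<union> T2" "T1 \<inter> T2 = {}"
    by (auto simp: A_def B_def P1_def P2_def T1_def T2_def c_def plus_def)
  have qP: "q P1 = q A1" "q P2 = q A2" "q T1 = q B1" "q T2 = q B2"
    unfolding P1_def P2_def T1_def T2_def using s by (simp_all add: qc)
  define X2 where "X2 = {x \<in> A. \<exists>y\<in>T2. f x y}"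
  \<comment> \<open>Taken as a complement, \<open>X1\<close> also receives the points at which
    \<open>f\<close> is undefined, so that the two sets exhaust \<open>A\<close>.\<close>
  define X1 where "X1 = A - X2"
  have sX2: "small X2" unfolding X2_def
    by (rule small_sep[OF sA(1)]) (intro Dr D2D[OF f(1)] D_small[OF sP(4)])
  have sX1: "small X1" unfolding X1_def by (intro small_Diff sA sX2)
  note P = surj_pairD[OF pr]
  have fX: "x \<in> X1 \<longleftrightarrow> y \<in> T1" "x \<in> X2 \<longleftrightarrow> y \<in> T2" if "f x y" for x y
    using that P(10)[OF that] P(11)[of x y] AP unfolding X1_def X2_def by blast+
  obtain V1 Y1 where 1: "small V1" "V1 \<subseteq> X1" "absorbs A V1" "small Y1" "Y1 \<subseteq> T1" "absorbs A Y1"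
    "small (X1 - V1)" "small (T1 - Y1)" "X1 - V1 \<approx> T1 - Y1"
    using class_principle[OF pr sX1 _ sP(3) _ fX(1)] AP unfolding X1_def by blast
  obtain V2 Y2 where 2: "small V2" "V2 \<subseteq> X2" "absorbs A V2" "small Y2" "Y2 \<subseteq> T2" "absorbs A Y2"
    "small (X2 - V2)" "small (T2 - Y2)" "X2 - V2 \<approx> T2 - Y2"
    using class_principle[OF pr sX2 _ sP(4) _ fX(2)] AP unfolding X2_def by blast
  define W1 where "W1 = X1 - V1"
  define W2 where "W2 = X2 - V2"
  have sW: "small W1" "small W2" using 1 2 by (simp_all add: W1_def W2_def)
  have dj: "W1 \<inter> W2 = {}" "W1 \<inter> V1 = {}" "W1 \<inter> V2 = {}" "W2 \<inter> V1 = {}" "W2 \<inter> V2 = {}" "V1 \<inter> V2 = {}"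
    "A = W1 \<union> V1 \<union> (W2 \<union> V2)"
    using 1(2) 2(2) unfolding W1_def W2_def X1_def X2_def by blast+
  have qT: "q B1 = q W1 \<uplus> q Y1" "q B2 = q W2 \<uplus> q Y2"
    using q_partition[of T1 Y1] q_partition[of T2 Y2] 1 2 sP sW qP
    by (auto simp: W1_def W2_def padd_commute simp flip: q_eq)
  have qW: "q W1 = q (P1 \<inter> W1) \<uplus> q (P2 \<inter> W1)" "q W2 = q (P1 \<inter> W2) \<uplus> q (P2 \<inter> W2)"
  proof -
    have "W1 = (P1 \<inter> W1) \<union> (P2 \<inter> W1)" "W2 = (P1 \<inter> W2) \<union> (P2 \<inter> W2)" using dj AP by blast+
    moreover have "(P1 \<inter> W1) \<inter> (P2 \<inter> W1) = {}" "(P1 \<inter> W2) \<inter> (P2 \<inter> W2) = {}" using AP by blast+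
    ultimately show "q W1 = q (P1 \<inter> W1) \<uplus> q (P2 \<inter> W1)" "q W2 = q (P1 \<inter> W2) \<uplus> q (P2 \<inter> W2)"
      using q_Un small_Int sP sW by metis+
  qed
  have qA: "q P = q (P \<inter> W1) \<uplus> q (P \<inter> V1) \<uplus> q (P \<inter> W2) \<uplus> q (P \<inter> V2)" if "small P" "P \<subseteq> A" for P
  proof -
    have "P = (P \<inter> W1) \<union> ((P \<inter> V1) \<union> ((P \<inter> W2) \<union> (P \<inter> V2)))" using dj(7) that by blast
    also have "q \<dots> = q (P \<inter> W1) \<uplus> q (P \<inter> V1) \<uplus> q (P \<inter> W2) \<uplus> q (P \<inter> V2)"
    proof -
      have sI: "small (P \<inter> W1)" "small (P \<inter> V1)" "small (P \<inter> W2)" "small (P \<inter> V2)"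
        by (intro small_Int that(1) sW 1(1) 2(1))+
      have "q (P \<inter> W2 \<union> P \<inter> V2) = q (P \<inter> W2) \<uplus> q (P \<inter> V2)"
        by (rule q_Un[OF sI(3,4)]) (use dj in blast)
      moreover have "q (P \<inter> V1 \<union> (P \<inter> W2 \<union> P \<inter> V2)) = q (P \<inter> V1) \<uplus> q (P \<inter> W2 \<union> P \<inter> V2)"
        by (rule q_Un[OF sI(2) small_Un[OF sI(3,4)]]) (use dj in blast)
      moreover have "q (P \<inter> W1 \<union> (P \<inter> V1 \<union> (P \<inter> W2 \<union> P \<inter> V2))) = q (P \<inter> W1) \<uplus> q (P \<inter> V1 \<union> (P \<inter> W2 \<union> P \<inter> V2))"
        by (rule q_Un[OF sI(1) small_Un[OF sI(2) small_Un[OF sI(3,4)]]]) (use dj in blast)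
      ultimately show ?thesis by simp
    qed
    finally show ?thesis .
  qed
  have abB: "absorbs (B1 \<oplus> B2) V" if "small V" "V \<subseteq> V1 \<or> V \<subseteq> V2" for V
  proof -
    have "absorbs A V" using absorbs_subset[OF sA(1)] that 1(1,3) 2(1,3) by blast
    then show ?thesis using absorbs_cong[OF sA that(1) qAB] unfolding B_def by blast
  qed
  have sV: "small (P1 \<inter> V1)" "small (P2 \<inter> V1)" "small (P1 \<inter> V2)" "small (P2 \<inter> V2)"
    using small_Int sP 1(1) 2(1) by blast+
  \<comment> \<open>The digits of \<open>vijk\<close> say that it stands for the piece of
    \<open>Pi \<inter> Vj\<close> absorbed by \<open>Bk\<close>; further down, \<open>yij\<close>
    stands for the piece of \<open>Yj\<close> absorbed by \<open>Ai\<close>.\<close>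
  obtain v111 v112 where v11: "small v111" "small v112" "q (P1 \<inter> V1) = q v111 \<uplus> q v112"
    "q B1 \<uplus> q v111 = q B1" "q B2 \<uplus> q v112 = q B2"
    using absorbs_split_q[OF s(3,4) sV(1) abB[OF sV(1)]] by blast
  obtain v211 v212 where v21: "small v211" "small v212" "q (P2 \<inter> V1) = q v211 \<uplus> q v212"
    "q B1 \<uplus> q v211 = q B1" "q B2 \<uplus> q v212 = q B2"
    using absorbs_split_q[OF s(3,4) sV(2) abB[OF sV(2)]] by blast
  obtain v121 v122 where v12: "small v121" "small v122" "q (P1 \<inter> V2) = q v121 \<uplus> q v122"
    "q B1 \<uplus> q v121 = q B1" "q B2 \<uplus> q v122 = q B2"
    using absorbs_split_q[OF s(3,4) sV(3) abB[OF sV(3)]] by blast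
  obtain v221 v222 where v22: "small v221" "small v222" "q (P2 \<inter> V2) = q v221 \<uplus> q v222"
    "q B1 \<uplus> q v221 = q B1" "q B2 \<uplus> q v222 = q B2"
    using absorbs_split_q[OF s(3,4) sV(4) abB[OF sV(4)]] by blast
  obtain y11 y21 where y1: "small y11" "small y21" "q Y1 = q y11 \<uplus> q y21"
    "q A1 \<uplus> q y11 = q A1" "q A2 \<uplus> q y21 = q A2"
    using absorbs_split_q[OF s(1,2) 1(4)] 1(6) unfolding A_def by blast
  obtain y12 y22 where y2: "small y12" "small y22" "q Y2 = q y12 \<uplus> q y22"
    "q A1 \<uplus> q y12 = q A1" "q A2 \<uplus> q y22 = q A2"
    using absorbs_split_q[OF s(1,2) 2(4)] 2(6) unfolding A_def by blast
  \<comment> \<open>The pieces \<open>v\<close> are genuine parts of the sums for \<open>A1\<close>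
    and \<open>A2\<close> and surplus in the sums for \<open>B1\<close> and \<open>B2\<close>, which
    absorb them; for the pieces \<open>y\<close> it is the other way round.\<close>
  define C1 where "C1 = (P1 \<inter> W1) \<oplus> y11 \<oplus> v111 \<oplus> v121"
  define C2 where "C2 = (P1 \<inter> W2) \<oplus> y12 \<oplus> v112 \<oplus> v122"
  define C3 where "C3 = (P2 \<inter> W1) \<oplus> y21 \<oplus> v211 \<oplus> v221"
  define C4 where "C4 = (P2 \<inter> W2) \<oplus> y22 \<oplus> v212 \<oplus> v222"
  have sPW: "small (P1 \<inter> W1)" "small (P1 \<inter> W2)" "small (P2 \<inter> W1)" "small (P2 \<inter> W2)"
    using small_Int sP sW by blast+
  have sC: "small C1" "small C2" "small C3" "small C4"
    unfolding C1_def C2_def C3_def C4_def by (intro small_plus sPW v11 v12 v21 v22 y1 y2)+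
  have qC: "q C1 = q (P1 \<inter> W1) \<uplus> q y11 \<uplus> q v111 \<uplus> q v121"
    "q C2 = q (P1 \<inter> W2) \<uplus> q y12 \<uplus> q v112 \<uplus> q v122"
    "q C3 = q (P2 \<inter> W1) \<uplus> q y21 \<uplus> q v211 \<uplus> q v221"
    "q C4 = q (P2 \<inter> W2) \<uplus> q y22 \<uplus> q v212 \<uplus> q v222"
    unfolding C1_def C2_def C3_def C4_def
    by (simp_all add: q_plus sPW v11(1,2) v12(1,2) v21(1,2) v22(1,2) y1(1,2) y2(1,2))
  have a: "q A1 = q (P1 \<inter> W1) \<uplus> q v111 \<uplus> q v112 \<uplus> q (P1 \<inter> W2) \<uplus> q v121 \<uplus> q v122"
    "q A2 = q (P2 \<inter> W1) \<uplus> q v211 \<uplus> q v212 \<uplus> q (P2 \<inter> W2) \<uplus> q v221 \<uplus> q v222"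
    using qA[OF sP(1)] qA[OF sP(2)] AP(1) unfolding qP v11(3) v12(3) v21(3) v22(3)
    by (simp_all add: padd_assoc)
  have b: "q B1 = q (P1 \<inter> W1) \<uplus> q (P2 \<inter> W1) \<uplus> q y11 \<uplus> q y21"
    "q B2 = q (P1 \<inter> W2) \<uplus> q (P2 \<inter> W2) \<uplus> q y12 \<uplus> q y22"
    using qT qW y1(3) y2(3) by (simp_all add: padd_assoc)
  have "q C1 \<uplus> q C2 = (q A1 \<uplus> q y11) \<uplus> q y12" unfolding qC a by (simp add: padd_ac)
  then have A1: "q A1 = q C1 \<uplus> q C2" using y1(4) y2(4) by simp
  have "q C3 \<uplus> q C4 = (q A2 \<uplus> q y21) \<uplus> q y22" unfolding qC a by (simp add: padd_ac)
  then have A2: "q A2 = q C3 \<uplus> q C4" using y1(5) y2(5) by simp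
  have "q C1 \<uplus> q C3 = (((q B1 \<uplus> q v111) \<uplus> q v121) \<uplus> q v211) \<uplus> q v221" unfolding qC b by (simp add: padd_ac)
  then have B1: "q B1 = q C1 \<uplus> q C3" using v11(4) v12(4) v21(4) v22(4) by simp
  have "q C2 \<uplus> q C4 = (((q B2 \<uplus> q v112) \<uplus> q v122) \<uplus> q v212) \<uplus> q v222" unfolding qC b by (simp add: padd_ac)
  then have B2: "q B2 = q C2 \<uplus> q C4" using v11(5) v12(5) v21(5) v22(5) by simp
  have "A1 \<approx> C1 \<oplus> C2" "A2 \<approx> C3 \<oplus> C4" "B1 \<approx> C1 \<oplus> C3" "B2 \<approx> C2 \<oplus> C4"
    using A1 A2 B1 B2 s sC by (simp_all add: q_plus flip: q_eq)
  then show ?thesis using sC by blast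
qed

end

context zf
begin

section \<open>Addition of natural numbers\<close>

text \<open>The condition in \<open>nat_add\<close> rewritten with pairs in place of
  \<open>app\<close>, which makes its definability immediate.\<close>

definition add_rel :: "'a \<Rightarrow> 'a \<Rightarrow> 'a \<Rightarrow> bool" where
  "add_rel m n k \<longleftrightarrow> (\<exists>f. is_function mem f \<and> (\<forall>x. x \<in> N \<longleftrightarrow> (\<exists>y. \<langle>x, y\<rangle> \<epsilon> f)) \<and> \<langle>z0, m\<rangle> \<epsilon> f \<and>
    (\<forall>i j. i \<in> N \<longrightarrow> \<langle>i, j\<rangle> \<epsilon> f \<longrightarrow> \<langle>sc i, sc j\<rangle> \<epsilon> f) \<and> \<langle>n, k\<rangle> \<epsilon> f)"

text \<open>The value of \<open>nat_add m n\<close> is junk for \<open>n\<close> outside \<open>\<omega>\<close>; the case distinction makes the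
  graph definable by one formula.\<close>

definition ad :: "'a \<Rightarrow> 'a \<Rightarrow> 'a" where
  "ad m n = (if n \<in> N then nat_add mem m n else z0)"

lemma nat_add_rel:
  assumes "n \<in> N"
  shows "(\<exists>f. sequence mem f \<and> app mem f z0 = m \<and>
     (\<forall>i. i \<epsilon> omega mem \<longrightarrow> app mem f (sc i) = sc (app mem f i)) \<and> k = app mem f n) \<longleftrightarrow> add_rel m n k"
proof -
  have *: "sequence mem f \<longleftrightarrow> is_function mem f \<and> (\<forall>x. x \<in> N \<longleftrightarrow> (\<exists>y. \<langle>x, y\<rangle> \<epsilon> f))" for f
  proof (cases "is_function mem f")
    case True
    have "domain_of mem f = omega mem \<longleftrightarrow> (\<forall>x. x \<epsilon> domain_of mem f \<longleftrightarrow> x \<epsilon> omega mem)"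
      using extensional by metis
    then show ?thesis unfolding sequence_def using True by (auto simp: domain_of_iff)
  qed (simp add: sequence_def)
  have ap: "\<langle>x, y\<rangle> \<epsilon> f \<longleftrightarrow> x \<in> N \<and> app mem f x = y" if "sequence mem f" for f x y
    using that app_eq app_in unfolding * unfolding sequence_def by (metis domain_of_iff ext_iff)
  have "(app mem f z0 = m \<and> (\<forall>i. i \<epsilon> omega mem \<longrightarrow> app mem f (sc i) = sc (app mem f i)) \<and> k = app mem f n) \<longleftrightarrow>
    (\<langle>z0, m\<rangle> \<epsilon> f \<and> (\<forall>i j. i \<in> N \<longrightarrow> \<langle>i, j\<rangle> \<epsilon> f \<longrightarrow> \<langle>sc i, sc j\<rangle> \<epsilon> f) \<and> \<langle>n, k\<rangle> \<epsilon> f)"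
    if "sequence mem f" for f
    unfolding ap[OF that] using assms by auto
  then have "(\<exists>f. sequence mem f \<and> app mem f z0 = m \<and>
     (\<forall>i. i \<epsilon> omega mem \<longrightarrow> app mem f (sc i) = sc (app mem f i)) \<and> k = app mem f n) \<longleftrightarrow>
     (\<exists>f. sequence mem f \<and> \<langle>z0, m\<rangle> \<epsilon> f \<and> (\<forall>i j. i \<in> N \<longrightarrow> \<langle>i, j\<rangle> \<epsilon> f \<longrightarrow> \<langle>sc i, sc j\<rangle> \<epsilon> f) \<and> \<langle>n, k\<rangle> \<epsilon> f)"
    by (simp only: cong: conj_cong)
  then show ?thesis unfolding add_rel_def * by (simp only: conj_assoc)
qed

lemma add_rel_unique:
  assumes "n \<in> N" "add_rel m n k" "add_rel m n k'"
  shows "k = k'"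
proof -
  obtain f where f: "is_function mem f" "\<And>x. x \<in> N \<longleftrightarrow> (\<exists>y. \<langle>x, y\<rangle> \<epsilon> f)" "\<langle>z0, m\<rangle> \<epsilon> f"
    "\<And>i j. i \<in> N \<Longrightarrow> \<langle>i, j\<rangle> \<epsilon> f \<Longrightarrow> \<langle>sc i, sc j\<rangle> \<epsilon> f" "\<langle>n, k\<rangle> \<epsilon> f" using assms(2) unfolding add_rel_def by blast
  obtain g where g: "is_function mem g" "\<And>x. x \<in> N \<longleftrightarrow> (\<exists>y. \<langle>x, y\<rangle> \<epsilon> g)" "\<langle>z0, m\<rangle> \<epsilon> g"
    "\<And>i j. i \<in> N \<Longrightarrow> \<langle>i, j\<rangle> \<epsilon> g \<Longrightarrow> \<langle>sc i, sc j\<rangle> \<epsilon> g" "\<langle>n, k'\<rangle> \<epsilon> g" using assms(3) unfolding add_rel_def by blast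
  have "\<exists>y. \<langle>n, y\<rangle> \<epsilon> f \<and> \<langle>n, y\<rangle> \<epsilon> g"
  proof (rule N_induct[OF assms(1)])
    show "D (\<lambda>s. \<exists>y. \<langle>s 0, y\<rangle> \<epsilon> f \<and> \<langle>s 0, y\<rangle> \<epsilon> g)" by (intro Dr)
  qed (use f g in blast)+
  then show ?thesis using f(5) g(5) is_functionD[OF f(1)] is_functionD[OF g(1)] by blast
qed

lemma add_rel_exists: "\<exists>F. Dt (\<lambda>s. F (s 0)) \<and> (\<forall>n\<in>N. add_rel m n (F n)) \<and> F z0 = m \<and> (\<forall>n\<in>N. F (sc n) = sc (F n))"
proof -
  have "Dt (\<lambda>s. sc (s 1))" by (intro Dr)
  from N_rec[of "\<lambda>n k. sc k" m, OF this] obtain F where F: "Dt (\<lambda>s. F (s 0))" "F z0 = m"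
    "\<And>n. n \<in> N \<Longrightarrow> F (sc n) = sc (F n)" by blast
  have iff: "\<langle>x, y\<rangle> \<epsilon> seq_of mem F \<longleftrightarrow> x \<in> N \<and> y = F x" for x y by (auto simp: in_seq_of[OF F(1)])
  have "is_function mem (seq_of mem F)" unfolding is_function_def in_seq_of[OF F(1)] by auto
  then have "add_rel m n (F n)" if "n \<in> N" for n
    unfolding add_rel_def iff using that F by (intro exI[of _ "seq_of mem F"]) (auto simp: iff)
  then show ?thesis using F by blast
qed

lemma ad_iff: "n \<in> N \<Longrightarrow> k = ad m n \<longleftrightarrow> add_rel m n k"
proof -
  assume n: "n \<in> N"
  obtain F where F: "add_rel m n (F n)" using add_rel_exists n by blast
  have "nat_add mem m n = (THE k. add_rel m n k)" unfolding nat_add_def nat_add_rel[OF n] ..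
  also have "\<dots> = F n" by (rule the_equality) (use F add_rel_unique[OF n] in blast)+
  finally show ?thesis using n F add_rel_unique[OF n] unfolding ad_def by auto
qed

lemma Dt_ad [Dr]:
  assumes "Dt t" "Dt u"
  shows "Dt (\<lambda>s. ad (t s) (u s))"
proof (rule Dt_app2[OF _ assms])
  have "y = ad m n \<longleftrightarrow> (n \<in> N \<and> add_rel m n y) \<or> (n \<notin> N \<and> y = z0)" for y m n
    using ad_iff by (auto simp: ad_def)
  then show "Dt (\<lambda>s. ad (s 0) (s 1))" unfolding Dt_def add_rel_def by simp (intro Dr)
qed

lemma ad_zero [simp]: "ad m z0 = m"
  and ad_succ: "n \<in> N \<Longrightarrow> ad m (sc n) = sc (ad m n)"
proof -
  obtain F where F: "\<And>n. n \<in> N \<Longrightarrow> add_rel m n (F n)" "F z0 = m" "\<And>n. n \<in> N \<Longrightarrow> F (sc n) = sc (F n)"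
    using add_rel_exists[of m] by blast
  have "ad m n = F n" if "n \<in> N" for n using F(1)[OF that] ad_iff[OF that, of "F n" m] by simp
  then show "ad m z0 = m" "n \<in> N \<Longrightarrow> ad m (sc n) = sc (ad m n)" using F by simp_all
qed

lemma ad_N [simp]: "m \<in> N \<Longrightarrow> n \<in> N \<Longrightarrow> ad m n \<epsilon> omega mem"
proof (erule N_induct[of n])
  show "D (\<lambda>s. ad m (s 0) \<epsilon> omega mem)" by (intro Dr)
qed (auto simp: ad_succ)

lemma ad_succ_left: "n \<in> N \<Longrightarrow> ad (sc m) n = sc (ad m n)"
proof (erule N_induct)
  show "D (\<lambda>s. ad (sc m) (s 0) = sc (ad m (s 0)))" by (intro Dr)
qed (auto simp: ad_succ)

lemma ad_zero_left: "n \<in> N \<Longrightarrow> ad z0 n = n"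
proof (erule N_induct)
  show "D (\<lambda>s. ad z0 (s 0) = s 0)" by (intro Dr)
qed (auto simp: ad_succ)

lemma ad_total: "n \<in> N \<Longrightarrow> j \<in> N \<Longrightarrow> (\<exists>i\<in>N. n = ad j i) \<or> (\<exists>i\<in>N. j = ad n i)"
proof (erule N_induct[of n])
  assume j: "j \<in> N"
  show "D (\<lambda>s. (\<exists>i\<in>N. s 0 = ad j i) \<or> (\<exists>i\<in>N. j = ad (s 0) i))" by (intro Dr)
  show "(\<exists>i\<in>N. z0 = ad j i) \<or> (\<exists>i\<in>N. j = ad z0 i)" using j ad_zero_left[OF j] by force
  fix n assume n: "n \<in> N" and "(\<exists>i\<in>N. n = ad j i) \<or> (\<exists>i\<in>N. j = ad n i)"
  then consider i where "i \<in> N" "n = ad j i" | i where "i \<in> N" "j = ad n i" by blast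
  then show "(\<exists>i\<in>N. sc n = ad j i) \<or> (\<exists>i\<in>N. j = ad (sc n) i)"
  proof cases
    case 1
    then have "sc n = ad j (sc i)" "sc i \<in> N" by (simp_all add: ad_succ)
    then show ?thesis by blast
  next
    case 2
    from N_cases[OF 2(1)] show ?thesis
    proof
      assume "i = z0"
      then have "sc n = ad j (sc z0)" using 2 by (simp add: ad_succ)
      then show ?thesis by (metis ext_iff succ_N zero_N)
    next
      assume "\<exists>k\<in>N. i = sc k"
      then obtain k where k: "k \<in> N" "i = sc k" by blast
      then have "j = ad (sc n) k" using 2 by (simp add: ad_succ ad_succ_left)
      then show ?thesis using k by blast
    qed
  qed
qed

end

section \<open>Tagged copies and simultaneous recursion along a family\<close>

context zf
begin

definition tag :: "'a \<Rightarrow> 'a \<Rightarrow> 'a" where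
  "tag i x = \<langle>x, i\<rangle>"

lemma Dt_tag [Dr]: "Dt t \<Longrightarrow> Dt u \<Longrightarrow> Dt (\<lambda>s. tag (t s) (u s))"
  unfolding tag_def by (intro Dr)

lemma small_tag:
  assumes "small A"
  shows "small (tag i ` A)"
  by (rule small_image[OF assms]) (intro Dr)

lemma q_tag:
  assumes "small A"
  shows "q (tag i ` A) = q A"
proof -
  have "inj_on (tag i) A" by (auto simp: inj_on_def tag_def)
  moreover have "Dt (\<lambda>s. tag i (s 0))" by (intro Dr)
  ultimately show ?thesis using inj_image_eqv[OF assms] q_eq small_tag[OF assms] assms by blast
qed

lemma tag_Collect: "tag i ` S = {p. \<exists>y\<in>S. p = \<langle>y, i\<rangle>}"
  by (auto simp: tag_def)

lemma surj_pair_eqv: "surj_pair f g A B \<Longrightarrow> A \<approx> B"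
  using leI[of A B f] leI[of B A g] unfolding surj_pair_def onto_def eqv_def D2_def by blast

text \<open>The next stage at \<open>m\<close> may consult the previous stage at
  \<open>sc m\<close>, so the recursion has to carry all indices at once; a stage is therefore coded
  as one subset of \<open>SG A\<close>.\<close>

lemma fam_rec:
  assumes A: "fam A" and P: "D (\<lambda>s. P (s 0) (s 1))" and St: "D (\<lambda>s. St (s 0) (s 1) (s 2))"
  shows "\<exists>F. Dt (\<lambda>s. F (s 0)) \<and> (\<forall>m x. \<langle>x, m\<rangle> \<epsilon> F z0 \<longleftrightarrow> m \<in> N \<and> x \<in> A m \<and> P m x) \<and>
    (\<forall>k\<in>N. \<forall>m x. \<langle>x, m\<rangle> \<epsilon> F (sc k) \<longleftrightarrow> m \<in> N \<and> x \<in> A m \<and> St (F k) m x)"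
proof -
  have sA: "small (SG A)" by (rule small_SG[OF A])
  have "Dt (\<lambda>s. coll {p \<in> SG A. \<exists>x m. p = \<langle>x, m\<rangle> \<and> St (s 1) m x})"
    by (intro Dr D_app3[OF St] fam_D[OF A])
  from N_rec[of "\<lambda>n u. coll {p \<in> SG A. \<exists>x m. p = \<langle>x, m\<rangle> \<and> St u m x}"
      "coll {p \<in> SG A. \<exists>x m. p = \<langle>x, m\<rangle> \<and> P m x}", OF this]
  obtain F where F: "Dt (\<lambda>s. F (s 0))" "F z0 = coll {p \<in> SG A. \<exists>x m. p = \<langle>x, m\<rangle> \<and> P m x}"
    "\<And>n. n \<in> N \<Longrightarrow> F (sc n) = coll {p \<in> SG A. \<exists>x m. p = \<langle>x, m\<rangle> \<and> St (F n) m x}" by blast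
  have 1: "small {p \<in> SG A. \<exists>x m. p = \<langle>x, m\<rangle> \<and> P m x}"
    by (rule small_sep[OF sA]) (intro Dr D_app2[OF P])
  have 2: "small {p \<in> SG A. \<exists>x m. p = \<langle>x, m\<rangle> \<and> St u m x}" for u
    by (rule small_sep[OF sA]) (intro Dr D_app3[OF St])
  show ?thesis
  proof (intro exI[of _ F] conjI allI ballI)
    show "\<langle>x, m\<rangle> \<epsilon> F z0 \<longleftrightarrow> m \<in> N \<and> x \<in> A m \<and> P m x" for m x
      unfolding F(2) mem_coll[OF 1] by auto
    show "\<langle>x, m\<rangle> \<epsilon> F (sc k) \<longleftrightarrow> m \<in> N \<and> x \<in> A m \<and> St (F k) m x" if "k \<in> N" for k m x
      unfolding F(3)[OF that] mem_coll[OF 2] by auto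
  qed (rule F(1))
qed

end

context zf_ac
begin

context
  fixes A B :: "'a \<Rightarrow> 'a set" and f g :: "'a \<Rightarrow> 'a \<Rightarrow> 'a \<Rightarrow> bool"
  assumes fA: "fam A" and fB: "fam B"
    and f3: "D (\<lambda>s. f (s 0) (s 1) (s 2))" and g3: "D (\<lambda>s. g (s 0) (s 1) (s 2))"
    and pr: "\<And>m. m \<in> N \<Longrightarrow> surj_pair (f m) (g m) (A m) (A (sc m) \<oplus> B m)"
begin

section \<open>The remainder postulate\<close>

lemmas fD = D_app3[OF f3] and gD = D_app3[OF g3]
lemmas sA = fam_small[OF fA] and sB = fam_small[OF fB]

abbreviation R where "R m \<equiv> cmp (f m) (g m)"

lemma RD: "Dt t \<Longrightarrow> Dt u \<Longrightarrow> Dt v \<Longrightarrow> D (\<lambda>s. R (t s) (u s) (v s))"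
  by (rule D_app3[of R]) (unfold cmp_def, intro Dr fD gD)

lemma reachRD: "Dt t \<Longrightarrow> Dt u \<Longrightarrow> Dt v \<Longrightarrow> D (\<lambda>s. reach (R (t s)) (u s) (v s))"
  by (rule D_app3[of "\<lambda>m. reach (R m)"]) (unfold reach_def, intro Dr RD)

lemma fam_shift: "fam F \<Longrightarrow> fam (\<lambda>n. F (ad m n))"
  by (rule fam_comp) (auto intro!: Dr)

lemma qA: "m \<in> N \<Longrightarrow> q (A m) = q (A (sc m)) \<uplus> q (B m)"
  using surj_pair_eqv[OF pr, of m] q_eq q_plus sA sB small_plus by metis

text \<open>Up to equivalence \<open>A (sc m)\<close> is a summand of \<open>A m\<close>, and
  enlarging a set preserves what it absorbs.\<close>

lemma absorbs_pred: "m \<in> N \<Longrightarrow> small Y \<Longrightarrow> absorbs (A (sc m)) Y \<Longrightarrow> absorbs (A m) Y"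
  using absorbs_plus[OF sA sB, of Y "sc m" m] absorbs_cong[of "A (sc m) \<oplus> B m" "A m" Y] sA sB qA q_plus
  by (metis small_plus)

lemma absorbs_ad:
  assumes "i \<in> N" "m \<in> N" "small Y" "absorbs (A (ad m i)) Y"
  shows "absorbs (A m) Y"
proof -
  have "absorbs (A (ad m i)) Y \<longrightarrow> absorbs (A m) Y"
  proof (rule N_induct[OF assms(1)])
    have "Dt (\<lambda>s. ad m (s 0))" by (intro Dr)
    from D_absorbs[of A "\<lambda>_. Y", OF fA fam_const[OF assms(3)] this]
    show "D (\<lambda>s. absorbs (A (ad m (s 0))) Y \<longrightarrow> absorbs (A m) Y)" by (intro Dr)
    show "absorbs (A (ad m (sc n))) Y \<longrightarrow> absorbs (A m) Y"
      if "n \<in> N" "absorbs (A (ad m n)) Y \<longrightarrow> absorbs (A m) Y" for n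
      using that absorbs_pred[of "ad m n" Y] assms(2,3) by (simp add: ad_succ)
  qed simp
  then show ?thesis using assms(4) by blast
qed

text \<open>The part that the class principle removes from \<open>X\<close> is put back as the error
  \<open>J\<close>, while the part removed from \<open>T\<close> only makes \<open>T\<close> larger
  than needed.\<close>

lemma class_le:
  assumes m: "m \<in> N" and X: "small X" "X \<subseteq> A m" and T: "small T" "T \<subseteq> A (sc m) \<oplus> B m"
    and XT: "\<And>x p. f m x p \<Longrightarrow> x \<in> X \<longleftrightarrow> p \<in> T"
  shows "\<exists>J. small J \<and> absorbs (A m) J \<and> X \<preceq> T \<oplus> J"
proof -
  obtain V Y where V: "small V" "V \<subseteq> X" "absorbs (A m) V" "small Y" "Y \<subseteq> T" "absorbs (A m) Y"
    "small (X - V)" "small (T - Y)" "X - V \<approx> T - Y"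
    by (rule class_principle[OF pr[OF m] X T XT])
  have "X - V \<preceq> T"
    by (rule le_trans[of T "X - V" "T - Y"]) (use V T in \<open>auto simp: eqv_def intro: subset_le\<close>)
  then have "(X - V) \<oplus> V \<preceq> T \<oplus> V" by (intro plus_mono V T le_refl)
  moreover have "q ((X - V) \<oplus> V) = q X"
    using q_partition[OF X(1) V(1,2,7)] V by (simp add: q_plus padd_commute)
  ultimately have "X \<preceq> T \<oplus> V"
    using le_cong[of "(X - V) \<oplus> V" "T \<oplus> V" X "T \<oplus> V"] V X T by simp
  then show ?thesis using V by blast
qed

lemma class_le_tag:
  assumes m: "m \<in> N" and X: "small X" "X \<subseteq> A m" and S: "small S" "S \<subseteq> A (sc m)"
    and XT: "\<And>x p. f m x p \<Longrightarrow> x \<in> X \<longleftrightarrow> (\<exists>y\<in>S. p = \<langle>y, z0\<rangle>)"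
  shows "\<exists>J. small J \<and> absorbs (A m) J \<and> X \<preceq> S \<oplus> J"
proof -
  have "tag z0 ` S \<subseteq> A (sc m) \<oplus> B m" using S(2) by (auto simp: tag_def)
  from class_le[OF m X small_tag[OF S(1)] this] XT
  obtain J where J: "small J" "absorbs (A m) J" "X \<preceq> tag z0 ` S \<oplus> J" unfolding tag_Collect by auto
  then have "X \<preceq> S \<oplus> J"
    using le_cong[of X "tag z0 ` S \<oplus> J" X "S \<oplus> J"] X S small_tag[OF S(1)] q_tag[OF S(1)]
    by (simp add: q_plus)
  then show ?thesis using J by blast
qed

text \<open>This is the postulate up to an error \<open>K\<close> that \<open>A m\<close> absorbs
  and that may vary with \<open>m\<close>. The points that the maps eventually send into some
  \<open>B\<close> account for the sum; the others have to be compared across all indices to obtain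
  one set \<open>c\<close>.\<close>

lemma remainder_mod:
  "\<exists>c. small c \<and> (\<forall>m\<in>N. \<exists>K. small K \<and> absorbs (A m) K \<and> A m \<approx> (c \<oplus> SG (\<lambda>n. B (ad m n))) \<oplus> K)"
proof -
  have St: "D (\<lambda>s. \<exists>y. \<langle>y, sc (s 1)\<rangle> \<epsilon> s 0 \<and> f (s 1) (s 2) \<langle>y, z0\<rangle>)" by (intro Dr fD)
  have "D (\<lambda>s. \<exists>b. f (s 0) (s 1) \<langle>b, z1\<rangle>)" by (intro Dr fD)
  from fam_rec[OF fA this, where St = "\<lambda>u m x. \<exists>y. \<langle>y, sc m\<rangle> \<epsilon> u \<and> f m x \<langle>y, z0\<rangle>", OF St]
  obtain F where F1: "Dt (\<lambda>s. F (s 0))"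
    and F2: "\<forall>m x. \<langle>x, m\<rangle> \<epsilon> F z0 \<longleftrightarrow> m \<in> N \<and> x \<in> A m \<and> (\<exists>b. f m x \<langle>b, z1\<rangle>)"
    and F3: "\<forall>k\<in>N. \<forall>m x. \<langle>x, m\<rangle> \<epsilon> F (sc k) \<longleftrightarrow>
      m \<in> N \<and> x \<in> A m \<and> (\<exists>y. \<langle>y, sc m\<rangle> \<epsilon> F k \<and> f m x \<langle>y, z0\<rangle>)"
    by (elim exE conjE) (rule that)
  note F = F1 F2[rule_format] F3[rule_format]
  \<comment> \<open>\<open>Dk k m\<close> consists of the points of \<open>A m\<close> that the maps \<open>f\<close> send into \<open>B (m + k)\<close>.\<close>
  define Dk where "Dk k m = {x \<in> A m. \<langle>x, m\<rangle> \<epsilon> F k}" for k m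
  have DkD: "D (\<lambda>s. t s \<in> Dk (u s) (v s))" if "Dt t" "Dt u" "Dt v" for t u v
    unfolding Dk_def using that by (intro Dr fam_D[OF fA] Dt_app1[OF F(1)])
  have sD: "small (Dk k m)" for k m
    unfolding Dk_def by (rule small_sep[OF sA]) (intro Dr)
  have famD: "fam (\<lambda>k. Dk k m)" for m by (rule famI) (auto intro: sD DkD Dt_var Dt_const)
  have D0: "x \<in> Dk z0 m \<longleftrightarrow> (\<exists>b. f m x \<langle>b, z1\<rangle>)" if "m \<in> N" for m x
    using that F(2) surj_pairD(10)[OF pr[OF that]] unfolding Dk_def by auto
  have DS: "x \<in> Dk (sc k) m \<longleftrightarrow> (\<exists>y\<in>Dk k (sc m). f m x \<langle>y, z0\<rangle>)" if "m \<in> N" "k \<in> N" for m k x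
    using that(1) F(3)[OF that(2)] surj_pairD(10)[OF pr[OF that(1)]] unfolding Dk_def by fastforce
  have fv: "p = p'" if "m \<in> N" "f m x p" "f m x p'" for m x p p'
    using surj_pairD(11)[OF pr[OF that(1)]] that by blast
  have excl: False if "m \<in> N" "j \<in> N" "x \<in> Dk z0 m" "x \<in> Dk (sc j) m" for m j x
  proof -
    obtain b y where "f m x \<langle>b, z1\<rangle>" "f m x \<langle>y, z0\<rangle>" using D0 DS \<open>m \<in> N\<close> \<open>j \<in> N\<close> \<open>x \<in> Dk z0 m\<close> \<open>x \<in> Dk (sc j) m\<close> by blast
    from fv[OF \<open>m \<in> N\<close> this] show False by simp
  qed
  define C where "C m = {x \<in> A m. \<forall>k\<in>N. x \<notin> Dk k m}" for m
  have CD: "D (\<lambda>s. t s \<in> C (v s))" if "Dt t" "Dt v" for t v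
    by (rule D_app2[of "\<lambda>x m. x \<in> C m", OF _ that]) (unfold C_def, intro Dr fam_D[OF fA] DkD)
  have famC: "fam C" by (rule fam_subset[OF fA _ CD[OF Dt_var Dt_var]]) (auto simp: C_def)
  note sC = fam_small[OF famC]
  have CA: "C m \<subseteq> A m" for m by (auto simp: C_def)
  \<comment> \<open>Under \<open>f m\<close> the set \<open>C m\<close> corresponds to the copy of
    \<open>C (sc m)\<close>, which is the hypothesis that the class lemmas require.\<close>
  have Cf: "x \<in> C m \<longleftrightarrow> (\<exists>y\<in>C (sc m). p = \<langle>y, z0\<rangle>)" if m: "m \<in> N" and fx: "f m x p" for m x p
  proof -
    have xp: "x \<in> A m" "p \<in> A (sc m) \<oplus> B m" using surj_pairD(10)[OF pr[OF m] fx] by blast+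
    from xp(2) show ?thesis
    proof (cases rule: plusE)
      case (1 y)
      have n0: "x \<notin> Dk z0 m"
      proof
        assume "x \<in> Dk z0 m"
        then obtain b where "f m x \<langle>b, z1\<rangle>" using D0[OF m] by blast
        from fv[OF m fx this] 1 show False by simp
      qed
      have nS: "x \<in> Dk (sc k) m \<longleftrightarrow> y \<in> Dk k (sc m)" if k: "k \<in> N" for k
      proof
        assume "x \<in> Dk (sc k) m"
        then obtain w where w: "w \<in> Dk k (sc m)" "f m x \<langle>w, z0\<rangle>" using DS[OF m k] by blast
        from fv[OF m fx w(2)] 1 have "w = y" by simp
        then show "y \<in> Dk k (sc m)" using w by blast
      next
        assume "y \<in> Dk k (sc m)"
        then show "x \<in> Dk (sc k) m" using DS[OF m k] fx 1 by blast
      qed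
      have "x \<in> C m \<longleftrightarrow> y \<in> C (sc m)"
      proof
        assume "x \<in> C m"
        then have "y \<notin> Dk k (sc m)" if "k \<in> N" for k
          using nS[OF that] that succ_N[of k] unfolding C_def by auto
        then show "y \<in> C (sc m)" using 1 unfolding C_def by blast
      next
        assume y: "y \<in> C (sc m)"
        have "x \<notin> Dk k m" if "k \<in> N" for k
          using N_cases[OF that] n0 nS y unfolding C_def by blast
        then show "x \<in> C m" using xp unfolding C_def by blast
      qed
      then show ?thesis using 1 by auto
    next
      case (2 b)
      then have "x \<in> Dk z0 m" using D0[OF m] fx by blast
      then have "x \<notin> C m" unfolding C_def by auto
      then show ?thesis using 2 by auto
    qed
  qed
  have disj: "k = k'" if "k \<in> N" "m \<in> N" "k' \<in> N" "x \<in> Dk k m" "x \<in> Dk k' m" for k k' m x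
  proof -
    have "\<forall>m\<in>N. \<forall>k'\<in>N. \<forall>x. x \<in> Dk k m \<longrightarrow> x \<in> Dk k' m \<longrightarrow> k = k'"
    proof (rule N_induct[OF that(1)])
      show "D (\<lambda>s. \<forall>m\<in>N. \<forall>k'\<in>N. \<forall>x. x \<in> Dk (s 0) m \<longrightarrow> x \<in> Dk k' m \<longrightarrow> s 0 = k')" by (intro Dr DkD)
      show "\<forall>m\<in>N. \<forall>k'\<in>N. \<forall>x. x \<in> Dk z0 m \<longrightarrow> x \<in> Dk k' m \<longrightarrow> z0 = k'"
      proof (intro ballI allI impI)
        fix m k' x assume h: "m \<in> N" "k' \<in> N" "x \<in> Dk z0 m" "x \<in> Dk k' m"
        from N_cases[OF h(2)] show "z0 = k'" using excl[OF h(1)] h(3,4) by blast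
      qed
      fix k assume k: "k \<in> N" and IH: "\<forall>m\<in>N. \<forall>k'\<in>N. \<forall>x. x \<in> Dk k m \<longrightarrow> x \<in> Dk k' m \<longrightarrow> k = k'"
      show "\<forall>m\<in>N. \<forall>k'\<in>N. \<forall>x. x \<in> Dk (sc k) m \<longrightarrow> x \<in> Dk k' m \<longrightarrow> sc k = k'"
      proof (intro ballI allI impI)
        fix m k' x assume h: "m \<in> N" "k' \<in> N" "x \<in> Dk (sc k) m" "x \<in> Dk k' m"
        then obtain y where y: "y \<in> Dk k (sc m)" "f m x \<langle>y, z0\<rangle>" using DS[OF h(1) k] by blast
        from N_cases[OF h(2)] show "sc k = k'"
        proof
          assume "k' = z0"
          then show ?thesis using excl[OF h(1) k] h(3,4) by blast
        next
          assume "\<exists>j\<in>N. k' = sc j"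
          then obtain j where j: "j \<in> N" "k' = sc j" by blast
          then obtain y' where y': "y' \<in> Dk j (sc m)" "f m x \<langle>y', z0\<rangle>" using DS[OF h(1)] h(4) by blast
          then have "y' = y" using fv[OF h(1) y(2) y'(2)] by simp
          moreover have "sc m \<in> N" using h(1) by simp
          ultimately show ?thesis using IH j y(1) y'(1) by blast
        qed
      qed
    qed
    then show ?thesis using that by blast
  qed
  \<comment> \<open>Composing the maps \<open>f\<close> gives the lower bound without any
    error.\<close>
  have ge: "B (ad m k) \<preceq> Dk k m" if "k \<in> N" "m \<in> N" for k m
  proof -
    have "\<forall>m\<in>N. B (ad m k) \<preceq> Dk k m"
    proof (rule N_induct[OF that(1)])
      show "D (\<lambda>s. \<forall>m\<in>N. B (ad m (s 0)) \<preceq> Dk (s 0) m)"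
        by (intro Dr D_le_gen sB sD DkD fam_D[OF fB])
      show "\<forall>m\<in>N. B (ad m z0) \<preceq> Dk z0 m"
      proof
        fix m assume m: "m \<in> N"
        show "B (ad m z0) \<preceq> Dk z0 m"
        proof (rule leI[where R = "\<lambda>x b. f m x \<langle>b, z1\<rangle>"])
          show "D (\<lambda>s. f m (s 0) \<langle>s 1, z1\<rangle>)" by (intro Dr fD)
          show "y = z" if "f m x \<langle>y, z1\<rangle>" "f m x \<langle>z, z1\<rangle>" for x y z using fv[OF m that] by simp
          show "\<exists>x\<in>Dk z0 m. f m x \<langle>y, z1\<rangle>" if "y \<in> B (ad m z0)" for y
            using that surj_pairD(12)[OF pr[OF m], of "\<langle>y, z1\<rangle>"] D0[OF m] by auto
        qed (rule sD sB)+
      qed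
      fix k assume k: "k \<in> N" and IH: "\<forall>m\<in>N. B (ad m k) \<preceq> Dk k m"
      show "\<forall>m\<in>N. B (ad m (sc k)) \<preceq> Dk (sc k) m"
      proof
        fix m assume m: "m \<in> N"
        have "Dk k (sc m) \<preceq> Dk (sc k) m"
        proof (rule leI[where R = "\<lambda>x b. f m x \<langle>b, z0\<rangle>"])
          show "D (\<lambda>s. f m (s 0) \<langle>s 1, z0\<rangle>)" by (intro Dr fD)
          show "y = z" if "f m x \<langle>y, z0\<rangle>" "f m x \<langle>z, z0\<rangle>" for x y z using fv[OF m that] by simp
          show "\<exists>x\<in>Dk (sc k) m. f m x \<langle>y, z0\<rangle>" if "y \<in> Dk k (sc m)" for y
            using that surj_pairD(12)[OF pr[OF m], of "\<langle>y, z0\<rangle>"] DS[OF m k] unfolding Dk_def[of k] by auto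
        qed (rule sD sB)+
        moreover have "B (ad (sc m) k) \<preceq> Dk k (sc m)" using IH m by auto
        ultimately show "B (ad m (sc k)) \<preceq> Dk (sc k) m"
          using le_trans[OF sD sB] k by (simp add: ad_succ ad_succ_left)
      qed
    qed
    then show ?thesis using that(2) by blast
  qed
  \<comment> \<open>The upper bound picks up an error at each step. The induction covers all
    \<open>m\<close> at once, because the step at \<open>m\<close> uses the bound at
    \<open>sc m\<close>; the errors are coded as elements so that they can be quantified in a
    formula.\<close>
  have le: "\<exists>j. absorbs (A m) (ext j) \<and> Dk k m \<preceq> B (ad m k) \<oplus> ext j" if "k \<in> N" "m \<in> N" for k m
  proof -
    have "\<forall>m\<in>N. \<exists>j. absorbs (A m) (ext j) \<and> Dk k m \<preceq> B (ad m k) \<oplus> ext j"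
    proof (rule N_induct[OF that(1)])
      show "D (\<lambda>s. \<forall>m\<in>N. \<exists>j. absorbs (A m) (ext j) \<and> Dk (s 0) m \<preceq> B (ad m (s 0)) \<oplus> ext j)"
        unfolding absorbs_def
        by (intro Dr D_le_gen sA sB sD DkD fam_D[OF fB] fam_D[OF fA] small_plus small_ext)
      show "\<forall>m\<in>N. \<exists>j. absorbs (A m) (ext j) \<and> Dk z0 m \<preceq> B (ad m z0) \<oplus> ext j"
      proof
        fix m assume m: "m \<in> N"
        have TA: "tag z1 ` B m \<subseteq> A (sc m) \<oplus> B m" by (auto simp: tag_def)
        have XT: "x \<in> Dk z0 m \<longleftrightarrow> p \<in> tag z1 ` B m" if h: "f m x p" for x p
        proof
          assume "x \<in> Dk z0 m"
          then obtain b where b: "f m x \<langle>b, z1\<rangle>" using D0[OF m] by blast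
          then have "b \<in> B m" using surj_pairD(10)[OF pr[OF m] b] by simp
          then show "p \<in> tag z1 ` B m" using fv[OF m h b] unfolding tag_Collect by blast
        next
          assume "p \<in> tag z1 ` B m"
          then show "x \<in> Dk z0 m" using D0[OF m] h unfolding tag_Collect by blast
        qed
        have DA: "Dk z0 m \<subseteq> A m" by (auto simp: Dk_def)
        from class_le[OF m sD DA small_tag[OF sB] TA XT]
        obtain J where J: "small J" "absorbs (A m) J" "Dk z0 m \<preceq> tag z1 ` B m \<oplus> J" by blast
        then have "Dk z0 m \<preceq> B m \<oplus> J"
          using le_cong[of "Dk z0 m" "tag z1 ` B m \<oplus> J" "Dk z0 m" "B m \<oplus> J"] sD sB small_tag[OF sB] q_tag[OF sB] J(1)
          by (simp add: q_plus)
        then show "\<exists>j. absorbs (A m) (ext j) \<and> Dk z0 m \<preceq> B (ad m z0) \<oplus> ext j"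
          using J by (intro exI[of _ "coll J"]) (simp add: ext_coll)
      qed
      fix k assume k: "k \<in> N" and IH: "\<forall>m\<in>N. \<exists>j. absorbs (A m) (ext j) \<and> Dk k m \<preceq> B (ad m k) \<oplus> ext j"
      show "\<forall>m\<in>N. \<exists>j. absorbs (A m) (ext j) \<and> Dk (sc k) m \<preceq> B (ad m (sc k)) \<oplus> ext j"
      proof
        fix m assume m: "m \<in> N"
        then obtain j where j: "absorbs (A (sc m)) (ext j)" "Dk k (sc m) \<preceq> B (ad (sc m) k) \<oplus> ext j"
          using IH by (metis ext_iff succ_N)
        have XT: "x \<in> Dk (sc k) m \<longleftrightarrow> (\<exists>y\<in>Dk k (sc m). p = \<langle>y, z0\<rangle>)" if h: "f m x p" for x p
          unfolding DS[OF m k] using h fv[OF m h] by blast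
        have DA: "Dk k (sc m) \<subseteq> A (sc m)" "Dk (sc k) m \<subseteq> A m" by (auto simp: Dk_def)
        from class_le_tag[OF m sD DA(2) sD DA(1) XT]
        obtain J where J: "small J" "absorbs (A m) J" "Dk (sc k) m \<preceq> Dk k (sc m) \<oplus> J" by blast
        let ?b = "B (ad m (sc k))"
        have "Dk k (sc m) \<oplus> J \<preceq> (?b \<oplus> ext j) \<oplus> J"
          using j(2) k J(1) sD sB by (intro plus_mono le_refl) (auto simp: ad_succ ad_succ_left)
        then have "Dk (sc k) m \<preceq> (?b \<oplus> ext j) \<oplus> J"
          using le_trans[OF _ sD J(3)] J(1) sB by simp
        moreover have "(?b \<oplus> ext j) \<oplus> J \<preceq> ?b \<oplus> (ext j \<oplus> J)" using plus_assoc_le J(1) sB by simp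
        ultimately have "Dk (sc k) m \<preceq> ?b \<oplus> (ext j \<oplus> J)"
          using le_trans[OF _ sD] J(1) sB by simp
        moreover have "absorbs (A m) (ext j \<oplus> J)"
          using absorbs_plus2[OF sA J(1)] absorbs_pred[OF m] j(1) J(2) by simp
        ultimately show "\<exists>j. absorbs (A m) (ext j) \<and> Dk (sc k) m \<preceq> ?b \<oplus> ext j"
          using J(1) by (intro exI[of _ "coll (ext j \<oplus> J)"]) (simp add: ext_coll)
      qed
    qed
    then show ?thesis using that(2) by blast
  qed
  let ?s = "\<lambda>m. SG (\<lambda>n. B (ad m n))"
  have ss: "small (?s m)" for m by (rule small_SG[OF fam_shift[OF fB]])
  have ex_K: "\<exists>K. small K \<and> absorbs (A m) K \<and> q (A m) = q (C m) \<uplus> q (?s m) \<uplus> q K" if m: "m \<in> N" for m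
  proof -
    have "A m = C m \<union> (\<Union>k\<in>N. Dk k m)" by (auto simp: C_def Dk_def)
    moreover have "C m \<inter> (\<Union>k\<in>N. Dk k m) = {}" by (auto simp: C_def)
    ultimately have "q (A m) = q (C m) \<uplus> q (\<Union>k\<in>N. Dk k m)"
      using q_Un sC small_UN_fam[OF famD] by metis
    moreover have "(\<Union>k\<in>N. Dk k m) \<approx> SG (\<lambda>k. Dk k m)"
      using disjoint_UN_eqv_SG[OF famD] disj[OF _ m] by blast
    then have "q (\<Union>k\<in>N. Dk k m) = q (SG (\<lambda>k. Dk k m))"
      using q_eq[OF small_UN_fam[OF famD] small_SG[OF famD]] by blast
    ultimately have qD: "q (A m) = q (C m \<oplus> SG (\<lambda>k. Dk k m))"
      using sC small_SG[OF famD] by (simp add: q_plus)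
    have "D (\<lambda>s. absorbs (A m) (ext (s 1)) \<and> Dk (s 0) m \<preceq> B (ad m (s 0)) \<oplus> ext (s 1))"
      unfolding absorbs_def
      by (intro Dr D_le_gen sA sB sD DkD fam_D[OF fB] fam_D[OF fA] small_plus small_ext)
    \<comment> \<open>One error for each \<open>k\<close> is selected, so that their countable sum
      is again absorbed by \<open>A m\<close>.\<close>
    from choice[of "\<lambda>k j. absorbs (A m) (ext j) \<and> Dk k m \<preceq> B (ad m k) \<oplus> ext j", OF AC this le[OF _ m]]
    obtain j where j: "Dt (\<lambda>s. j (s 0))" "\<And>k. k \<in> N \<Longrightarrow> absorbs (A m) (ext (j k))"
      "\<And>k. k \<in> N \<Longrightarrow> Dk k m \<preceq> B (ad m k) \<oplus> ext (j k)" by blast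
    note fj = fam_ext[OF j(1)]
    let ?K = "SG (\<lambda>k. ext (j k))"
    have sK: "small ?K" by (rule small_SG[OF fj])
    have aK: "absorbs (A m) ?K" by (rule absorbs_SG[OF sA fj j(2)])
    have "SG (\<lambda>k. Dk k m) \<preceq> SG (\<lambda>k. B (ad m k) \<oplus> ext (j k))"
      by (rule SG_mono[OF famD fam_plus[OF fam_shift[OF fB] fj] j(3)])
    moreover have "SG (\<lambda>k. B (ad m k) \<oplus> ext (j k)) \<preceq> ?s m \<oplus> ?K"
      using SG_plus[OF fam_shift[OF fB] fj] by (simp add: eqv_def)
    ultimately have "SG (\<lambda>k. Dk k m) \<preceq> ?s m \<oplus> ?K"
      using le_trans[OF small_plus[OF ss sK] small_SG[OF famD]] by blast
    then have "C m \<oplus> SG (\<lambda>k. Dk k m) \<preceq> C m \<oplus> (?s m \<oplus> ?K)"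
      by (intro plus_mono le_refl sC small_SG[OF famD] small_plus ss sK)
    then have 1: "A m \<preceq> C m \<oplus> (?s m \<oplus> ?K)"
      by (rule le_cong[rotated -1]) (use qD sA sC ss sK small_SG[OF famD] in auto)
    \<comment> \<open>For the converse, \<open>?K\<close> is added on both sides and then swallowed
      by \<open>A m\<close>.\<close>
    have "?s m \<preceq> SG (\<lambda>k. Dk k m)" by (rule SG_mono[OF fam_shift[OF fB] famD ge[OF _ m]])
    then have "(C m \<oplus> ?s m) \<oplus> ?K \<preceq> (C m \<oplus> SG (\<lambda>k. Dk k m)) \<oplus> ?K"
      by (intro plus_mono le_refl sC small_SG[OF famD] small_plus ss sK)
    then have "C m \<oplus> (?s m \<oplus> ?K) \<preceq> A m"
      by (rule le_cong[rotated -1])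
        (use qD sA sC ss sK small_SG[OF famD] aK in \<open>auto simp: q_plus padd_assoc absorbs_iff\<close>)
    then have "q (A m) = q (C m \<oplus> (?s m \<oplus> ?K))" using 1 sA sC ss sK q_eq by (simp add: eqv_def)
    then show ?thesis using sK aK sC ss by (auto simp: q_plus)
  qed
  \<comment> \<open>Closing the removed part \<open>V\<close> under preimages along \<open>f\<close> makes \<open>E m = C m - V m\<close> increasing in \<open>m\<close>.\<close>
  let ?M = "\<lambda>m x. x \<in> minimal (R m) (C m)"
  have MD: "D (\<lambda>s. ?M (t s) (u s))" if "Dt t" "Dt u" for t u
    by (rule D_app2[of ?M, OF _ that]) (unfold minimal_def, intro Dr CD RD reachRD)
  \<comment> \<open>The first disjunct adds the descendants at the same index, needed for
    \<open>class_eqv\<close>; the second adds the preimages from the next index.\<close>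
  let ?St = "\<lambda>u m x. (\<exists>v. \<langle>v, m\<rangle> \<epsilon> u \<and> R m v x) \<or> (\<exists>y. \<langle>y, sc m\<rangle> \<epsilon> u \<and> f m x \<langle>y, z0\<rangle>)"
  have M1: "D (\<lambda>s. ?M (s 0) (s 1))" by (intro MD Dr)
  have M2: "D (\<lambda>s. ?St (s 0) (s 1) (s 2))" by (intro Dr RD fD)
  from fam_rec[of A ?M ?St, OF fA M1 M2] obtain G where G1: "Dt (\<lambda>s. G (s 0))"
    and G2: "\<forall>m x. \<langle>x, m\<rangle> \<epsilon> G z0 \<longleftrightarrow> m \<in> N \<and> x \<in> A m \<and> ?M m x"
    and G3: "\<forall>k\<in>N. \<forall>m x. \<langle>x, m\<rangle> \<epsilon> G (sc k) \<longleftrightarrow> m \<in> N \<and> x \<in> A m \<and> ?St (G k) m x"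
    by (elim exE conjE) (rule that)
  note G = G1 G2[rule_format] G3[rule_format]
  define Vk where "Vk k m = {x \<in> A m. \<langle>x, m\<rangle> \<epsilon> G k}" for k m
  have VkD: "D (\<lambda>s. t s \<in> Vk (u s) (v s))" if "Dt t" "Dt u" "Dt v" for t u v
    unfolding Vk_def using that by (intro Dr fam_D[OF fA] Dt_app1[OF G(1)])
  have sVk: "small (Vk k m)" for k m
    unfolding Vk_def by (rule small_sep[OF sA]) (intro Dr)
  have famV: "fam (\<lambda>k. Vk k m)" for m by (rule famI) (auto intro: sVk VkD Dt_var Dt_const)
  have V0: "Vk z0 m = minimal (R m) (C m)" if "m \<in> N" for m
    using that CA[of m] unfolding Vk_def G(2) minimal_def by auto
  have VS: "x \<in> Vk (sc k) m \<longleftrightarrow> (\<exists>v\<in>Vk k m. R m v x) \<or> (\<exists>y\<in>Vk k (sc m). f m x \<langle>y, z0\<rangle>)"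
    if "m \<in> N" "k \<in> N" for m k x
    using that(1) G(3)[OF that(2)] surj_pairD(9,10)[OF pr[OF that(1)]] unfolding Vk_def by fastforce
  \<comment> \<open>An image under \<open>R m\<close> is no larger than the set it comes from, and a
    preimage under \<open>f m\<close> exceeds it only by an absorbed set, by
    \<open>class_le_tag\<close>.\<close>
  have aVk: "absorbs (A m) (Vk k m)" if "k \<in> N" "m \<in> N" for k m
  proof -
    have "\<forall>m\<in>N. absorbs (A m) (Vk k m)"
    proof (rule N_induct[OF that(1)])
      show "D (\<lambda>s. \<forall>m\<in>N. absorbs (A m) (Vk (s 0) m))" unfolding absorbs_def
        by (intro Dr D_le_gen sA sVk VkD fam_D[OF fA] small_plus)
      show "\<forall>m\<in>N. absorbs (A m) (Vk z0 m)"
        using V0 absorbs_minimal[OF pr sC CA] by simp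
      fix k assume k: "k \<in> N" and IH: "\<forall>m\<in>N. absorbs (A m) (Vk k m)"
      show "\<forall>m\<in>N. absorbs (A m) (Vk (sc k) m)"
      proof
        fix m assume m: "m \<in> N"
        note P = surj_pairD[OF pr[OF m]]
        define V1 where "V1 = {x \<in> A m. \<exists>v\<in>Vk k m. R m v x}"
        define V2 where "V2 = {x \<in> A m. \<exists>y\<in>Vk k (sc m). f m x \<langle>y, z0\<rangle>}"
        have s1: "small V1" unfolding V1_def by (rule small_sep[OF sA]) (intro Dr VkD RD)
        have s2: "small V2" unfolding V2_def by (rule small_sep[OF sA]) (intro Dr VkD fD)
        have "V1 \<preceq> Vk k m"
        proof (rule leI[where R = "R m"])
          show "D (\<lambda>s. R m (s 0) (s 1))" by (intro RD Dr)
        qed (use functionalD[OF P(7)] s1 sVk in \<open>auto simp: V1_def\<close>)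
        then have a1: "absorbs (A m) V1" using absorbs_mono[OF sA sVk s1] IH m by blast
        have XT: "x \<in> V2 \<longleftrightarrow> (\<exists>y\<in>Vk k (sc m). p = \<langle>y, z0\<rangle>)" if h: "f m x p" for x p
          using h fv[OF m h] P(10)[OF h] unfolding V2_def by blast
        have VA: "V2 \<subseteq> A m" "Vk k (sc m) \<subseteq> A (sc m)" by (auto simp: V2_def Vk_def)
        from class_le_tag[OF m s2 VA(1) sVk VA(2) XT]
        obtain J where J: "small J" "absorbs (A m) J" "V2 \<preceq> Vk k (sc m) \<oplus> J" by blast
        have "absorbs (A m) (Vk k (sc m))" using absorbs_pred[OF m sVk] IH m by auto
        then have "absorbs (A m) (Vk k (sc m) \<oplus> J)" using absorbs_plus2[OF sA J(1) sVk] J(2) by blast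
        then have a2: "absorbs (A m) V2" using absorbs_mono[OF sA _ s2 _ J(3)] J(1) sVk by simp
        have "absorbs (A m) (V1 \<union> V2)"
          using absorbs_mono[OF sA _ _ absorbs_plus2[OF sA s2 s1 a1 a2] Un_le_plus[OF s1 s2]]
            small_Un s1 s2 by simp
        moreover have "Vk (sc k) m = V1 \<union> V2"
          using VS[OF m k] unfolding V1_def V2_def Vk_def[of "sc k"] by blast
        ultimately show "absorbs (A m) (Vk (sc k) m)" by simp
      qed
    qed
    then show ?thesis using that(2) by blast
  qed
  define V where "V m = {x \<in> C m. \<exists>k\<in>N. x \<in> Vk k m}" for m
  have VD: "D (\<lambda>s. t s \<in> V (v s))" if "Dt t" "Dt v" for t v
    by (rule D_app2[of "\<lambda>x m. x \<in> V m", OF _ that]) (unfold V_def, intro Dr CD VkD)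
  have famVV: "fam V"
    by (rule fam_subset[OF famC _ VD[OF Dt_var Dt_var]]) (auto simp: V_def)
  note sV = fam_small[OF famVV]
  have VC: "V m \<subseteq> C m" for m by (auto simp: V_def)
  have aV: "absorbs (A m) (V m)" if "m \<in> N" for m
  proof (rule absorbs_subset[OF sA small_UN_fam[OF famV] sV absorbs_UN[OF sA famV aVk[OF _ that]]])
    show "V m \<subseteq> (\<Union>k\<in>N. Vk k m)" unfolding V_def by blast
  qed
  have Vmin: "minimal (R m) (C m) \<subseteq> V m" if "m \<in> N" for m
  proof
    fix x assume x: "x \<in> minimal (R m) (C m)"
    then have "x \<in> C m" "x \<in> Vk z0 m" using V0[OF that] by (auto simp: minimal_def)
    then show "x \<in> V m" by (auto simp: V_def intro!: bexI[of _ z0])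
  qed
  have Vreach: "x \<in> V m" if m: "m \<in> N" and v: "v \<in> V m" and r: "reach (R m) v x" and x: "x \<in> C m" for m v x
  proof -
    have "\<exists>k\<in>N. x \<in> Vk k m"
    proof (rule reach_induct[of "R m" v x "\<lambda>x. \<exists>k\<in>N. x \<in> Vk k m", OF r surj_pairD(6)[OF pr[OF m]]])
      show "D (\<lambda>s. \<exists>k\<in>N. s 0 \<in> Vk k m)" by (intro Dr VkD)
      show "\<exists>k\<in>N. v \<in> Vk k m" using v unfolding V_def by blast
      fix a b assume "\<exists>k\<in>N. a \<in> Vk k m" "R m a b"
      then obtain k where "k \<in> N" "b \<in> Vk (sc k) m" using VS[OF m] by blast
      then show "\<exists>k\<in>N. b \<in> Vk k m" by (intro bexI[of _ "sc k"]) auto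
    qed
    then show ?thesis using x unfolding V_def by blast
  qed
  have Vpre: "x \<in> V m" if m: "m \<in> N" and y: "y \<in> V (sc m)" and fx: "f m x \<langle>y, z0\<rangle>" for m x y
  proof -
    have "x \<in> C m" using Cf[OF m fx] y VC by blast
    moreover obtain k where "k \<in> N" "x \<in> Vk (sc k) m" using y VS[OF m] fx unfolding V_def by blast
    ultimately show ?thesis unfolding V_def using succ_N by (auto intro!: bexI[of _ "sc k"])
  qed
  define E where "E m = C m - V m" for m
  have sE: "small (E m)" for m unfolding E_def by (intro small_Diff sC sV)
  \<comment> \<open>The increment of the chain: points surviving at \<open>sc m\<close> although
    some preimage was removed at \<open>m\<close>.\<close>
  define T where "T m = {y \<in> E (sc m). \<exists>v\<in>V m. f m v \<langle>y, z0\<rangle>}" for m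
  have famT: "fam T"
  proof (rule famI)
    show "small (T m)" for m
      unfolding T_def by (rule small_sep[OF sE]) (intro Dr VD fD)
    show "D (\<lambda>s. s 1 \<in> T (s 0))" unfolding T_def E_def by (intro Dr CD VD fD)
  qed
  note sT = fam_small[OF famT]
  have aT: "absorbs (A m) (T m)" if m: "m \<in> N" for m
  proof -
    have "T m \<preceq> V m"
    proof (rule leI[where R = "\<lambda>v y. f m v \<langle>y, z0\<rangle>"])
      show "D (\<lambda>s. f m (s 0) \<langle>s 1, z0\<rangle>)" by (intro Dr fD)
      show "y = z" if "f m x \<langle>y, z0\<rangle>" "f m x \<langle>z, z0\<rangle>" for x y z using fv[OF m that] by simp
    qed (use sT sV in \<open>auto simp: T_def\<close>)
    then show ?thesis using absorbs_mono[OF sA sV sT aV[OF m]] by blast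
  qed
  have qE: "q (E (sc m)) = q (E m) \<uplus> q (T m)" if m: "m \<in> N" for m
  proof -
    let ?T = "E (sc m) - T m"
    have sub: "tag z0 ` C (sc m) \<subseteq> A (sc m) \<oplus> B m" using CA[of "sc m"] by (auto simp: tag_def)
    have "E m \<approx> tag z0 ` C (sc m) - {t. \<exists>v\<in>V m. f m v t}"
      unfolding E_def
      by (rule class_eqv[OF pr[OF m] sC CA small_tag[OF sC] sub _ sV VC Vmin[OF m] Vreach[OF m]])
        (use Cf[OF m] in \<open>auto simp: tag_Collect\<close>)
    moreover have "tag z0 ` C (sc m) - {t. \<exists>v\<in>V m. f m v t} = tag z0 ` ?T"
    proof -
      \<comment> \<open>Since \<open>V\<close> is closed under preimages and \<open>f m\<close> is
        onto, every point of \<open>V (sc m)\<close> has a preimage in \<open>V m\<close>; deleting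
        the image of \<open>V m\<close> thus deletes all of \<open>V (sc m)\<close>.\<close>
      have "y \<in> E (sc m)" if y: "y \<in> C (sc m)" "\<not> (\<exists>v\<in>V m. f m v \<langle>y, z0\<rangle>)" for y
      proof -
        have "\<langle>y, z0\<rangle> \<in> A (sc m) \<oplus> B m" using y(1) CA by auto
        then obtain x where "f m x \<langle>y, z0\<rangle>" using surj_pairD(12)[OF pr[OF m]] by blast
        then show ?thesis using y Vpre[OF m] unfolding E_def by blast
      qed
      then show ?thesis unfolding T_def E_def tag_Collect by blast
    qed
    ultimately have "q (E m) = q ?T"
      using q_tag[of ?T z0] small_tag[of ?T z0] small_Diff[OF sE sT] sE by (simp flip: q_eq)
    moreover have "q (E (sc m)) = q (T m) \<uplus> q ?T"
      using q_partition[OF sE sT _ small_Diff[OF sE sT]] unfolding T_def by blast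
    ultimately show ?thesis by (simp add: padd_commute)
  qed
  have sTT: "small (SG (\<lambda>n. T (ad m n)))" for m by (rule small_SG[OF fam_shift[OF famT]])
  \<comment> \<open>Up to equivalence, the limit of the chain is its first term together with all
    increments; the same set arises from any later starting index.\<close>
  define c where "c = E z0 \<oplus> SG T"
  have sc: "small c" unfolding c_def by (intro small_plus sE small_SG famT)
  have qc: "q c = q (E m) \<uplus> q (SG (\<lambda>n. T (ad m n)))" if "m \<in> N" for m
  proof -
    have "c \<preceq> E m \<oplus> SG (\<lambda>n. T (ad m n)) \<and> E m \<oplus> SG (\<lambda>n. T (ad m n)) \<preceq> c"
    proof (rule N_induct[OF that])
      show "D (\<lambda>s. c \<preceq> E (s 0) \<oplus> SG (\<lambda>n. T (ad (s 0) n)) \<and> E (s 0) \<oplus> SG (\<lambda>n. T (ad (s 0) n)) \<preceq> c)"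
        unfolding E_def
        by (intro Dr D_le_gen sc sTT small_plus small_Diff sC sV fam_D[OF famT] CD VD D_small[OF sc])
      have "SG (\<lambda>n. T (ad z0 n)) = SG T" by (rule SG_cong_set) (simp add: ad_zero_left)
      then show "c \<preceq> E z0 \<oplus> SG (\<lambda>n. T (ad z0 n)) \<and> E z0 \<oplus> SG (\<lambda>n. T (ad z0 n)) \<preceq> c"
        using le_refl[OF sc] unfolding c_def by simp
      fix m assume m: "m \<in> N"
        and IH: "c \<preceq> E m \<oplus> SG (\<lambda>n. T (ad m n)) \<and> E m \<oplus> SG (\<lambda>n. T (ad m n)) \<preceq> c"
      have "SG (\<lambda>n. T (ad m (sc n))) = SG (\<lambda>n. T (ad (sc m) n))"
        by (rule SG_cong_set) (simp add: ad_succ ad_succ_left)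
      then have "q (SG (\<lambda>n. T (ad m n))) = q (T m) \<uplus> q (SG (\<lambda>n. T (ad (sc m) n)))"
        using SG_split[OF fam_shift[OF famT], of m] sT sTT by (simp add: q_plus flip: q_eq)
      moreover have "q c = q (E m) \<uplus> q (SG (\<lambda>n. T (ad m n)))"
        using IH sc sE sTT by (simp add: eqv_def flip: q_eq q_plus) (simp add: q_eq eqv_def)
      ultimately have "q c = q (E (sc m) \<oplus> SG (\<lambda>n. T (ad (sc m) n)))"
        using qE[OF m] sE sTT by (simp add: q_plus padd_assoc)
      then show "c \<preceq> E (sc m) \<oplus> SG (\<lambda>n. T (ad (sc m) n)) \<and> E (sc m) \<oplus> SG (\<lambda>n. T (ad (sc m) n)) \<preceq> c"
        using sc sE sTT by (simp add: q_eq eqv_def)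
    qed
    then have "q c = q (E m \<oplus> SG (\<lambda>n. T (ad m n)))" using sc sE sTT q_eq by (simp add: eqv_def)
    then show ?thesis using sE sTT by (simp add: q_plus)
  qed
  show ?thesis
  proof (rule exI[of _ c], rule conjI[OF sc], rule ballI)
    fix m assume m: "m \<in> N"
    obtain K where K: "small K" "absorbs (A m) K" "q (A m) = q (C m) \<uplus> q (?s m) \<uplus> q K"
      using ex_K[OF m] by blast
    \<comment> \<open>Increments at later indices are absorbed there and hence at \<open>m\<close>.
      Adding them to \<open>A m\<close> costs nothing and completes \<open>E m\<close> to
      \<open>c\<close>.\<close>
    have "absorbs (A m) (T (ad m n))" if "n \<in> N" for n
      using absorbs_ad[OF that m sT aT] m that by simp
    then have "absorbs (A m) (SG (\<lambda>n. T (ad m n)))" by (rule absorbs_SG[OF sA fam_shift[OF famT]])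
    then have "q (A m) = q (A m) \<uplus> q (SG (\<lambda>n. T (ad m n)))" using sA sTT by (simp add: absorbs_iff)
    moreover have "q (A m) = q (E m) \<uplus> q (V m) \<uplus> q (?s m) \<uplus> q K"
      unfolding K(3) using q_partition[OF sC sV VC small_Diff[OF sC sV], of m]
      unfolding E_def by (simp add: padd_ac)
    ultimately have "q (A m) = (q (E m) \<uplus> q (V m) \<uplus> q (?s m) \<uplus> q K) \<uplus> q (SG (\<lambda>n. T (ad m n)))"
      by metis
    then have "q (A m) = q ((c \<oplus> ?s m) \<oplus> (V m \<oplus> K))"
      using qc[OF m] sc ss sV K(1) by (simp add: q_plus padd_ac)
    then have "A m \<approx> (c \<oplus> ?s m) \<oplus> (V m \<oplus> K)" using q_eq sA sc ss sV K(1) by simp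
    moreover have "absorbs (A m) (V m \<oplus> K)" using absorbs_plus2[OF sA K(1) sV aV[OF m] K(2)] .
    ultimately show "\<exists>K. small K \<and> absorbs (A m) K \<and> A m \<approx> (c \<oplus> ?s m) \<oplus> K"
      using sV K(1) small_plus by blast
  qed
qed

text \<open>The errors must be replaced by one set that every term absorbs. An error from a later
  index also serves at \<open>j\<close>; comparing \<open>K j\<close> with all of these leaves a
  core that is absorbed everywhere, and the cores for all \<open>j\<close> together are added to
  \<open>c\<close>.\<close>

theorem remainder_pairs: "\<exists>c. small c \<and> (\<forall>m\<in>N. A m \<approx> c \<oplus> SG (\<lambda>n. B (ad m n)))"
proof -
  let ?s = "\<lambda>m. SG (\<lambda>n. B (ad m n))"
  have ss: "small (?s m)" for m by (rule small_SG[OF fam_shift[OF fB]])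
  obtain c where c: "small c"
    "\<And>m. m \<in> N \<Longrightarrow> \<exists>K. small K \<and> absorbs (A m) K \<and> A m \<approx> (c \<oplus> ?s m) \<oplus> K"
    using remainder_mod by blast
  note Ds = D_le_gen small_plus small_ext ss sA sB c(1) fam_D[OF fA] fam_D[OF fB] D_small[OF c(1)]
  have "D (\<lambda>s. absorbs (A (s 0)) (ext (s 1)) \<and> A (s 0) \<approx> (c \<oplus> ?s (s 0)) \<oplus> ext (s 1))"
    unfolding absorbs_def eqv_def by (intro Dr Ds)
  moreover have "\<exists>K. absorbs (A m) (ext K) \<and> A m \<approx> (c \<oplus> ?s m) \<oplus> ext K" if m: "m \<in> N" for m
    using c(2)[OF m] ext_coll by metis
  ultimately obtain K where K: "Dt (\<lambda>s. K (s 0))" "\<And>m. m \<in> N \<Longrightarrow> absorbs (A m) (ext (K m))"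
    "\<And>m. m \<in> N \<Longrightarrow> A m \<approx> (c \<oplus> ?s m) \<oplus> ext (K m)"
    using choice[of "\<lambda>m K. absorbs (A m) (ext K) \<and> A m \<approx> (c \<oplus> ?s m) \<oplus> ext K", OF AC] by blast
  have qs: "q (?s m) = q (B m) \<uplus> q (?s (sc m))" for m
  proof -
    have "SG (\<lambda>n. B (ad m (sc n))) = ?s (sc m)"
      by (rule SG_cong_set) (simp add: ad_succ ad_succ_left)
    then have "?s m \<approx> B m \<oplus> ?s (sc m)" using SG_split[OF fam_shift[OF fB], of m] by simp
    then show ?thesis using q_eq[of "?s m" "B m \<oplus> ?s (sc m)"] ss sB by (simp add: q_plus)
  qed
  \<comment> \<open>Adding \<open>B j\<close> to the equation at \<open>sc j\<close> gives the
    equation at \<open>j\<close> with the same error, so errors travel down the indices.\<close>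
  have shift: "A j \<approx> (c \<oplus> ?s j) \<oplus> ext (K (ad j i))" if "i \<in> N" "j \<in> N" for i j
  proof -
    have "\<forall>j\<in>N. A j \<approx> (c \<oplus> ?s j) \<oplus> ext (K (ad j i))"
    proof (rule N_induct[OF that(1)])
      show "D (\<lambda>s. \<forall>j\<in>N. A j \<approx> (c \<oplus> ?s j) \<oplus> ext (K (ad j (s 0))))"
        unfolding eqv_def by (intro Dr Ds Dt_app1[OF K(1)])
      show "\<forall>j\<in>N. A j \<approx> (c \<oplus> ?s j) \<oplus> ext (K (ad j z0))" using K(3) by simp
      fix i assume i: "i \<in> N" and IH: "\<forall>j\<in>N. A j \<approx> (c \<oplus> ?s j) \<oplus> ext (K (ad j i))"
      show "\<forall>j\<in>N. A j \<approx> (c \<oplus> ?s j) \<oplus> ext (K (ad j (sc i)))"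
      proof
        fix j assume j: "j \<in> N"
        let ?K = "ext (K (ad j (sc i)))"
        have "A (sc j) \<approx> (c \<oplus> ?s (sc j)) \<oplus> ?K"
          using IH[rule_format, of "sc j"] j i by (simp add: ad_succ ad_succ_left)
        then have "q (A (sc j)) = (q c \<uplus> q (?s (sc j))) \<uplus> q ?K"
          using q_eq[of "A (sc j)" "(c \<oplus> ?s (sc j)) \<oplus> ?K"] sA ss c(1) by (simp add: q_plus)
        then have "q (A j) = (q c \<uplus> q (?s j)) \<uplus> q ?K" using qA[OF j] qs[of j] by (simp add: padd_ac)
        then show "A j \<approx> (c \<oplus> ?s j) \<oplus> ?K"
          using q_eq[of "A j" "(c \<oplus> ?s j) \<oplus> ?K"] sA ss c(1) by (simp add: q_plus)
      qed
    qed
    then show ?thesis using that(2) by blast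
  qed
  have kappa: "\<exists>u. (\<forall>n\<in>N. absorbs (A n) (ext u)) \<and> A j \<approx> (c \<oplus> ?s j) \<oplus> ext u" if j: "j \<in> N" for j
  proof -
    let ?C = "c \<oplus> ?s j" and ?K = "ext (K j)"
    have sC: "small ?C" using c(1) ss by simp
    let ?P = "\<lambda>i x. ext x \<subseteq> ?K \<and> absorbs ?C (?K - ext x) \<and> absorbs (ext (K (ad j i))) (ext x)"
    have "D (\<lambda>s. ?P (s 0) (s 1))" unfolding absorbs_def
      by (intro Dr D_le_gen small_plus small_ext sC small_Diff D_small[OF sC] Dt_app1[OF K(1)]
          D_small[OF c(1)] fam_D[OF fB] c(1) ss)
    moreover have "\<exists>x. ?P i x" if i: "i \<in> N" for i
    proof -
      let ?L = "ext (K (ad j i))"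
      \<comment> \<open>\<open>A j\<close> absorbs \<open>K j\<close> and is equivalent to the sum
        of \<open>?C\<close> and the later error, so each point of \<open>K j\<close> can be charged
        to one of these two.\<close>
      have "q (A j) = q (?C \<oplus> ?L)"
        using shift[OF i j] q_eq[of "A j" "?C \<oplus> ?L"] sA sC by simp
      then have "absorbs (?C \<oplus> ?L) ?K"
        using absorbs_cong[OF sA _ small_ext _ K(2)[OF j]] sC by simp
      then obtain Y1 Y2 where Y: "small Y1" "small Y2" "Y1 \<union> Y2 = ?K" "Y1 \<inter> Y2 = {}"
        "absorbs ?C Y1" "absorbs ?L Y2"
        using absorbs_split[OF sC small_ext small_ext] by blast
      then have "?K - Y2 = Y1" by blast
      then show ?thesis using Y by (intro exI[of _ "coll Y2"]) (auto simp: ext_coll)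
    qed
    ultimately obtain Q where Q: "Dt (\<lambda>s. Q (s 0))" "\<And>i. i \<in> N \<Longrightarrow> ?P i (Q i)"
      using choice[of ?P, OF AC] by blast
    \<comment> \<open>\<open>K j\<close> may depend on \<open>j\<close>, but \<open>k\<close> is absorbed by every \<open>A n\<close> since it lies below all \<open>K (j + i)\<close>.\<close>
    define k where "k = {y \<in> ?K. \<forall>i\<in>N. y \<in> ext (Q i)}"
    have sk: "small k" unfolding k_def
      by (rule small_sep[OF small_ext]) (intro Dr Dt_app1[OF Q(1)])
    have sd: "small (?K - k)" by (intro small_Diff small_ext sk)
    have fQ: "fam (\<lambda>i. ?K - ext (Q i))"
      by (rule famI) (auto intro!: small_Diff Dr Dt_app1[OF Q(1)])
    have "absorbs ?C (\<Union>i\<in>N. ?K - ext (Q i))"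
      by (rule absorbs_UN[OF sC fQ]) (use Q(2) in blast)
    moreover have "?K - k \<subseteq> (\<Union>i\<in>N. ?K - ext (Q i))" unfolding k_def by blast
    ultimately have "absorbs ?C (?K - k)"
      using absorbs_subset[OF sC small_UN_fam[OF fQ] sd] by blast
    then have aC: "q ?C \<uplus> q (?K - k) = q ?C" using absorbs_iff[OF sC sd] by blast
    have "k \<subseteq> ?K" unfolding k_def by blast
    from q_partition[OF small_ext sk this sd] have "q (A j) = q ?C \<uplus> q k"
      using K(3)[OF j] q_eq[of "A j" "?C \<oplus> ?K"] sA sC aC by (simp add: q_plus) (metis padd_ac)
    then have e: "A j \<approx> ?C \<oplus> k" using q_eq[of "A j" "?C \<oplus> k"] sA sC sk by (simp add: q_plus)
    have a: "absorbs (A (ad j i)) k" if i: "i \<in> N" for i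
    proof -
      let ?L = "ext (K (ad j i))"
      have "absorbs ?L (ext (Q i))" using Q(2)[OF i] by blast
      then have "absorbs ?L k" using absorbs_subset[OF small_ext small_ext sk] i unfolding k_def by blast
      then have "k \<preceq> ?L" using absorbs_le[OF small_ext sk] by blast
      moreover have "absorbs (A (ad j i)) ?L" using K(2) i j by simp
      ultimately show ?thesis using absorbs_mono[OF sA small_ext sk] by blast
    qed
    \<comment> \<open>Indices beyond \<open>j\<close> are covered directly; for earlier ones,
      absorption at \<open>j\<close> itself, the case \<open>z0\<close>, is passed down.\<close>
    have "absorbs (A n) k" if n: "n \<in> N" for n
      using ad_total[OF n j] a absorbs_ad[OF _ n sk] a[of z0] by auto
    then show ?thesis using e sk by (intro exI[of _ "coll k"]) (simp add: ext_coll)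
  qed
  have "D (\<lambda>s. (\<forall>n\<in>N. absorbs (A n) (ext (s 1))) \<and> A (s 0) \<approx> (c \<oplus> ?s (s 0)) \<oplus> ext (s 1))"
    unfolding absorbs_def eqv_def by (intro Dr Ds)
  from choice[of "\<lambda>j u. (\<forall>n\<in>N. absorbs (A n) (ext u)) \<and> A j \<approx> (c \<oplus> ?s j) \<oplus> ext u", OF AC this kappa]
  obtain k where k: "Dt (\<lambda>s. k (s 0))" "\<And>j n. j \<in> N \<Longrightarrow> n \<in> N \<Longrightarrow> absorbs (A n) (ext (k j))"
    "\<And>j. j \<in> N \<Longrightarrow> A j \<approx> (c \<oplus> ?s j) \<oplus> ext (k j)" by blast
  note fk = fam_ext[OF k(1)]
  let ?k = "SG (\<lambda>j. ext (k j))"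
  have sk: "small ?k" by (rule small_SG[OF fk])
  have "A m \<approx> (c \<oplus> ?k) \<oplus> ?s m" if m: "m \<in> N" for m
  proof -
    have "absorbs (A m) ?k" by (rule absorbs_SG[OF sA fk k(2)[OF _ m]])
    then have qk: "q (A m) \<uplus> q ?k = q (A m)" using absorbs_iff[OF sA sk] by blast
    have qm: "q (A m) = q ((c \<oplus> ?s m) \<oplus> ext (k m))"
      using k(3)[OF m] q_eq[of "A m"] sA ss c(1) by simp
    \<comment> \<open>Replacing the single core by the sum of all cores enlarges the right-hand
      side, and the surplus is absorbed by \<open>A m\<close>.\<close>
    have "ext (k m) \<preceq> ?k"
    proof (rule leI[where R = "\<lambda>p x. p = \<langle>x, m\<rangle>"])
      show "D (\<lambda>s. s 0 = \<langle>s 1, m\<rangle>)" by (intro Dr)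
    qed (use sk m in auto)
    then have "(c \<oplus> ?s m) \<oplus> ext (k m) \<preceq> (c \<oplus> ?s m) \<oplus> ?k"
      by (intro plus_mono le_refl small_plus c(1) ss small_ext sk)
    then have 1: "A m \<preceq> (c \<oplus> ?k) \<oplus> ?s m"
      by (rule le_cong[rotated -1]) (use qm sA ss sk c(1) in \<open>auto simp: q_plus padd_ac\<close>)
    have "c \<oplus> ?s m \<preceq> (c \<oplus> ?s m) \<oplus> ext (k m)" by (intro le_plus1 small_plus c(1) ss small_ext)
    then have "(c \<oplus> ?s m) \<oplus> ?k \<preceq> ((c \<oplus> ?s m) \<oplus> ext (k m)) \<oplus> ?k"
      by (rule plus_mono[rotated 4]) (intro le_refl small_plus c(1) ss small_ext sk)+
    then have "(c \<oplus> ?k) \<oplus> ?s m \<preceq> A m"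
    proof (rule le_cong[rotated -1])
      show "q (((c \<oplus> ?s m) \<oplus> ext (k m)) \<oplus> ?k) = q (A m)"
        using qk qm sA ss sk c(1) by (simp add: q_plus)
    qed (use sA ss sk c(1) in \<open>auto simp: q_plus padd_ac\<close>)
    then show ?thesis using 1 by (simp add: eqv_def)
  qed
  then show ?thesis using small_plus[OF c(1) sk] by blast
qed

end

theorem remainder:
  assumes A: "fam A" and B: "fam B" and e: "\<And>n. n \<in> N \<Longrightarrow> A n \<approx> A (sc n) \<oplus> B n"
  shows "\<exists>c. small c \<and> (\<forall>m\<in>N. A m \<approx> c \<oplus> SG (\<lambda>n. B (ad m n)))"
proof -
  have "fam (\<lambda>n. A (sc n))" by (rule fam_comp[OF A]) (intro Dr)
  then have AB: "fam (\<lambda>n. A (sc n) \<oplus> B n)" using B by (rule fam_plus)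
  obtain h where h: "Dt (\<lambda>s. h (s 0))"
    "\<And>n. n \<in> N \<Longrightarrow> onto (\<lambda>x y. \<langle>x, y\<rangle> \<epsilon> h n) (A n) (A (sc n) \<oplus> B n)"
    using choose_onto[OF AB A] e unfolding eqv_def by blast
  obtain k where k: "Dt (\<lambda>s. k (s 0))"
    "\<And>n. n \<in> N \<Longrightarrow> onto (\<lambda>x y. \<langle>x, y\<rangle> \<epsilon> k n) (A (sc n) \<oplus> B n) (A n)"
    using choose_onto[OF A AB] e unfolding eqv_def by blast
  have D: "D (\<lambda>s. \<langle>s 1, s 2\<rangle> \<epsilon> h (s 0))" "D (\<lambda>s. \<langle>s 1, s 2\<rangle> \<epsilon> k (s 0))"
    by (intro Dr Dt_app1[OF h(1)] Dt_app1[OF k(1)])+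
  have "surj_pair (\<lambda>x y. \<langle>x, y\<rangle> \<epsilon> h m) (\<lambda>x y. \<langle>x, y\<rangle> \<epsilon> k m) (A m) (A (sc m) \<oplus> B m)" if "m \<in> N" for m
    using h(2)[OF that] k(2)[OF that] fam_small[OF A] fam_small[OF B]
    unfolding surj_pair_def D2_def by (auto intro!: Dr)
  from remainder_pairs[OF A B D this] show ?thesis .
qed

end

context zf
begin

section \<open>Cardinals and surjective cardinals\<close>

text \<open>Equipotence expressed through pairs alone, without \<open>app\<close>,
  \<open>domain_of\<close> and \<open>range_of\<close>, so that the classes defined from it are seen
  to be definable.\<close>

definition eqp :: "'a \<Rightarrow> 'a \<Rightarrow> bool" where
  "eqp X Y \<longleftrightarrow> (\<exists>f. is_function mem f \<and> (\<forall>x. x \<epsilon> X \<longleftrightarrow> (\<exists>y. \<langle>x, y\<rangle> \<epsilon> f)) \<and> (\<forall>y. y \<epsilon> Y \<longleftrightarrow> (\<exists>x. \<langle>x, y\<rangle> \<epsilon> f)) \<and>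
    (\<forall>x x' y. \<langle>x, y\<rangle> \<epsilon> f \<longrightarrow> \<langle>x', y\<rangle> \<epsilon> f \<longrightarrow> x = x'))"

lemma D_eqp [Dr]: "Dt t \<Longrightarrow> Dt u \<Longrightarrow> D (\<lambda>s. eqp (t s) (u s))"
  by (rule D_app2) (unfold eqp_def, intro Dr)

lemma domain_eq: "is_function mem f \<Longrightarrow> domain_of mem f = X \<longleftrightarrow> (\<forall>x. x \<epsilon> X \<longleftrightarrow> (\<exists>y. \<langle>x, y\<rangle> \<epsilon> f))"
  using extensional[of "domain_of mem f" X] by (auto simp: domain_of_iff)

lemma range_eq: "is_function mem f \<Longrightarrow> range_of mem f = Y \<longleftrightarrow> (\<forall>y. y \<epsilon> Y \<longleftrightarrow> (\<exists>x. \<langle>x, y\<rangle> \<epsilon> f))"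
  using extensional[of "range_of mem f" Y] by (auto simp: range_of_iff)

lemma equipotent_eqp: "equipotent mem X Y \<longleftrightarrow> eqp X Y"
proof -
  have "(\<forall>x x'. x \<epsilon> X \<and> x' \<epsilon> X \<and> app mem f x = app mem f x' \<longrightarrow> x = x') \<longleftrightarrow>
      (\<forall>x x' y. \<langle>x, y\<rangle> \<epsilon> f \<longrightarrow> \<langle>x', y\<rangle> \<epsilon> f \<longrightarrow> x = x')"
    if f: "is_function mem f" and d: "\<forall>x. x \<epsilon> X \<longleftrightarrow> (\<exists>y. \<langle>x, y\<rangle> \<epsilon> f)" for f
  proof -
    have "\<langle>x, y\<rangle> \<epsilon> f \<longleftrightarrow> x \<epsilon> X \<and> app mem f x = y" for x y
      using app_eq[OF f] app_in[OF f] d domain_of_iff[OF f] by metis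
    then show ?thesis by auto
  qed
  note inj = this
  have chain: "(P \<Longrightarrow> d = d') \<Longrightarrow> (P \<Longrightarrow> r = r') \<Longrightarrow> (P \<Longrightarrow> d' \<Longrightarrow> i = i') \<Longrightarrow>
      (P \<and> d \<and> r \<and> i) = (P \<and> d' \<and> r' \<and> i')" for P d d' r r' i i' by blast
  show ?thesis unfolding equipotent_def eqp_def
    by (rule arg_cong[where f = Ex], rule HOL.ext, rule chain, erule domain_eq, erule range_eq, erule inj)
qed

lemma eqpI:
  assumes "small A" "small B" "D2 R" "\<And>x. x \<in> A \<Longrightarrow> \<exists>y\<in>B. R x y" "\<And>y. y \<in> B \<Longrightarrow> \<exists>x\<in>A. R x y"
    and "\<And>x y z. x \<in> A \<Longrightarrow> y \<in> B \<Longrightarrow> z \<in> B \<Longrightarrow> R x y \<Longrightarrow> R x z \<Longrightarrow> y = z"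
    and "\<And>x x' y. x \<in> A \<Longrightarrow> x' \<in> A \<Longrightarrow> y \<in> B \<Longrightarrow> R x y \<Longrightarrow> R x' y \<Longrightarrow> x = x'"
  shows "eqp (coll A) (coll B)"
proof -
  have "D (\<lambda>s. s 0 \<in> A \<and> s 1 \<in> B \<and> R (s 0) (s 1))"
    by (intro Dr D2D[OF assms(3)] D_small[OF assms(1)] D_small[OF assms(2)])
  from small_rel[of A B "\<lambda>x y. x \<in> A \<and> y \<in> B \<and> R x y", OF assms(1,2) this]
  obtain r where r: "\<And>x y. \<langle>x, y\<rangle> \<epsilon> r \<longleftrightarrow> x \<in> A \<and> y \<in> B \<and> R x y"
    "\<forall>p. p \<epsilon> r \<longrightarrow> (\<exists>x y. p = \<langle>x, y\<rangle>)" by auto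
  have "is_function mem r" unfolding is_function_def using r assms(6) by blast
  then show ?thesis unfolding eqp_def mem_coll[OF assms(1)] mem_coll[OF assms(2)]
    using assms(4,5,7) by (intro exI[of _ r]) (simp add: r(1), blast)
qed

definition bijr :: "('a \<Rightarrow> 'a \<Rightarrow> bool) \<Rightarrow> 'a \<Rightarrow> 'a \<Rightarrow> bool" where
  "bijr R X Y \<longleftrightarrow> (\<forall>x. x \<epsilon> X \<longleftrightarrow> (\<exists>y. R x y)) \<and> (\<forall>y. y \<epsilon> Y \<longleftrightarrow> (\<exists>x. R x y)) \<and>
    (\<forall>x x' y. R x y \<longrightarrow> R x' y \<longrightarrow> x = x') \<and> (\<forall>x y z. R x y \<longrightarrow> R x z \<longrightarrow> y = z)"

lemma bijrD:
  assumes "bijr R X Y"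
  shows "\<And>x y. R x y \<Longrightarrow> x \<epsilon> X \<and> y \<epsilon> Y" "\<And>x. x \<epsilon> X \<Longrightarrow> \<exists>y. R x y" "\<And>y. y \<epsilon> Y \<Longrightarrow> \<exists>x. R x y"
    "\<And>x y z. R x y \<Longrightarrow> R x z \<Longrightarrow> y = z" "\<And>x x' y. R x y \<Longrightarrow> R x' y \<Longrightarrow> x = x'"
  using assms unfolding bijr_def by metis+

lemma eqp_bijr:
  assumes "eqp X Y"
  shows "\<exists>f. bijr (\<lambda>x y. \<langle>x, y\<rangle> \<epsilon> f) X Y"
proof -
  from assms[unfolded eqp_def] obtain f where f: "is_function mem f"
    and "\<forall>x. x \<epsilon> X \<longleftrightarrow> (\<exists>y. \<langle>x, y\<rangle> \<epsilon> f)" "\<forall>y. y \<epsilon> Y \<longleftrightarrow> (\<exists>x. \<langle>x, y\<rangle> \<epsilon> f)"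
      "\<forall>x x' y. \<langle>x, y\<rangle> \<epsilon> f \<longrightarrow> \<langle>x', y\<rangle> \<epsilon> f \<longrightarrow> x = x'"
    by (elim exE conjE) (rule that)
  moreover have "\<forall>x y z. \<langle>x, y\<rangle> \<epsilon> f \<longrightarrow> \<langle>x, z\<rangle> \<epsilon> f \<longrightarrow> y = z"
    by (intro allI impI) (rule is_functionD[OF f])
  ultimately show ?thesis unfolding bijr_def by (intro exI[of _ f] conjI)
qed

lemma eqpE:
  assumes "eqp X Y"
  obtains R where "D2 R" "bijr R X Y"
proof -
  obtain f where f: "bijr (\<lambda>x y. \<langle>x, y\<rangle> \<epsilon> f) X Y" using eqp_bijr[OF assms] by (rule exE)
  have "D2 (\<lambda>x y. \<langle>x, y\<rangle> \<epsilon> f)" unfolding D2_def by (intro Dr)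
  then show ?thesis using that f by blast
qed

lemma eqp_refl: "eqp X X"
proof -
  have "D2 (=)" unfolding D2_def by (intro Dr)
  then have "eqp (coll (ext X)) (coll (ext X))" by (rule eqpI[OF small_ext small_ext]) auto
  then show ?thesis by simp
qed

lemma eqp_sym:
  assumes "eqp X Y"
  shows "eqp Y X"
proof -
  obtain R where R0: "D2 R" "bijr R X Y" by (rule eqpE[OF assms])
  note R = R0(1) bijrD[OF R0(2)]
  have "D2 (\<lambda>y x. R x y)" unfolding D2_def by (intro D2D[OF R(1)] Dr)
  then have "eqp (coll (ext Y)) (coll (ext X))"
  proof (rule eqpI[OF small_ext small_ext])
    show "\<exists>y\<in>ext X. R y x" if "x \<in> ext Y" for x using that R(2,4) unfolding Bex_def ext_iff by metis
    show "\<exists>x\<in>ext Y. R y x" if "y \<in> ext X" for y using that R(2,3) unfolding Bex_def ext_iff by metis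
  qed (use R(5,6) in blast)+
  then show ?thesis by simp
qed

lemma eqp_trans:
  assumes "eqp X Y" "eqp Y Z"
  shows "eqp X Z"
proof -
  obtain R where R0: "D2 R" "bijr R X Y" by (rule eqpE[OF assms(1)])
  note R = R0(1) bijrD[OF R0(2)]
  obtain S where S0: "D2 S" "bijr S Y Z" by (rule eqpE[OF assms(2)])
  note S = S0(1) bijrD[OF S0(2)]
  have D: "D2 (\<lambda>x z. \<exists>y. R x y \<and> S y z)" unfolding D2_def by (intro D2D[OF R(1)] D2D[OF S(1)] Dr)
  have "eqp (coll (ext X)) (coll (ext Z))"
  proof (rule eqpI[OF small_ext small_ext D])
    show "\<exists>z\<in>ext Z. \<exists>y. R x y \<and> S y z" if "x \<in> ext X" for x
      using that R(2,3) S(2,3) unfolding Bex_def ext_iff by metis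
    show "\<exists>x\<in>ext X. \<exists>y. R x y \<and> S y z" if "z \<in> ext Z" for z
      using that R(2,4) S(2,4) unfolding Bex_def ext_iff by metis
    show "y = z" if "\<exists>w. R x w \<and> S w y" "\<exists>w. R x w \<and> S w z" for x y z
      using that R(5) S(5) by metis
    show "x = x'" if "\<exists>w. R x w \<and> S w y" "\<exists>w. R x' w \<and> S w y" for x x' y
      using that R(6) S(6) by metis
  qed
  then show ?thesis by simp
qed

lemma eqp_le:
  assumes "eqp X Y"
  shows "ext Y \<preceq> ext X"
proof -
  obtain R where R0: "D2 R" "bijr R X Y" by (rule eqpE[OF assms])
  note R = R0(1) bijrD[OF R0(2)]
  show ?thesis
  proof (rule leI[OF small_ext small_ext])
    show "D (\<lambda>s. R (s 0) (s 1))" using R(1) unfolding D2_def .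
    show "\<exists>x\<in>ext X. R x y" if "y \<in> ext Y" for y using that R(2,4) unfolding Bex_def ext_iff by metis
  qed (use R(5) in blast)
qed

lemma eqp_eqv: "eqp X Y \<Longrightarrow> ext X \<approx> ext Y"
  unfolding eqv_def using eqp_le eqp_sym by blast

lemma card_of_scott: "card_of mem X = scott mem (eqp X)"
  unfolding card_of_def equipotent_eqp ..

lemma Dt_card_of [Dr]: "Dt t \<Longrightarrow> Dt (\<lambda>s. card_of mem (t s))"
  by (rule Dt_app1) (unfold card_of_scott, intro Dt_scott Dr)

text \<open>The set of minimal representatives is not empty, so equal cardinals share a member to
  which both sets are equipotent.\<close>

lemma card_of_eq: "card_of mem X = card_of mem Y \<longleftrightarrow> eqp X Y"
proof
  have D: "D (\<lambda>s. eqp Z (s 0))" for Z by (intro Dr)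
  assume "card_of mem X = card_of mem Y"
  then have e: "scott mem (eqp X) = scott mem (eqp Y)" unfolding card_of_scott .
  obtain Z where Z: "Z \<epsilon> scott mem (eqp X)" "eqp X Z" using scott_nonempty[of "eqp X", OF D eqp_refl] by blast
  then have "eqp Y Z" using in_scott[of "eqp Y", OF D eqp_refl, of Z] e by simp
  then show "eqp X Y" using Z(2) eqp_sym eqp_trans by blast
next
  assume "eqp X Y"
  then have "eqp X = eqp Y" using eqp_sym eqp_trans by blast
  then show "card_of mem X = card_of mem Y" unfolding card_of_scott by simp
qed

lemma partial_surjection_le: "(\<exists>f. partial_surjection mem f X Y) \<longleftrightarrow> ext Y \<preceq> ext X"
proof
  assume "\<exists>f. partial_surjection mem f X Y"
  then obtain f where f: "is_function mem f" "subset_of mem (domain_of mem f) X" "range_of mem f = Y"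
    unfolding partial_surjection_def by blast
  then have "onto (\<lambda>x y. \<langle>x, y\<rangle> \<epsilon> f) (ext X) (ext Y)"
    using domain_of_iff[OF f(1)] range_of_iff[OF f(1)] is_functionD[OF f(1)]
    unfolding onto_def subset_of_def by auto
  then show "ext Y \<preceq> ext X" unfolding le_def by blast
next
  assume "ext Y \<preceq> ext X"
  then obtain R where R: "D2 R" "onto R (ext X) (ext Y)" using le_onto by blast
  then obtain r where r: "\<And>x y. \<langle>x, y\<rangle> \<epsilon> r \<longleftrightarrow> R x y" "\<forall>p. p \<epsilon> r \<longrightarrow> (\<exists>x y. p = \<langle>x, y\<rangle>)"
    using small_rel[OF small_ext small_ext, of R X Y] unfolding D2_def onto_def by auto
  have f: "is_function mem r" unfolding is_function_def r(1) using r(2) R(2) unfolding onto_def by blast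
  have "partial_surjection mem r X Y"
    unfolding partial_surjection_def subset_of_def range_eq[OF f] domain_of_iff[OF f] r(1)
    using f R(2) unfolding onto_def by auto
  then show "\<exists>f. partial_surjection mem f X Y" by blast
qed

lemma eq_star_iff: "eq_star mem a b \<longleftrightarrow> (\<exists>X Y. card_of mem X = a \<and> card_of mem Y = b \<and> ext Y \<preceq> ext X \<and> ext X \<preceq> ext Y)"
  unfolding eq_star_def partial_surjection_le ..

text \<open>Equipotent sets are surjective images of each other, so the choice of representatives in
  \<open>eq_star\<close> does not matter.\<close>

lemma eq_star_card: "eq_star mem (card_of mem X) (card_of mem Y) \<longleftrightarrow> ext X \<approx> ext Y"
proof
  assume "eq_star mem (card_of mem X) (card_of mem Y)"
  then obtain X' Y' where e: "eqp X' X" "eqp Y' Y" "ext X' \<approx> ext Y'"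
    unfolding eq_star_iff card_of_eq eqv_def by blast
  then show "ext X \<approx> ext Y" using eqp_eqv eqv_sym eqv_trans small_ext by metis
next
  assume "ext X \<approx> ext Y"
  then show "eq_star mem (card_of mem X) (card_of mem Y)" unfolding eq_star_iff eqv_def by blast
qed

lemma D_eq_star [Dr]: "Dt t \<Longrightarrow> Dt u \<Longrightarrow> D (\<lambda>s. eq_star mem (t s) (u s))"
  by (rule D_app2) (unfold eq_star_iff, intro Dr D_le_ext)

lemma D_cardinal [Dr]: "Dt t \<Longrightarrow> D (\<lambda>s. cardinal mem (t s))"
  by (rule D_app1) (unfold cardinal_def, intro Dr)

definition surj_card :: "'a set \<Rightarrow> 'a" where
  "surj_card A = surj_class mem (card_of mem (coll A))"

lemma Dt_surj_class [Dr]: "Dt t \<Longrightarrow> Dt (\<lambda>s. surj_class mem (t s))"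
  by (rule Dt_app1) (unfold surj_class_def, intro Dt_scott Dr)

lemma surj_class_eq: "surj_class mem (card_of mem X) = surj_class mem (card_of mem Y) \<longleftrightarrow> ext X \<approx> ext Y"
proof -
  let ?P = "\<lambda>X b. cardinal mem b \<and> eq_star mem (card_of mem X) b"
  have D: "D (\<lambda>s. ?P Z (s 0))" for Z by (intro Dr)
  have P: "?P Z (card_of mem Z)" for Z
    unfolding eq_star_card cardinal_def using eqv_refl by auto
  show ?thesis
  proof
    assume "surj_class mem (card_of mem X) = surj_class mem (card_of mem Y)"
    then have e: "scott mem (?P X) = scott mem (?P Y)" unfolding surj_class_def .
    obtain b where b: "b \<epsilon> scott mem (?P X)" "?P X b" using scott_nonempty[of "?P X", OF D P] by blast
    then have "?P Y b" using in_scott[of "?P Y", OF D P, of b] e by simp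
    then obtain Z where "b = card_of mem Z" "ext X \<approx> ext Z" "ext Y \<approx> ext Z"
      using b(2) eq_star_card unfolding cardinal_def by blast
    then show "ext X \<approx> ext Y" using eqv_sym eqv_trans small_ext by metis
  next
    assume e: "ext X \<approx> ext Y"
    have "?P X b \<longleftrightarrow> ?P Y b" for b
    proof (cases "cardinal mem b")
      case True
      then obtain Z where "b = card_of mem Z" unfolding cardinal_def by blast
      then show ?thesis using e eq_star_card eqv_sym eqv_trans small_ext by metis
    qed simp
    then show "surj_class mem (card_of mem X) = surj_class mem (card_of mem Y)"
      unfolding surj_class_def by simp
  qed
qed

lemma surj_card_eq: "small A \<Longrightarrow> small B \<Longrightarrow> surj_card A = surj_card B \<longleftrightarrow> A \<approx> B"
  unfolding surj_card_def surj_class_eq by (simp add: ext_coll)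

lemma surj_card_ext: "surj_card (ext X) = surj_class mem (card_of mem X)"
  by (simp add: surj_card_def)

lemma surjective_cardinal_iff: "surjective_cardinal mem S \<longleftrightarrow> (\<exists>X. S = surj_card (ext X))"
  unfolding surjective_cardinal_def cardinal_def surj_card_ext by blast

lemma surjective_cardinal_surj_card: "surjective_cardinal mem (surj_card A)"
  unfolding surjective_cardinal_def cardinal_def surj_card_def by blast

text \<open>The description denotes only if all representatives give the same cardinal; the two
  bijections between representatives are combined separately on each tag.\<close>

lemma card_add_eq: "card_add mem (card_of mem X) (card_of mem Y) = card_of mem (coll (ext X \<oplus> ext Y))"
proof -
  have set: "the_set mem (\<lambda>p. (\<exists>x. x \<epsilon> X \<and> p = \<langle>x, z0\<rangle>) \<or> (\<exists>y. y \<epsilon> Y \<and> p = \<langle>y, z1\<rangle>)) = coll (ext X \<oplus> ext Y)" for X Y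
    unfolding the_set_coll plus_def by simp
  have "eqp (coll (ext X' \<oplus> ext Y')) (coll (ext X \<oplus> ext Y))" if e1: "eqp X' X" and e2: "eqp Y' Y" for X' Y'
  proof -
    obtain R where R0: "D2 R" "bijr R X' X" by (rule eqpE[OF e1])
  note R = R0(1) bijrD[OF R0(2)]
    obtain S where S0: "D2 S" "bijr S Y' Y" by (rule eqpE[OF e2])
  note S = S0(1) bijrD[OF S0(2)]
    let ?R = "\<lambda>p r. (\<exists>x y. p = \<langle>x, z0\<rangle> \<and> r = \<langle>y, z0\<rangle> \<and> R x y) \<or> (\<exists>x y. p = \<langle>x, z1\<rangle> \<and> r = \<langle>y, z1\<rangle> \<and> S x y)"
    have D: "D2 ?R" unfolding D2_def by (intro Dr D2D[OF R(1)] D2D[OF S(1)])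
    show ?thesis
    proof (rule eqpI[OF _ _ D])
      show "\<exists>r\<in>ext X \<oplus> ext Y. ?R p r" if "p \<in> ext X' \<oplus> ext Y'" for p
        using that
      proof (cases rule: plusE)
        case (1 x)
        then obtain y where "R x y" using R(3) by auto
        then show ?thesis using 1 R(2) by (intro bexI[of _ "\<langle>y, z0\<rangle>"]) auto
      next
        case (2 x)
        then obtain y where "S x y" using S(3) by auto
        then show ?thesis using 2 S(2) by (intro bexI[of _ "\<langle>y, z1\<rangle>"]) auto
      qed
      show "\<exists>p\<in>ext X' \<oplus> ext Y'. ?R p r" if "r \<in> ext X \<oplus> ext Y" for r
        using that
      proof (cases rule: plusE)
        case (1 y)
        then obtain x where "R x y" using R(4) by auto
        then show ?thesis using 1 R(2) by (intro bexI[of _ "\<langle>x, z0\<rangle>"]) auto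
      next
        case (2 y)
        then obtain x where "S x y" using S(4) by auto
        then show ?thesis using 2 S(2) by (intro bexI[of _ "\<langle>x, z1\<rangle>"]) auto
      qed
    qed (use R(5,6) S(5,6) in auto)
  qed
  note eq = this
  show ?thesis unfolding card_add_def set
  proof (rule the_equality)
    show "\<exists>X' Y'. card_of mem X' = card_of mem X \<and> card_of mem Y' = card_of mem Y \<and>
        card_of mem (coll (ext X \<oplus> ext Y)) = card_of mem (coll (ext X' \<oplus> ext Y'))" by blast
  qed (use eq in \<open>auto simp: card_of_eq\<close>)
qed

lemma surj_add_surj_card: "small A \<Longrightarrow> small B \<Longrightarrow> surj_add mem (surj_card A) (surj_card B) = surj_card (A \<oplus> B)"
proof -
  assume s: "small A" "small B"
  have "surj_class mem (card_add mem a b) = surj_card (A \<oplus> B)"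
    if ab: "cardinal mem a" "cardinal mem b" "surj_class mem a = surj_card A" "surj_class mem b = surj_card B" for a b
  proof -
    obtain X Y where X: "a = card_of mem X" "b = card_of mem Y" using ab unfolding cardinal_def by blast
    then have "surj_card (ext X) = surj_card A" "surj_card (ext Y) = surj_card B" using ab by (simp_all add: surj_card_ext)
    then have "ext X \<oplus> ext Y \<approx> A \<oplus> B" using s by (simp add: surj_card_eq plus_cong)
    then show ?thesis unfolding X card_add_eq surj_card_def[symmetric] using s by (simp add: surj_card_eq)
  qed
  moreover have "cardinal mem (card_of mem (coll A))" for A unfolding cardinal_def by blast
  ultimately show ?thesis unfolding surj_add_def
  proof (intro the_equality, goal_cases)
    case 1
    show ?case
      by (rule exI[of _ "card_of mem (coll A)"], rule exI[of _ "card_of mem (coll B)"])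
        (use 1 in \<open>simp flip: surj_card_def\<close>)
  next
    case (2 C)
    then show ?case by blast
  qed
qed

lemma seq_of_cong: "(\<And>n. n \<in> N \<Longrightarrow> t n = t' n) \<Longrightarrow> seq_of mem t = seq_of mem t'"
proof -
  assume "\<And>n. n \<in> N \<Longrightarrow> t n = t' n"
  then have "(\<lambda>p. \<exists>n. n \<epsilon> omega mem \<and> p = \<langle>n, t n\<rangle>) = (\<lambda>p. \<exists>n. n \<epsilon> omega mem \<and> p = \<langle>n, t' n\<rangle>)"
    by (auto simp: fun_eq_iff)
  then show ?thesis unfolding seq_of_def by simp
qed

end

section \<open>Countable sums of representatives and the postulates\<close>

context zf_ac
begin

text \<open>Independence of the representatives takes a whole sequence of bijections, which
  countable choice provides.\<close>

lemma card_sum_eq: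
  assumes "Dt (\<lambda>s. G (s 0))" "sequence mem a" "\<And>n. n \<in> N \<Longrightarrow> app mem a n = card_of mem (G n)"
  shows "card_sum mem a = card_of mem (coll (SG (\<lambda>n. ext (G n))))"
proof -
  have set: "the_set mem (\<lambda>p. \<exists>n x. n \<epsilon> omega mem \<and> x \<epsilon> app mem X n \<and> p = \<langle>x, n\<rangle>) = coll (SG (\<lambda>n. ext (F n)))"
    if "\<And>n. n \<in> N \<Longrightarrow> F n = app mem X n" for X F
  proof -
    have "{p. \<exists>n x. n \<epsilon> omega mem \<and> x \<epsilon> app mem X n \<and> p = \<langle>x, n\<rangle>} = SG (\<lambda>n. ext (F n))"
      using that unfolding SG_def by auto
    then show ?thesis unfolding the_set_coll by simp
  qed
  have eq: "eqp (coll (SG (\<lambda>n. ext (F n)))) (coll (SG (\<lambda>n. ext (G n))))"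
    if F: "Dt (\<lambda>s. F (s 0))" "\<And>n. n \<in> N \<Longrightarrow> eqp (F n) (G n)" for F
  proof -
    have "D (\<lambda>s. bijr (\<lambda>x y. \<langle>x, y\<rangle> \<epsilon> s 1) (F (s 0)) (G (s 0)))"
      unfolding bijr_def by (intro Dr Dt_app1[OF F(1)] Dt_app1[OF assms(1)])
    from choice[of "\<lambda>n f. bijr (\<lambda>x y. \<langle>x, y\<rangle> \<epsilon> f) (F n) (G n)", OF AC this eqp_bijr[OF F(2)]]
    obtain h where h: "Dt (\<lambda>s. h (s 0))" "\<And>n. n \<in> N \<Longrightarrow> bijr (\<lambda>x y. \<langle>x, y\<rangle> \<epsilon> h n) (F n) (G n)" by blast
    note h1 = bijrD[OF h(2)]
    let ?R = "\<lambda>p r. \<exists>n x y. n \<in> N \<and> p = \<langle>x, n\<rangle> \<and> r = \<langle>y, n\<rangle> \<and> \<langle>x, y\<rangle> \<epsilon> h n"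
    have D: "D2 ?R" unfolding D2_def by (intro Dr Dt_app1[OF h(1)])
    show ?thesis
    proof (rule eqpI[OF _ _ D])
      show "small (SG (\<lambda>n. ext (F n)))" "small (SG (\<lambda>n. ext (G n)))"
        by (intro small_SG fam_ext F(1) assms(1))+
      show "\<exists>r\<in>SG (\<lambda>n. ext (G n)). ?R p r" if p: "p \<in> SG (\<lambda>n. ext (F n))" for p
      proof -
        obtain n x where n: "n \<in> N" "x \<epsilon> F n" "p = \<langle>x, n\<rangle>" using p by (auto simp: SG_iff)
        then obtain y where y: "\<langle>x, y\<rangle> \<epsilon> h n" using h1(2)[OF n(1)] by blast
        then have "y \<epsilon> G n" using h1(1)[OF n(1)] by blast
        then show ?thesis using n y by (intro bexI[of _ "\<langle>y, n\<rangle>"]) auto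
      qed
      show "\<exists>p\<in>SG (\<lambda>n. ext (F n)). ?R p r" if r: "r \<in> SG (\<lambda>n. ext (G n))" for r
      proof -
        obtain n y where n: "n \<in> N" "y \<epsilon> G n" "r = \<langle>y, n\<rangle>" using r by (auto simp: SG_iff)
        then obtain x where x: "\<langle>x, y\<rangle> \<epsilon> h n" using h1(3)[OF n(1)] by blast
        then have "x \<epsilon> F n" using h1(1)[OF n(1)] by blast
        then show ?thesis using n x by (intro bexI[of _ "\<langle>x, n\<rangle>"]) auto
      qed
      show "y = z" if "?R x y" "?R x z" for x y z using that h1(4) by auto
      show "x = x'" if "?R x y" "?R x' y" for x x' y using that h1(5) by auto
    qed
  qed
  let ?Q = "\<lambda>c. \<exists>X. sequence mem X \<and> (\<forall>n. n \<epsilon> omega mem \<longrightarrow> card_of mem (app mem X n) = app mem a n) \<and>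
     c = card_of mem (the_set mem (\<lambda>p. \<exists>n x. n \<epsilon> omega mem \<and> x \<epsilon> app mem X n \<and> p = \<langle>x, n\<rangle>))"
  have "?Q (card_of mem (coll (SG (\<lambda>n. ext (G n)))))"
    using seq_of[OF assms(1)] assms(3) set[of G "seq_of mem G"]
    by (intro exI[of _ "seq_of mem G"]) simp
  moreover have "c = card_of mem (coll (SG (\<lambda>n. ext (G n))))" if "?Q c" for c
  proof -
    obtain X where X: "sequence mem X" "\<And>n. n \<in> N \<Longrightarrow> card_of mem (app mem X n) = app mem a n"
      "c = card_of mem (the_set mem (\<lambda>p. \<exists>n x. n \<epsilon> omega mem \<and> x \<epsilon> app mem X n \<and> p = \<langle>x, n\<rangle>))"
      using \<open>?Q c\<close> by auto
    obtain F where F: "Dt (\<lambda>s. F (s 0))" "\<And>n. n \<in> N \<Longrightarrow> F n = app mem X n" using sequence_term[OF X(1)] by blast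
    have "eqp (F n) (G n)" if "n \<in> N" for n
      using X(2)[OF that] F(2)[OF that] assms(3)[OF that] card_of_eq by metis
    then have "eqp (coll (SG (\<lambda>n. ext (F n)))) (coll (SG (\<lambda>n. ext (G n))))" by (rule eq[OF F(1)])
    moreover have "c = card_of mem (coll (SG (\<lambda>n. ext (F n))))"
      unfolding X(3) by (rule arg_cong[where f = "card_of mem"], rule set, rule F(2))
    ultimately show ?thesis by (simp add: card_of_eq)
  qed
  ultimately show ?thesis unfolding card_sum_def by (rule the_equality)
qed

text \<open>Any admissible sequence of cardinals is first represented by a chosen sequence of sets;
  termwise equivalence with \<open>G\<close> then passes to the sums by
  \<open>SG_cong\<close>.\<close>

lemma surj_sum_surj_card:
  assumes "Dt (\<lambda>s. G (s 0))" "sequence mem S" "\<And>n. n \<in> N \<Longrightarrow> app mem S n = surj_card (ext (G n))"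
  shows "surj_sum mem S = surj_card (SG (\<lambda>n. ext (G n)))"
proof -
  let ?Q = "\<lambda>C. \<exists>a. sequence mem a \<and>
     (\<forall>n. n \<epsilon> omega mem \<longrightarrow> cardinal mem (app mem a n) \<and> surj_class mem (app mem a n) = app mem S n) \<and>
     C = surj_class mem (card_sum mem a)"
  have D: "Dt (\<lambda>s. card_of mem (G (s 0)))" by (intro Dr assms(1))
  note sq = seq_of[of "\<lambda>n. card_of mem (G n)", OF D]
  have "card_sum mem (seq_of mem (\<lambda>n. card_of mem (G n))) = card_of mem (coll (SG (\<lambda>n. ext (G n))))"
    by (rule card_sum_eq[OF assms(1) sq])
  then have "?Q (surj_card (SG (\<lambda>n. ext (G n))))"
    using sq assms(3) unfolding surj_card_def
    by (intro exI[of _ "seq_of mem (\<lambda>n. card_of mem (G n))"]) (auto simp: cardinal_def)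
  moreover have "C = surj_card (SG (\<lambda>n. ext (G n)))" if "?Q C" for C
  proof -
    obtain a where a: "sequence mem a" "\<And>n. n \<in> N \<Longrightarrow> cardinal mem (app mem a n)"
      "\<And>n. n \<in> N \<Longrightarrow> surj_class mem (app mem a n) = app mem S n" "C = surj_class mem (card_sum mem a)"
      using \<open>?Q C\<close> by auto
    obtain F where F: "Dt (\<lambda>s. F (s 0))" "\<And>n. n \<in> N \<Longrightarrow> F n = app mem a n" using sequence_term[OF a(1)] by blast
    have "D (\<lambda>s. F (s 0) = card_of mem (s 1))" by (intro Dr F(1))
    moreover have "\<exists>X. F n = card_of mem X" if "n \<in> N" for n
      using a(2)[OF that] F(2)[OF that] unfolding cardinal_def by simp
    ultimately obtain X where X: "Dt (\<lambda>s. X (s 0))" "\<And>n. n \<in> N \<Longrightarrow> F n = card_of mem (X n)"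
      using choice[of "\<lambda>n X. F n = card_of mem X", OF AC] by blast
    have "card_sum mem a = card_of mem (coll (SG (\<lambda>n. ext (X n))))"
      by (rule card_sum_eq[OF X(1) a(1)]) (use F(2) X(2) in simp)
    then have C: "C = surj_card (SG (\<lambda>n. ext (X n)))" unfolding a(4) surj_card_def by simp
    have "ext (X n) \<approx> ext (G n)" if "n \<in> N" for n
    proof -
      have "surj_card (ext (X n)) = surj_card (ext (G n))"
        using a(3)[OF that] F(2)[OF that] X(2)[OF that] assms(3)[OF that] by (simp add: surj_card_ext)
      then show ?thesis by (simp add: surj_card_eq)
    qed
    then show ?thesis unfolding C
      using SG_cong[OF fam_ext[OF X(1)] fam_ext[OF assms(1)]] surj_card_eq
        small_SG[OF fam_ext[OF X(1)]] small_SG[OF fam_ext[OF assms(1)]] by blast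
  qed
  ultimately show ?thesis unfolding surj_sum_def by (rule the_equality)
qed

lemma representatives:
  assumes "sequence_in mem (surjective_cardinal mem) S"
  obtains G where "Dt (\<lambda>s. G (s 0))" "sequence mem S" "\<And>n. n \<in> N \<Longrightarrow> app mem S n = surj_card (ext (G n))"
proof -
  have S: "sequence mem S" "\<And>n. n \<in> N \<Longrightarrow> \<exists>X. app mem S n = surj_card (ext X)"
    using assms unfolding sequence_in_def surjective_cardinal_iff by auto
  obtain F where F: "Dt (\<lambda>s. F (s 0))" "\<And>n. n \<in> N \<Longrightarrow> F n = app mem S n" using sequence_term[OF S(1)] by blast
  have "D (\<lambda>s. F (s 0) = surj_card (ext (s 1)))" unfolding surj_card_ext by (intro Dr F(1))
  from choice[of "\<lambda>n X. F n = surj_card (ext X)", OF AC this] obtain G where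
    "Dt (\<lambda>s. G (s 0))" "\<And>n. n \<in> N \<Longrightarrow> F n = surj_card (ext (G n))" using S(2) F(2) by auto
  then show ?thesis using that S(1) F(2) by auto
qed

text \<open>Since \<open>seq_of\<close> evaluates \<open>t\<close> on \<open>N\<close> only,
  agreement there with a definable term suffices. This covers expressions built from
  \<open>app\<close>, whose values elsewhere are unspecified.\<close>

lemma surj_sum_seq_of:
  assumes "fam F" "\<And>n. n \<in> N \<Longrightarrow> t n = surj_card (F n)"
  shows "surj_sum mem (seq_of mem t) = surj_card (SG F)"
proof -
  have D: "Dt (\<lambda>s. coll (F (s 0)))" by (rule fam_Dt[OF assms(1) Dt_var])
  have D': "Dt (\<lambda>s. surj_card (F (s 0)))" unfolding surj_card_def by (intro Dr D)
  have "seq_of mem t = seq_of mem (\<lambda>n. surj_card (F n))" by (rule seq_of_cong[OF assms(2)])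
  then show ?thesis
    using surj_sum_surj_card[of "\<lambda>n. coll (F n)", OF D seq_of(1)[of "\<lambda>n. surj_card (F n)", OF D']]
      seq_of(2)[of "\<lambda>n. surj_card (F n)", OF D'] by (simp add: ext_coll fam_small[OF assms(1)])
qed

theorem surjective_cardinals_algebra:
  "surjective_cardinal_algebra mem (surjective_cardinal mem) (surj_add mem) (surj_sum mem)"
  unfolding surjective_cardinal_algebra_def
proof (intro conjI allI impI; (elim conjE)?)
  fix a b assume "surjective_cardinal mem a" "surjective_cardinal mem b"
  then show "surjective_cardinal mem (surj_add mem a b)"
    unfolding surjective_cardinal_iff[of a] surjective_cardinal_iff[of b]
    by (auto simp: surj_add_surj_card surjective_cardinal_surj_card)
next
  fix a assume a: "sequence_in mem (surjective_cardinal mem) a"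
  obtain G where "Dt (\<lambda>s. G (s 0))" "sequence mem a" "\<And>n. n \<in> N \<Longrightarrow> app mem a n = surj_card (ext (G n))"
    using representatives[OF a] by metis
  then show "surjective_cardinal mem (surj_sum mem a)"
    using surj_sum_surj_card[of G a] surjective_cardinal_surj_card by simp
next
  fix a assume a: "sequence_in mem (surjective_cardinal mem) a"
  obtain G where G: "Dt (\<lambda>s. G (s 0))" "sequence mem a" "\<And>n. n \<in> N \<Longrightarrow> app mem a n = surj_card (ext (G n))"
    using representatives[OF a] by metis
  have fG: "fam (\<lambda>n. ext (G n))" by (rule fam_ext[OF G(1)])
  have fS: "fam (\<lambda>n. ext (G (sc n)))" by (rule fam_comp[OF fG]) (intro Dr)
  have "surj_sum mem (seq_of mem (\<lambda>n. app mem a (sc n))) = surj_card (SG (\<lambda>n. ext (G (sc n))))"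
    by (rule surj_sum_seq_of[OF fS]) (use G(3) in simp)
  then show "surj_sum mem a = surj_add mem (app mem a z0) (surj_sum mem (seq_of mem (\<lambda>n. app mem a (sc n))))"
    using surj_sum_surj_card[OF G] G(3)[of z0] SG_split[OF fG] small_SG[OF fG] small_SG[OF fS]
    by (simp add: surj_add_surj_card surj_card_eq)
next
  fix a b assume "sequence_in mem (surjective_cardinal mem) a" "sequence_in mem (surjective_cardinal mem) b"
  then obtain G H where G: "Dt (\<lambda>s. G (s 0))" "sequence mem a" "\<And>n. n \<in> N \<Longrightarrow> app mem a n = surj_card (ext (G n))"
    and H: "Dt (\<lambda>s. H (s 0))" "sequence mem b" "\<And>n. n \<in> N \<Longrightarrow> app mem b n = surj_card (ext (H n))"
    using representatives by metis
  have f: "fam (\<lambda>n. ext (G n))" "fam (\<lambda>n. ext (H n))" using fam_ext[OF G(1)] fam_ext[OF H(1)] by blast+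
  have fp: "fam (\<lambda>n. ext (G n) \<oplus> ext (H n))" by (rule fam_plus[OF f])
  have "surj_sum mem (seq_of mem (\<lambda>n. surj_add mem (app mem a n) (app mem b n))) = surj_card (SG (\<lambda>n. ext (G n) \<oplus> ext (H n)))"
    by (rule surj_sum_seq_of[OF fp]) (use G(3) H(3) in \<open>simp add: surj_add_surj_card\<close>)
  then show "surj_sum mem (seq_of mem (\<lambda>n. surj_add mem (app mem a n) (app mem b n))) =
      surj_add mem (surj_sum mem a) (surj_sum mem b)"
    using surj_sum_surj_card[OF G] surj_sum_surj_card[OF H] SG_plus[OF f] small_SG[OF fp] small_SG[OF f(1)] small_SG[OF f(2)]
    by (simp add: surj_add_surj_card surj_card_eq)
next
  show "\<exists>z. surjective_cardinal mem z \<and>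
      (\<forall>a. surjective_cardinal mem a \<longrightarrow> surj_add mem a z = a \<and> surj_add mem z a = a)"
  proof (intro exI[of _ "surj_card {}"] conjI allI impI surjective_cardinal_surj_card)
    fix a assume "surjective_cardinal mem a"
    then obtain X where X: "a = surj_card (ext X)" unfolding surjective_cardinal_iff by blast
    have e: "ext X \<oplus> {} \<approx> ext X" by (rule plus_empty) simp
    then show "surj_add mem a (surj_card {}) = a" unfolding X by (simp add: surj_add_surj_card small_empty surj_card_eq)
    have "{} \<oplus> ext X \<approx> ext X \<oplus> {}" by (rule plus_commute) (simp_all add: small_empty)
    then have "{} \<oplus> ext X \<approx> ext X" using e eqv_trans small_plus small_empty small_ext by meson
    then show "surj_add mem (surj_card {}) a = a" unfolding X by (simp add: surj_add_surj_card small_empty surj_card_eq)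
  qed
next
  fix a1 a2 b1 b2 assume "surjective_cardinal mem a1" "surjective_cardinal mem a2"
    "surjective_cardinal mem b1" "surjective_cardinal mem b2" and e: "surj_add mem a1 a2 = surj_add mem b1 b2"
  then obtain A1 A2 B1 B2 where X: "a1 = surj_card (ext A1)" "a2 = surj_card (ext A2)" "b1 = surj_card (ext B1)" "b2 = surj_card (ext B2)"
    unfolding surjective_cardinal_iff by blast
  have "ext A1 \<oplus> ext A2 \<approx> ext B1 \<oplus> ext B2" using e unfolding X by (simp add: surj_add_surj_card surj_card_eq)
  from refinement[OF small_ext small_ext small_ext small_ext this]
  obtain C1 C2 C3 C4 where C: "small C1" "small C2" "small C3" "small C4"
    "ext A1 \<approx> C1 \<oplus> C2" "ext A2 \<approx> C3 \<oplus> C4" "ext B1 \<approx> C1 \<oplus> C3" "ext B2 \<approx> C2 \<oplus> C4" by blast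
  show "\<exists>c1 c2 c3 c4. surjective_cardinal mem c1 \<and> surjective_cardinal mem c2 \<and>
      surjective_cardinal mem c3 \<and> surjective_cardinal mem c4 \<and> a1 = surj_add mem c1 c2 \<and>
      a2 = surj_add mem c3 c4 \<and> b1 = surj_add mem c1 c3 \<and> b2 = surj_add mem c2 c4"
    unfolding X
    by (rule exI[of _ "surj_card C1"], rule exI[of _ "surj_card C2"], rule exI[of _ "surj_card C3"], rule exI[of _ "surj_card C4"])
      (use C in \<open>simp add: surj_add_surj_card surj_card_eq surjective_cardinal_surj_card\<close>)
next
  fix a b assume "sequence_in mem (surjective_cardinal mem) a" "sequence_in mem (surjective_cardinal mem) b"
    and e: "\<forall>n. n \<epsilon> omega mem \<longrightarrow> app mem a n = surj_add mem (app mem a (sc n)) (app mem b n)"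
  then obtain G H where G: "Dt (\<lambda>s. G (s 0))" "sequence mem a" "\<And>n. n \<in> N \<Longrightarrow> app mem a n = surj_card (ext (G n))"
    and H: "Dt (\<lambda>s. H (s 0))" "sequence mem b" "\<And>n. n \<in> N \<Longrightarrow> app mem b n = surj_card (ext (H n))"
    using representatives by metis
  have f: "fam (\<lambda>n. ext (G n))" "fam (\<lambda>n. ext (H n))" using fam_ext[OF G(1)] fam_ext[OF H(1)] by blast+
  have "ext (G n) \<approx> ext (G (sc n)) \<oplus> ext (H n)" if "n \<in> N" for n
  proof -
    have "surj_card (ext (G n)) = surj_card (ext (G (sc n)) \<oplus> ext (H n))"
      using e G(3) H(3) that by (simp add: surj_add_surj_card)
    then show ?thesis by (simp add: surj_card_eq)
  qed
  from remainder[OF f this] obtain c where c: "small c"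
    "\<And>m. m \<in> N \<Longrightarrow> ext (G m) \<approx> c \<oplus> SG (\<lambda>n. ext (H (ad m n)))" by blast
  show "\<exists>c. surjective_cardinal mem c \<and> (\<forall>m. m \<epsilon> omega mem \<longrightarrow>
      app mem a m = surj_add mem c (surj_sum mem (seq_of mem (\<lambda>n. app mem b (nat_add mem m n)))))"
  proof (intro exI[of _ "surj_card c"] conjI allI impI surjective_cardinal_surj_card)
    fix m assume m: "m \<epsilon> omega mem"
    have fm: "fam (\<lambda>n. ext (H (ad m n)))" by (rule fam_comp[OF f(2)]) (intro Dr)
    \<comment> \<open>The two additions can differ only off \<open>N\<close>, where
      \<open>seq_of\<close> does not look.\<close>
    have "nat_add mem m n = ad m n" if "n \<in> N" for n using that by (simp add: ad_def)
    then have "surj_sum mem (seq_of mem (\<lambda>n. app mem b (nat_add mem m n))) = surj_card (SG (\<lambda>n. ext (H (ad m n))))"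
      using H(3) m by (intro surj_sum_seq_of[OF fm]) simp
    then show "app mem a m = surj_add mem (surj_card c) (surj_sum mem (seq_of mem (\<lambda>n. app mem b (nat_add mem m n))))"
      using G(3)[of m] c(2)[of m] m c(1) small_SG[OF fm] by (simp add: surj_add_surj_card surj_card_eq)
  qed
qed

end

theorem theorem2p11:
  fixes mem :: "'a \<Rightarrow> 'a \<Rightarrow> bool"
  assumes "ZF mem" and "AC_omega mem"
  shows "surjective_cardinal_algebra mem
           (surjective_cardinal mem) (surj_add mem) (surj_sum mem)"
proof -
  interpret zf_ac mem by unfold_locales (rule assms)+
  show ?thesis by (rule surjective_cardinals_algebra)
qed

end
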